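(* There exists a universal constant $M>0$ such that the following holds. Suppose that: (1) the learning rule $\Psi_\alpha$ is an empirical conditional risk minimizer, i.e. $\Psi_\alpha(S)\in\arg\min_{g\in\mathcal G}\widehat{\mathcal R}_\alpha(g,S)$ for every training index set $S$; (2) the class of functions $\{z\mapsto c(g,z):g\in\mathcal G\}$ has finite VC-dimension $\mathcal V_{\mathcal G}$; (3) $0\le c(g,z)\le1$ for all $(g,z)\in\mathcal G\times\mathcal Z$. Let $K\ge2$ divide $n$ and let $V_{1:K}^{\mathrm{K\text{-}fold}}$ be the $K$-fold validation sets. Then for every $\delta\in(0,1)$, with probability at least $1-15\delta$, $$\Big|\widehat{\mathcal R}_{CV,\alpha}(\Psi_\alpha,V_{1:K}^{\mathrm{K\text{-}fold}})-\mathcal R_\alpha\big(\Psi_\alpha(S_n)\big)\Big|\le E_{\mathrm{K\text{-}fold}}(n,K,\alpha)+\frac{20}{3n\alpha}\log\Big(\frac1\delta\Big)+20\sqrt{\frac{2}{n\alpha}\log\Big(\frac1\delta\Big)},$$ with $$E_{\mathrm{K\text{-}fold}}(n,K,\alpha)=5M\sqrt{\frac{\mathcal V_{\mathcal G}K}{n\alpha}}+\frac{5K}{(K-1)n\alpha}.$$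
   Context: Let $\mathcal X\subset\mathbb R^d$, $\mathcal Z=\mathcal X\times\{-1,1\}$, and let $\|\cdot\|$ be a norm on $\mathcal X$. Let $Z=(X,Y)$ be a random element of $\mathcal Z$ and $Z_i=(X_i,Y_i)$, $i=1,\dots,n$, i.i.d. copies of $Z$; $S_n=\{1,\dots,n\}$. Let $\alpha=k/n\in(0,1]$ with $k$ a positive integer, and let $t_\alpha$ be the $(1-\alpha)$-quantile of $\|X\|$, with $\mathbb P(\|X\|\ge t_\alpha)=\alpha$. Let $\mathcal G$ be a class of functions $g:\mathcal X\to\mathbb R$ and $c:\mathcal G\times\mathcal Z\to\mathbb R$ a cost function, with $c(g,(x,y))$ depending on $g$ through $g(x)$ (also written $c(g(x),y)$). The conditional risk is $\mathcal R_\alpha(g)=\mathbb E[c(g,Z)\mid \|X\|\ge t_\alpha]$; for a data-dependent $\hat g$, $\mathcal R_\alpha(\hat g)$ means this function evaluated at $\hat g$. With reverse order statistics $\|X_{(1)}\|\ge\dots\ge\|X_{(n)}\|$ of the full sample, the empirical risk on $S\subset\{1,\dots,n\}$, $n_S=\mathrm{card}(S)$, is $$\widehat{\mathcal R}_\alpha(g,S)=\frac1{\alpha n_S}\sum_{i\in S}c(g,Z_i)\mathbf 1\{\|X_i\|>\|X_{(\lfloor\alpha n\rfloor)}\|\}.$$ A learning rule $\Psi$ maps an index set $S\subset\{1,\dots,n\}$ to an element $\Psi(S)\in\mathcal G$ trained on $\{Z_i:i\in S\}$. For validation sets $V_{1:K}=(V_1,\dots,V_K)$ with training sets $T_j=\{1,\dots,n\}\setminus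 V_j$, the cross-validation estimator is $\widehat{\mathcal R}_{CV,\alpha}(\Psi,V_{1:K})=\frac1K\sum_{j=1}^K\widehat{\mathcal R}_\alpha(\Psi(T_j),V_j)$. In the $K$-fold scheme, $V_1,\dots,V_K$ form a partition of $\{1,\dots,n\}$ into sets of equal cardinality $n/K$ ($K$ is assumed to divide $n$). The VC-dimension of a class of real functions is the VC-dimension of the family of its subgraphs $\{(x,y,t)\in\mathcal Z\times\mathbb R: t<c(g(x),y)\}$, $g\in\mathcal G$. "Universal constant" means not depending on any of the other objects ($n,\alpha,K,\delta,\mathcal G,c$, the law of $Z$).
   Formalization: It is additionally assumed that ‖X‖ has no atoms in [t_α,∞); with ties at the top order statistics the claim fails (e.g. an atom of mass α above t_α, c=1). The costs and the learning rule are assumed (jointly) measurable, and the rule may also see the threshold ‖X_(⌊αn⌋)‖. *)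

theory Defs
  imports "HOL-Probability.Probability" "HOL-Library.Extended_Nat"
begin

(* Points of R^d are the elements of the space of PiM {..<d} borel, i.e. functions that are
   undefined outside {..<d}. With d a number and not a type, one constant can serve all d. *)

type_synonym vect = "nat \<Rightarrow> real"
type_synonym obs = "vect \<times> int"

abbreviation borel_vect :: "nat \<Rightarrow> vect measure" where
  "borel_vect d \<equiv> PiM {..<d} (\<lambda>_. borel)"

definition norm_on :: "nat \<Rightarrow> (vect \<Rightarrow> real) \<Rightarrow> bool" where
  "norm_on d N \<longleftrightarrow>
     (\<forall>x\<in>space (borel_vect d). 0 \<le> N x \<and> (N x = 0 \<longleftrightarrow> (\<forall>i<d. x i = 0))) \<and>
     (\<forall>x\<in>space (borel_vect d). \<forall>a. N (\<lambda>i\<in>{..<d}. a * x i) = \<bar>a\<bar> * N x) \<and>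
     (\<forall>x\<in>space (borel_vect d). \<forall>y\<in>space (borel_vect d).
        N (\<lambda>i\<in>{..<d}. x i + y i) \<le> N x + N y)"

(* Borel sigma-algebra of X \<times> {-1,1}; X itself need not be a Borel set. *)
definition obs_space :: "nat \<Rightarrow> vect set \<Rightarrow> obs measure" where
  "obs_space d X = restrict_space (borel_vect d) X \<Otimes>\<^sub>M count_space {-1, 1}"

definition sample_measure :: "nat \<Rightarrow> obs measure \<Rightarrow> (nat \<Rightarrow> obs) measure" where
  "sample_measure n P = PiM {1..n} (\<lambda>_. P)"

(* The (1 - \<alpha>)-quantile of the norm. The restriction to t \<ge> 0 matters only for \<alpha> = 1, where it
   replaces the value -\<infinity> of the usual generalised inverse by 0. *)
definition tail_quantile :: "(vect \<Rightarrow> real) \<Rightarrow> obs measure \<Rightarrow> real \<Rightarrow> real" where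
  "tail_quantile N P \<alpha> = Inf {t. 0 \<le> t \<and> measure P {z \<in> space P. N (fst z) \<le> t} \<ge> 1 - \<alpha>}"

definition cond_risk ::
  "(vect \<Rightarrow> real) \<Rightarrow> obs measure \<Rightarrow> real \<Rightarrow> ('g \<Rightarrow> obs \<Rightarrow> real) \<Rightarrow> 'g \<Rightarrow> real" where
  "cond_risk N P \<alpha> c g =
     (\<integral>z. c g z \<partial>uniform_measure P {z \<in> space P. N (fst z) \<ge> tail_quantile N P \<alpha>})"

(* The m-th largest norm, 1 \<le> m \<le> n. *)
definition rev_order_stat :: "nat \<Rightarrow> (vect \<Rightarrow> real) \<Rightarrow> (nat \<Rightarrow> obs) \<Rightarrow> nat \<Rightarrow> real" where
  "rev_order_stat n N \<omega> m = rev (sort (map (\<lambda>i. N (fst (\<omega> i))) [1..<Suc n])) ! (m - 1)"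

definition emp_threshold :: "nat \<Rightarrow> real \<Rightarrow> (vect \<Rightarrow> real) \<Rightarrow> (nat \<Rightarrow> obs) \<Rightarrow> real" where
  "emp_threshold n \<alpha> N \<omega> = rev_order_stat n N \<omega> (nat \<lfloor>\<alpha> * real n\<rfloor>)"

definition emp_risk ::
  "nat \<Rightarrow> real \<Rightarrow> (vect \<Rightarrow> real) \<Rightarrow> ('g \<Rightarrow> obs \<Rightarrow> real) \<Rightarrow> (nat \<Rightarrow> obs) \<Rightarrow> 'g \<Rightarrow> nat set \<Rightarrow> real" where
  "emp_risk n \<alpha> N c \<omega> g S =
     1 / (\<alpha> * real (card S)) *
       (\<Sum>i\<in>S. c g (\<omega> i) * of_bool (N (fst (\<omega> i)) > emp_threshold n \<alpha> N \<omega>))"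

(* A learning rule maps an index set and the sample to an element of the class. It sees the
   observations in S and, besides these, only the full-sample threshold that enters emp_risk:
   without the latter an empirical risk minimiser would in general not be a learning rule.
   The joint measurability makes its empirical and true risks random variables. *)
definition learning_rule ::
  "nat \<Rightarrow> real \<Rightarrow> (vect \<Rightarrow> real) \<Rightarrow> obs measure \<Rightarrow> 'g set \<Rightarrow> ('g \<Rightarrow> obs \<Rightarrow> real) \<Rightarrow>
   (nat set \<Rightarrow> (nat \<Rightarrow> obs) \<Rightarrow> 'g) \<Rightarrow> bool" where
  "learning_rule n \<alpha> N P G c \<Psi> \<longleftrightarrow>
     (\<forall>S. S \<subseteq> {1..n} \<and> S \<noteq> {} \<longrightarrow>
        (\<forall>\<omega>\<in>space (sample_measure n P). \<Psi> S \<omega> \<in> G) \<and>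
        (\<forall>\<omega>\<in>space (sample_measure n P). \<forall>\<omega>'\<in>space (sample_measure n P).
           (\<forall>i\<in>S. \<omega> i = \<omega>' i) \<and> emp_threshold n \<alpha> N \<omega> = emp_threshold n \<alpha> N \<omega>' \<longrightarrow>
           \<Psi> S \<omega> = \<Psi> S \<omega>') \<and>
        (\<lambda>(\<omega>, z). c (\<Psi> S \<omega>) z) \<in> borel_measurable (sample_measure n P \<Otimes>\<^sub>M P))"

definition cond_erm ::
  "nat \<Rightarrow> real \<Rightarrow> (vect \<Rightarrow> real) \<Rightarrow> obs measure \<Rightarrow> 'g set \<Rightarrow> ('g \<Rightarrow> obs \<Rightarrow> real) \<Rightarrow>
   (nat set \<Rightarrow> (nat \<Rightarrow> obs) \<Rightarrow> 'g) \<Rightarrow> bool" where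
  "cond_erm n \<alpha> N P G c \<Psi> \<longleftrightarrow>
     (\<forall>S. S \<subseteq> {1..n} \<and> S \<noteq> {} \<longrightarrow>
        (\<forall>\<omega>\<in>space (sample_measure n P).
           is_arg_min (\<lambda>g. emp_risk n \<alpha> N c \<omega> g S) (\<lambda>g. g \<in> G) (\<Psi> S \<omega>)))"

definition kfold :: "nat \<Rightarrow> nat \<Rightarrow> (nat \<Rightarrow> nat set) \<Rightarrow> bool" where
  "kfold n K V \<longleftrightarrow> disjoint_family_on V {1..K} \<and> (\<Union>j\<in>{1..K}. V j) = {1..n} \<and>
     (\<forall>j\<in>{1..K}. card (V j) = n div K)"

definition cv_risk ::
  "nat \<Rightarrow> real \<Rightarrow> (vect \<Rightarrow> real) \<Rightarrow> ('g \<Rightarrow> obs \<Rightarrow> real) \<Rightarrow>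
   (nat set \<Rightarrow> (nat \<Rightarrow> obs) \<Rightarrow> 'g) \<Rightarrow> nat \<Rightarrow> (nat \<Rightarrow> nat set) \<Rightarrow> (nat \<Rightarrow> obs) \<Rightarrow> real" where
  "cv_risk n \<alpha> N c \<Psi> K V \<omega> =
     1 / real K * (\<Sum>j=1..K. emp_risk n \<alpha> N c \<omega> (\<Psi> ({1..n} - V j) \<omega>) (V j))"

definition shatters :: "'a set set \<Rightarrow> 'a set \<Rightarrow> bool" where
  "shatters \<C> A \<longleftrightarrow> (\<forall>B\<subseteq>A. \<exists>C\<in>\<C>. C \<inter> A = B)"

definition vc_dim :: "'a set set \<Rightarrow> enat" where
  "vc_dim \<C> = (SUP A\<in>{A. finite A \<and> shatters \<C> A}. enat (card A))"

definition subgraph :: "'a set \<Rightarrow> ('a \<Rightarrow> real) \<Rightarrow> ('a \<times> real) set" where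
  "subgraph D f = {(z, t). z \<in> D \<and> t < f z}"

definition E_kfold :: "real \<Rightarrow> nat \<Rightarrow> nat \<Rightarrow> nat \<Rightarrow> real \<Rightarrow> real" where
  "E_kfold M v n K \<alpha> =
     5 * M * sqrt (real v * real K / (real n * \<alpha>)) + 5 * real K / ((real K - 1) * real n * \<alpha>)"

end

theory Submission
  imports Defs
begin

text \<open>
For a cost function \<open>f\<close> let \<open>\<psi> f\<close> be \<open>f\<close> times the indicator of the tail region, where the norm is at
least the quantile \<open>t\<close>; the conditional risk of \<open>f\<close> is the mean of \<open>\<psi> f\<close> divided by \<open>\<alpha>\<close>. The
empirical risks use a random threshold instead of \<open>t\<close>. The sets cut out by two thresholds are nested
and, almost surely, the norm has no ties in the tail, so exchanging the thresholds changes an empirical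
risk, averaged over the folds, by at most \<open>(\<bar>B - k\<bar> + 1) / (n \<alpha>)\<close>, where the binomial \<open>B\<close> counts the
sample points in the tail region (\<open>sum_threshold_mismatch_le\<close>).

After this exchange three deviations of an empirical mean from an expectation remain, each taken at a
function that depends on the data: the rule trained without fold \<open>j\<close> evaluated on fold \<open>j\<close>, the same rule
evaluated on its own training set, both averaged over \<open>j\<close>, and the rule trained on the full sample
evaluated on the full sample. Risk minimisation on the training sets bounds the cross-validation error
from above by these deviations, risk minimisation on the full sample bounds it from below
(\<open>cv_error_decomposition\<close>).

All three are controlled through exponential moments (\<open>selection_mgf_bound\<close>). The class may
be uncountable, and the supremum of the deviation over the class need not be measurable; under the
continuum hypothesis a VC class of measurable functions can even violate the uniform law of large
numbers. The selected functions, however, are jointly measurable in the sample and the argument, so the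
symmetrisation is done for the selection: exchanging points of the sample with points of an independent
ghost sample preserves the law, hence the exponential may be averaged over all exchanges before it is
integrated. Only then, at fixed points, is the selected function replaced by an arbitrary member of the
class, and what has to be bounded is a finite average over signs. Chaining along nets whose cardinality
at scale \<open>2 ^ - j\<close> is \<open>exp (O (v (j + 1)))\<close> does this without a logarithmic
factor (\<open>chaining\<close>, \<open>packing_bound\<close>).

The index set may be cut into blocks with a separate selection for each block. The \<open>K\<close> validation folds
then cost \<open>40 K v\<close> in the exponent, while the variance term stays that of all \<open>n\<close> points. This is why
\<open>K\<close> multiplies the VC-dimension in the final bound but not \<open>ln (1 / \<delta>)\<close>. For the training sets, which
overlap, convexity of the exponential reduces the average over the folds to a single one.

The error never exceeds \<open>1\<close>, so only the case in which both square roots of the bound are small needs an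
argument. In that case all exponents are in their Gaussian range, and in units of
\<open>sqrt (ln (1 / \<delta>) / (n \<alpha>))\<close> the three deviations contribute \<open>6\<close>, \<open>6 * sqrt 2\<close> and \<open>6\<close>, the threshold
contributes \<open>3 * 2\<close>, and the sum is below \<open>20 * sqrt 2\<close>. Eight tail events of probability at most \<open>\<delta>\<close>
are excluded, and the universal constant is \<open>100\<close>.
\<close>

section \<open>Shattering and packing numbers\<close>

text \<open>
Pajor's form of the Sauer-Shelah lemma, by induction on the ground set. Removing a point \<open>a\<close> from all
members of \<open>F\<close> merges exactly the pairs \<open>C\<close>, \<open>insert a C\<close> that both lie in \<open>F\<close>. So \<open>card F\<close> is the
number of traces on the rest plus the number of merged traces. A set shattered by the traces is
shattered by \<open>F\<close>; a set shattered by the merged traces stays so after adding \<open>a\<close>.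
\<close>

lemma card_le_card_shattered:
  assumes "finite A" "F \<subseteq> Pow A"
  shows "card F \<le> card {B. B \<subseteq> A \<and> shatters F B}"
  using assms
proof (induction A arbitrary: F rule: finite_induct)
  case empty
  show ?case
  proof (cases "F = {}")
    case False
    with empty have "F = {{}}" by auto
    then have "{B. B \<subseteq> {} \<and> shatters F B} = {{}}" by (auto simp: shatters_def)
    with \<open>F = {{}}\<close> show ?thesis by simp
  qed simp
next
  case (insert a A)
  define Fa where "Fa = {C \<in> F. a \<notin> C}"
  define Fb where "Fb = {C \<in> F. a \<in> C}"
  define Fc where "Fc = (\<lambda>C. C - {a}) ` Fb"
  define Sh where "Sh = (\<lambda>F. {B. B \<subseteq> A \<and> shatters F B})"
  have finF: "finite F" using insert by (meson finite_Pow_iff finite_insert finite_subset)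
  have fin: "finite Fa" "finite Fb" "finite Fc" using finF by (auto simp: Fa_def Fb_def Fc_def)
  have finSh: "finite (Sh F')" for F' using insert(1) by (auto simp: Sh_def)
  have Fc_mem: "C \<in> Fc \<longleftrightarrow> a \<notin> C \<and> insert a C \<in> F" for C
    unfolding Fc_def Fb_def by (auto simp: insert_absorb image_iff intro!: bexI[of _ "insert a C"])
  have "card F = card Fa + card Fb"
    using fin by (subst card_Un_disjoint[symmetric]) (auto simp: Fa_def Fb_def intro!: arg_cong[of _ _ card])
  also have "card Fb = card Fc"
    unfolding Fc_def by (rule card_image[symmetric]) (auto simp: Fb_def inj_on_def)
  also have "card Fa + card Fc = card (Fa \<union> Fc) + card (Fa \<inter> Fc)"
    using fin by (intro card_Un_Int) auto
  also have "\<dots> \<le> card (Sh (Fa \<union> Fc)) + card (Sh (Fa \<inter> Fc))"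
    unfolding Sh_def using insert(4) by (intro add_mono insert(3)) (force simp: Fa_def Fc_mem)+
  also have "card (Sh (Fa \<inter> Fc)) = card (insert a ` Sh (Fa \<inter> Fc))"
    using insert(2) by (intro card_image[symmetric]) (auto simp: inj_on_def Sh_def)
  also have "card (Sh (Fa \<union> Fc)) + card (insert a ` Sh (Fa \<inter> Fc))
      = card (Sh (Fa \<union> Fc) \<union> insert a ` Sh (Fa \<inter> Fc))"
    using insert(2) finSh by (intro card_Un_disjoint[symmetric]) (auto simp: Sh_def)
  also have "\<dots> \<le> card {B. B \<subseteq> insert a A \<and> shatters F B}"
  proof (rule card_mono)
    show "finite {B. B \<subseteq> insert a A \<and> shatters F B}"
      using insert(1) by simp
    have 1: "shatters F B" if "B \<subseteq> A" "shatters (Fa \<union> Fc) B" for B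
      unfolding shatters_def
    proof (intro allI impI)
      fix B' assume "B' \<subseteq> B"
      with that obtain C where C: "C \<in> Fa \<union> Fc" "C \<inter> B = B'" unfolding shatters_def by meson
      have "a \<notin> B" using insert(2) that by auto
      then show "\<exists>C\<in>F. C \<inter> B = B'" using C
        by (auto simp: Fa_def Fc_mem intro: bexI[of _ C] bexI[of _ "insert a C"])
    qed
    have 2: "shatters F (insert a B)" if "B \<subseteq> A" "shatters (Fa \<inter> Fc) B" for B
      unfolding shatters_def
    proof (intro allI impI)
      fix B' assume "B' \<subseteq> insert a B"
      then have "B' - {a} \<subseteq> B" by auto
      with that obtain C where C: "C \<in> Fa \<inter> Fc" "C \<inter> B = B' - {a}" unfolding shatters_def by meson
      have "C \<in> F" "insert a C \<in> F" "a \<notin> C" using C by (auto simp: Fa_def Fc_mem)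
      moreover have "C \<inter> insert a B = B'" if "a \<notin> B'" using C that \<open>a \<notin> C\<close> by auto
      moreover have "insert a C \<inter> insert a B = B'" if "a \<in> B'" using C that \<open>a \<notin> C\<close> by auto
      ultimately show "\<exists>C\<in>F. C \<inter> insert a B = B'" by blast
    qed
    show "Sh (Fa \<union> Fc) \<union> insert a ` Sh (Fa \<inter> Fc) \<subseteq> {B. B \<subseteq> insert a A \<and> shatters F B}"
      using 1 2 by (auto simp: Sh_def)
  qed
  finally show ?case by simp
qed

lemma Sauer_Shelah:
  assumes "finite A" "F \<subseteq> Pow A" "\<And>B. B \<subseteq> A \<Longrightarrow> shatters F B \<Longrightarrow> card B \<le> v"
  shows "card F \<le> (\<Sum>i\<le>v. card A choose i)"
proof -
  have "card F \<le> card {B. B \<subseteq> A \<and> shatters F B}"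
    using assms by (intro card_le_card_shattered)
  also have "\<dots> \<le> card (\<Union>i\<le>v. {B. B \<subseteq> A \<and> card B = i})"
    using assms by (intro card_mono) auto
  also have "\<dots> \<le> (\<Sum>i\<le>v. card {B. B \<subseteq> A \<and> card B = i})"
    by (rule card_UN_le) simp
  also have "\<dots> = (\<Sum>i\<le>v. card A choose i)"
    using assms by (simp add: n_subsets)
  finally show ?thesis .
qed

text \<open>
Multiplying by \<open>(v / L) ^ v\<close> and lowering the exponents to \<open>i\<close> turns the sum into a part of the binomial
expansion of \<open>(1 + v / L) ^ L \<le> exp v\<close>.
\<close>

lemma sum_choose_le_power:
  assumes "1 \<le> v" "v \<le> L"
  shows "real (\<Sum>i\<le>v. L choose i) \<le> (exp 1 * real L / real v) ^ v"
proof -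
  have L: "real L > 0" and v: "real v > 0" using assms by auto
  have "(real v / real L) ^ v * real (\<Sum>i\<le>v. L choose i) = (\<Sum>i\<le>v. real (L choose i) * (real v / real L) ^ v)"
    by (simp add: sum_distrib_left mult.commute)
  also have "\<dots> \<le> (\<Sum>i\<le>v. real (L choose i) * (real v / real L) ^ i)"
    using assms by (intro sum_mono mult_left_mono power_decreasing) auto
  also have "\<dots> \<le> (\<Sum>i\<le>L. real (L choose i) * (real v / real L) ^ i)"
    using assms by (intro sum_mono2) auto
  also have "\<dots> = (1 + real v / real L) ^ L"
    by (subst add.commute, subst binomial_ring) simp
  also have "\<dots> \<le> exp (real v / real L) ^ L"
    by (intro power_mono) auto
  also have "\<dots> = exp (real v)" using L by (simp add: exp_of_nat_mult[symmetric])
  also have "\<dots> = exp 1 ^ v" by (simp add: exp_of_nat_mult[symmetric])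
  finally have "(real v / real L) ^ v * real (\<Sum>i\<le>v. L choose i) \<le> exp 1 ^ v" .
  then have "real (\<Sum>i\<le>v. L choose i) \<le> exp 1 ^ v / (real v / real L) ^ v"
    using L v by (simp add: field_simps)
  then show ?thesis by (simp add: power_divide power_mult_distrib)
qed

lemma card_le_vc_dim:
  assumes "vc_dim \<C> \<le> enat v" "finite A" "shatters \<C> A"
  shows "card A \<le> v"
proof -
  have "enat (card A) \<le> vc_dim \<C>"
    unfolding vc_dim_def using assms by (intro SUP_upper) auto
  with assms(1) show ?thesis using order_trans by fastforce
qed

text \<open>
A union bound over a uniformly random list of \<open>L\<close> points of \<open>U\<close>, carried out by counting lists: two
traces that differ on a fraction \<open>\<theta>\<close> of \<open>U\<close> agree on the whole list with probability at most
\<open>(1 - \<theta>) ^ L\<close>.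
\<close>

lemma exists_separating_points:
  fixes S :: "'f \<Rightarrow> 'u set" and \<theta> :: real
  assumes "finite U" "U \<noteq> {}" "finite F" "0 \<le> \<theta>" "\<theta> \<le> 1"
    and sep: "\<And>f g. f \<in> F \<Longrightarrow> g \<in> F \<Longrightarrow> f \<noteq> g \<Longrightarrow>
      \<theta> * real (card U) \<le> real (card {u \<in> U. (u \<in> S f) \<noteq> (u \<in> S g)})"
    and small: "real (card F) ^ 2 * (1 - \<theta>) ^ L < 1"
  obtains A where "A \<subseteq> U" "card A \<le> L" "inj_on (\<lambda>f. S f \<inter> A) F"
proof -
  define Ls where "Ls = (\<lambda>X::'u set. {xs. set xs \<subseteq> X \<and> length xs = L})"
  define agree where "agree = (\<lambda>(f, g). {u \<in> U. (u \<in> S f) = (u \<in> S g)})"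
  define Prs where "Prs = {(f, g). f \<in> F \<and> g \<in> F \<and> f \<noteq> g}"
  have Prs: "Prs \<subseteq> F \<times> F" "finite Prs"
    using assms(3) by (auto simp: Prs_def intro: finite_subset[of _ "F \<times> F"])
  have cU: "real (card U) > 0" using assms by (simp add: card_gt_0_iff)
  have agree: "real (card (agree p)) \<le> (1 - \<theta>) * real (card U)" if "p \<in> Prs" for p
  proof -
    obtain f g where p: "p = (f, g)" "f \<in> F" "g \<in> F" "f \<noteq> g" using \<open>p \<in> Prs\<close> by (auto simp: Prs_def)
    have "card (agree p) + card {u \<in> U. (u \<in> S f) \<noteq> (u \<in> S g)} = card U"
      using assms(1) unfolding agree_def p
      by (subst card_Un_disjoint[symmetric]) (auto intro!: arg_cong[of _ _ card])
    then have "real (card (agree p)) + real (card {u \<in> U. (u \<in> S f) \<noteq> (u \<in> S g)}) = real (card U)"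
      by linarith
    with sep[OF p(2-)] show ?thesis by (simp add: algebra_simps)
  qed
  have cLs: "card (Ls X) = card X ^ L" if "finite X" for X
    unfolding Ls_def using that by (rule card_lists_length_eq)
  have finLs: "finite (Ls X)" if "finite X" for X
    unfolding Ls_def using that by (rule finite_lists_length_eq)
  have finA: "finite (agree p)" for p using assms(1) by (cases p) (auto simp: agree_def)
  have "real (card (\<Union>p\<in>Prs. Ls (agree p))) \<le> real (\<Sum>p\<in>Prs. card (Ls (agree p)))"
    using card_UN_le[OF Prs(2)] by (intro of_nat_mono)
  also have "\<dots> = (\<Sum>p\<in>Prs. real (card (agree p)) ^ L)"
    using finA by (simp add: cLs)
  also have "\<dots> \<le> (\<Sum>p\<in>Prs. ((1 - \<theta>) * real (card U)) ^ L)"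
    by (intro sum_mono power_mono agree) auto
  also have "\<dots> = real (card Prs) * (1 - \<theta>) ^ L * real (card U) ^ L"
    by (simp add: power_mult_distrib)
  also have "\<dots> \<le> real (card F) ^ 2 * (1 - \<theta>) ^ L * real (card U) ^ L"
  proof -
    have "card Prs \<le> card (F \<times> F)" using Prs assms(3) by (intro card_mono) auto
    then have "real (card Prs) \<le> real (card F) ^ 2"
      by (metis card_cartesian_product of_nat_mono of_nat_mult power2_eq_square)
    then show ?thesis using assms by (intro mult_right_mono) auto
  qed
  also have "\<dots> < real (card (Ls U))"
    using small cU assms(1) by (simp add: cLs)
  finally have "card (\<Union>p\<in>Prs. Ls (agree p)) < card (Ls U)" by simp
  moreover have "finite (\<Union>p\<in>Prs. Ls (agree p))" using Prs(2) finA finLs by blast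
  ultimately obtain xs where xs: "xs \<in> Ls U" "xs \<notin> (\<Union>p\<in>Prs. Ls (agree p))"
    by (metis (no_types, lifting) card_mono leD subsetI)
  show thesis
  proof (rule that[of "set xs"])
    show "set xs \<subseteq> U" "card (set xs) \<le> L" using xs(1) card_length[of xs] by (auto simp: Ls_def)
    show "inj_on (\<lambda>f. S f \<inter> set xs) F"
    proof (rule inj_onI, rule ccontr)
      fix f g assume fg: "f \<in> F" "g \<in> F" "S f \<inter> set xs = S g \<inter> set xs" "f \<noteq> g"
      then have "xs \<in> Ls (agree (f, g))" using xs(1) by (auto simp: Ls_def agree_def)
      moreover have "(f, g) \<in> Prs" using fg by (auto simp: Prs_def)
      ultimately show False using xs(2) by blast
    qed
  qed
qed

text \<open>
The grid points \<open>l / m\<close> replace a uniformly random level: up to an error of one point, the fraction of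
levels that tell \<open>x\<close> from \<open>y\<close> is \<open>\<bar>x - y\<bar>\<close>. This discretises the subgraphs, so that only counting is
needed.
\<close>

lemma grid_separates:
  fixes x y :: real
  assumes "0 < m" "0 \<le> x" "x \<le> 1" "0 \<le> y" "y \<le> 1"
  shows "real m * \<bar>x - y\<bar> - 1 \<le> real (card {l. l < m \<and> (real l / real m < x) \<noteq> (real l / real m < y)})"
proof -
  define a b where "a = nat \<lceil>real m * x\<rceil>" and "b = nat \<lceil>real m * y\<rceil>"
  have grid: "(l < m \<and> real l / real m < t) \<longleftrightarrow> l < nat \<lceil>real m * t\<rceil>" if "0 \<le> t" "t \<le> 1" for l t
  proof -
    have "real l / real m < t \<longleftrightarrow> real l < real m * t" using assms(1) by (simp add: field_simps)
    also have "\<dots> \<longleftrightarrow> int l < \<lceil>real m * t\<rceil>" by (simp add: less_ceiling_iff)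
    also have "\<dots> \<longleftrightarrow> l < nat \<lceil>real m * t\<rceil>" by linarith
    finally have *: "real l / real m < t \<longleftrightarrow> l < nat \<lceil>real m * t\<rceil>" .
    have "real m * t \<le> real m" using that by (simp add: mult_left_le)
    then have "nat \<lceil>real m * t\<rceil> \<le> m" by (simp add: nat_le_iff ceiling_le_iff)
    with * show ?thesis by linarith
  qed
  have "{l. l < m \<and> (real l / real m < x) \<noteq> (real l / real m < y)} = {min a b ..< max a b}"
  proof -
    have "l \<in> {l. l < m \<and> (real l / real m < x) \<noteq> (real l / real m < y)} \<longleftrightarrow> (l < a) \<noteq> (l < b)" for l
      using grid[of x l] grid[of y l] assms unfolding a_def b_def by blast
    moreover have "l \<in> {min a b ..< max a b} \<longleftrightarrow> (l < a) \<noteq> (l < b)" for l by auto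
    ultimately show ?thesis by blast
  qed
  moreover have "real m * \<bar>x - y\<bar> - 1 \<le> real (max a b - min a b)"
  proof -
    have "real m * \<bar>x - y\<bar> = \<bar>real m * x - real m * y\<bar>" 
      by (simp add: abs_mult right_diff_distrib[symmetric])
    moreover have "0 \<le> real m * x" "0 \<le> real m * y" using assms by auto
    then have "real a = of_int \<lceil>real m * x\<rceil>" "real b = of_int \<lceil>real m * y\<rceil>"
      by (auto simp: a_def b_def)
    moreover have "real (max a b - min a b) = \<bar>real a - real b\<bar>"
      by (auto simp: max_def min_def)
    moreover have "real m * x \<le> of_int \<lceil>real m * x\<rceil>" "of_int \<lceil>real m * x\<rceil> < real m * x + 1"
       "real m * y \<le> of_int \<lceil>real m * y\<rceil>" "of_int \<lceil>real m * y\<rceil> < real m * y + 1"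
      by linarith+
    ultimately show ?thesis by linarith
  qed
  ultimately show ?thesis by simp
qed

text \<open>
Dudley's bound for the packing numbers of a VC-subgraph class in mean square. Functions with values in
the unit interval that are \<open>2 ^ - j\<close>-separated in mean square have subgraphs that differ on a fraction of
about \<open>4 ^ - j\<close> of all pairs of a point and a level. Of order \<open>v * 16 ^ j\<close> random pairs therefore separate
all subgraphs, and the Sauer-Shelah lemma bounds the number of distinct traces.
\<close>

lemma packing_bound:
  fixes H :: "('a \<Rightarrow> real) set" and z :: "'q \<Rightarrow> 'a"
  assumes Q: "finite Q" "\<And>q. q \<in> Q \<Longrightarrow> z q \<in> D"
    and H: "\<And>f x. f \<in> H \<Longrightarrow> x \<in> D \<Longrightarrow> 0 \<le> f x \<and> f x \<le> 1"
    and vc: "vc_dim (subgraph D ` H) \<le> enat v"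
    and F: "finite F" "F \<subseteq> H"
    and sep: "\<And>f g. f \<in> F \<Longrightarrow> g \<in> F \<Longrightarrow> f \<noteq> g \<Longrightarrow>
      real (card Q) / 4 ^ j < (\<Sum>q\<in>Q. (f (z q) - g (z q))\<^sup>2)"
  shows "real (card F) \<le> exp (real v * (6 + 4 * real j))"
proof (cases "v = 0")
  case True
  have "f = g" if fg: "f \<in> F" "g \<in> F" for f g
  proof (rule ccontr)
    assume "f \<noteq> g"
    with sep[OF fg] have "(\<Sum>q\<in>Q. (f (z q) - g (z q))\<^sup>2) \<noteq> 0"
      by (smt (verit) divide_nonneg_nonneg of_nat_0_le_iff zero_le_power)
    then obtain q where q: "q \<in> Q" "f (z q) \<noteq> g (z q)"
      by (metis (no_types, lifting) diff_self power_zero_numeral sum.neutral)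
    define t where "t = min (f (z q)) (g (z q))"
    have "shatters (subgraph D ` H) {(z q, t)}"
      unfolding shatters_def
    proof (intro allI impI)
      fix B assume "B \<subseteq> {(z q, t)}"
      then consider "B = {}" | "B = {(z q, t)}" by blast
      moreover have "f \<in> H" "g \<in> H" using fg F by auto
      ultimately show "\<exists>C\<in>subgraph D ` H. C \<inter> {(z q, t)} = B"
        using q Q(2)[OF q(1)] by cases (force simp: subgraph_def t_def min_def)+
    qed
    from card_le_vc_dim[OF vc _ this] True show False by simp
  qed
  then have "card F \<le> Suc 0" using card_le_Suc0_iff_eq[OF F(1)] by blast
  with True show ?thesis by simp
next
  case False
  then have v: "1 \<le> v" by simp
  \<comment> \<open>\<open>v * b\<close> is the number of random pairs. The power \<open>16 ^ j\<close> makes the failure probability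
    \<open>exp (- 16 * v * 4 ^ j)\<close>, which beats the square of the number \<open>exp (O (v * j))\<close> of functions.\<close>
  define b :: nat where "b = 2 ^ (5 + 4 * j)"
  define B where "B = exp 1 * real b"
  have two: "2 \<le> exp (1::real)" using exp_ge_add_one_self[of "1::real"] by linarith
  have "real b \<le> exp 1 ^ (5 + 4 * j)"
    unfolding b_def of_nat_power using two by (intro power_mono) auto
  then have "B \<le> exp 1 * exp 1 ^ (5 + 4 * j)" unfolding B_def by simp
  also have "\<dots> = exp (6 + 4 * real j)"
    by (simp add: exp_of_nat_mult[symmetric] exp_add[symmetric])
  finally have B: "B \<le> exp (6 + 4 * real j)" .
  have B1: "1 \<le> B" 
    using two unfolding B_def b_def by (intro mult_ge1_I) auto
  have B1v: "1 \<le> B ^ v" using B1 by simp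
  have Bv: "B ^ v \<le> exp (real v * (6 + 4 * real j))"
    unfolding exp_of_nat_mult using B B1 by (intro power_mono) auto
  show ?thesis
  proof (rule ccontr)
    assume "\<not> ?thesis"
    with Bv have "B ^ v < real (card F)" by linarith
    then have "\<lfloor>B ^ v\<rfloor> < int (card F)" by (simp add: floor_less_iff)
    moreover have "0 \<le> \<lfloor>B ^ v\<rfloor>" using B1v by simp
    ultimately have "nat \<lfloor>B ^ v\<rfloor> + 1 \<le> card F" by linarith
    \<comment> \<open>A family that is only just too large keeps the union bound under control.\<close>
    then obtain F0 where F0: "F0 \<subseteq> F" "card F0 = nat \<lfloor>B ^ v\<rfloor> + 1"
      by (meson obtain_subset_with_card_n)
    have "real (card F0) = of_int \<lfloor>B ^ v\<rfloor> + 1" using F0 B1v by simp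
    then have gt: "B ^ v < real (card F0)" and le: "real (card F0) \<le> 2 * B ^ v"
      using B1v by linarith+
    have finF0: "finite F0" using F F0 finite_subset by blast
    have "\<not> card F0 \<le> Suc 0" using gt B1v by linarith
    then obtain f0 g0 where "f0 \<in> F0" "g0 \<in> F0" "f0 \<noteq> g0"
      using card_le_Suc0_iff_eq[OF finF0] by blast
    then have Qne: "Q \<noteq> {}" using sep[of f0 g0] F0(1) by fastforce
    \<comment> \<open>The grid is so fine that the rounding error, one level per point, takes away half of the separation.\<close>
    define m :: nat where "m = 2 * 4 ^ j"
    define \<theta> :: real where "\<theta> = 1 / m"
    define U where "U = Q \<times> {..<m}"
    define S where "S = (\<lambda>f. {(q, l::nat). real l / real m < f (z q)})"
    have m: "m > 0" by (simp add: m_def)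
    have "\<theta> * real (card U) \<le> real (card {u \<in> U. (u \<in> S f) \<noteq> (u \<in> S g)})"
      if fg: "f \<in> F0" "g \<in> F0" "f \<noteq> g" for f g
    proof -
      have fgH: "f \<in> H" "g \<in> H" using fg F F0 by auto
      have "\<theta> * real (card U) = real (card Q)" using m by (simp add: \<theta>_def U_def card_cartesian_product)
      also have "\<dots> = real m * (real (card Q) / 4 ^ j) - real (card Q)" by (simp add: m_def)
      also have "\<dots> \<le> real m * (\<Sum>q\<in>Q. (f (z q) - g (z q))\<^sup>2) - real (card Q)"
      proof -
        have "real (card Q) / 4 ^ j \<le> (\<Sum>q\<in>Q. (f (z q) - g (z q))\<^sup>2)"
          using sep[of f g] fg F0(1) by (intro less_imp_le) blast
        then show ?thesis by (intro diff_mono mult_left_mono) auto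
      qed
      also have "\<dots> = (\<Sum>q\<in>Q. real m * (f (z q) - g (z q))\<^sup>2 - 1)"
        by (simp add: sum_subtractf sum_distrib_left)
      also have "\<dots> \<le> (\<Sum>q\<in>Q. real m * \<bar>f (z q) - g (z q)\<bar> - 1)"
      proof (intro sum_mono diff_mono mult_left_mono)
        fix q assume "q \<in> Q"
        then have "\<bar>f (z q) - g (z q)\<bar> \<le> 1" using H[OF fgH(1) Q(2)] H[OF fgH(2) Q(2)] by (smt (verit))
        then show "(f (z q) - g (z q))\<^sup>2 \<le> \<bar>f (z q) - g (z q)\<bar>"
          by (metis abs_ge_zero mult_left_le power2_abs power2_eq_square)
      qed auto
      also have "\<dots> \<le> (\<Sum>q\<in>Q. real (card {l. l < m \<and> (real l / real m < f (z q)) \<noteq> (real l / real m < g (z q))}))"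
        using H fgH Q m by (intro sum_mono grid_separates) auto
      also have "\<dots> = real (card (SIGMA q:Q. {l. l < m \<and> (real l / real m < f (z q)) \<noteq> (real l / real m < g (z q))}))"
        using Q(1) by simp
      also have "(SIGMA q:Q. {l. l < m \<and> (real l / real m < f (z q)) \<noteq> (real l / real m < g (z q))})
          = {u \<in> U. (u \<in> S f) \<noteq> (u \<in> S g)}"
        by (auto simp: U_def S_def)
      finally show ?thesis .
    qed
    moreover have "real (card F0) ^ 2 * (1 - \<theta>) ^ (v * b) < 1"
    proof -
      have \<theta>1: "\<theta> \<le> 1" using m by (simp add: \<theta>_def)
      have "real (card F0) ^ 2 \<le> (2 * B ^ v) ^ 2" using le by (intro power_mono) auto
      also have "\<dots> = 4 * B ^ (2 * v)" by (simp add: power_mult_distrib power_mult[symmetric] mult.commute)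
      also have "\<dots> \<le> exp (2 * real v) * exp (6 + 4 * real j) ^ (2 * v)"
      proof (intro mult_mono power_mono)
        have "(4::real) \<le> exp 1 ^ 2" using two power_mono[of 2 "exp 1::real" 2] by simp
        also have "\<dots> = exp 2" by (simp add: exp_of_nat_mult[symmetric])
        also have "\<dots> \<le> exp (2 * real v)" using v by simp
        finally show "4 \<le> exp (2 * real v)" .
      qed (use B B1 in auto)
      also have "\<dots> = exp (real v * (14 + 8 * real j))"
        by (simp add: exp_of_nat_mult[symmetric] exp_add[symmetric] algebra_simps)
      finally have 1: "real (card F0) ^ 2 \<le> exp (real v * (14 + 8 * real j))" .
      have "(1 - \<theta>) ^ (v * b) \<le> exp (- \<theta>) ^ (v * b)"
        using \<theta>1 exp_ge_add_one_self[of "-\<theta>"] by (intro power_mono) auto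
      also have "\<dots> = exp (- (real v * (real b / real m)))"
        by (simp add: exp_of_nat_mult[symmetric] \<theta>_def)
      also have "real b / real m = 16 * 4 ^ j"
        by (simp add: b_def m_def power_add power_mult flip: power_mult_distrib)
           (simp add: field_simps flip: power_mult_distrib)
      finally have 2: "(1 - \<theta>) ^ (v * b) \<le> exp (- (real v * (16 * 4 ^ j)))" .
      have "real (card F0) ^ 2 * (1 - \<theta>) ^ (v * b)
          \<le> exp (real v * (14 + 8 * real j)) * exp (- (real v * (16 * 4 ^ j)))"
        using 1 2 \<theta>1 by (intro mult_mono) auto
      also have "\<dots> = exp (real v * (14 + 8 * real j - 16 * 4 ^ j))"
        by (simp add: exp_add[symmetric] algebra_simps)
      also have "\<dots> < 1"
      proof -
        have "1 + real j * 3 \<le> (1 + 3) ^ j" by (rule Bernoulli_inequality) simp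
        then have "14 + 8 * real j - 16 * 4 ^ j < 0" by simp
        then show ?thesis using v by (simp add: mult_pos_neg)
      qed
      finally show ?thesis .
    qed
    moreover have "finite U" "U \<noteq> {}" using Q(1) Qne m by (auto simp: U_def)
    moreover have "0 \<le> \<theta>" "\<theta> \<le> 1" using m by (auto simp: \<theta>_def)
    ultimately obtain A where A: "A \<subseteq> U" "card A \<le> v * b" "inj_on (\<lambda>f. S f \<inter> A) F0"
      using finF0 by (elim exists_separating_points[of U F0 \<theta> S "v * b", rotated -1]) auto
    have finA: "finite A" using A(1) \<open>finite U\<close> finite_subset by blast
    define pt where "pt = (\<lambda>(q, l). (z q, real l / real m))"
    have S_iff: "u \<in> S f \<longleftrightarrow> pt u \<in> subgraph D f" if "u \<in> A" for u f
      using that A(1) Q(2) by (auto simp: S_def pt_def subgraph_def U_def)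
    \<comment> \<open>The traces stay distinct when the abstract pairs are mapped to points under the graph.\<close>
    define F' where "F' = (\<lambda>f. subgraph D f \<inter> pt ` A) ` F0"
    have "inj_on (\<lambda>f. subgraph D f \<inter> pt ` A) F0"
    proof (rule inj_onI)
      fix f g assume fg: "f \<in> F0" "g \<in> F0" "subgraph D f \<inter> pt ` A = subgraph D g \<inter> pt ` A"
      have "S f \<inter> A = S g \<inter> A" using fg(3) S_iff by blast
      with A(3) fg show "f = g" by (auto dest: inj_onD)
    qed
    then have "real (card F0) = real (card F')" unfolding F'_def by (simp add: card_image)
    also have "card F' \<le> (\<Sum>i\<le>v. card (pt ` A) choose i)"
    proof (rule Sauer_Shelah)
      show "finite (pt ` A)" "F' \<subseteq> Pow (pt ` A)" using finA by (auto simp: F'_def)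
      fix C assume C: "C \<subseteq> pt ` A" "shatters F' C"
      have "shatters (subgraph D ` H) C"
        unfolding shatters_def
      proof (intro allI impI)
        fix C' assume "C' \<subseteq> C"
        then obtain f where "f \<in> F0" "subgraph D f \<inter> pt ` A \<inter> C = C'"
          using C(2) unfolding shatters_def F'_def by blast
        then show "\<exists>E\<in>subgraph D ` H. E \<inter> C = C'"
          using C(1) F(2) F0(1) by (intro bexI[of _ "subgraph D f"]) auto
      qed
      then show "card C \<le> v" using C(1) finA vc by (intro card_le_vc_dim) (auto intro: finite_subset)
    qed
    then have "real (card F') \<le> real (\<Sum>i\<le>v. card (pt ` A) choose i)" by (rule of_nat_mono)
    also have "\<dots> \<le> real (\<Sum>i\<le>v. (v * b) choose i)"
      using A(2) card_image_le[OF finA, of pt]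
      by (intro of_nat_mono sum_mono binomial_right_mono) auto
    also have "\<dots> \<le> (exp 1 * real (v * b) / real v) ^ v"
      using v by (intro sum_choose_le_power) (auto simp: b_def)
    also have "\<dots> = B ^ v" using v by (simp add: B_def)
    finally show False using gt by simp
  qed
qed

section \<open>Chaining for sums with random signs\<close>

lemma two_pow_fact_le: "2 ^ n * fact n \<le> (fact (2 * n) :: real)"
proof (induction n)
  case (Suc n)
  have "2 ^ Suc n * fact (Suc n) = (2 * real n + 2) * (2 ^ n * fact n :: real)"
    by (simp add: algebra_simps)
  also have "\<dots> \<le> (2 * real n + 2) * ((2 * real n + 1) * fact (2 * n))"
  proof (rule mult_left_mono)
    have "2 ^ n * fact n \<le> 1 * (fact (2 * n) :: real)" using Suc by simp
    also have "\<dots> \<le> (2 * real n + 1) * fact (2 * n)" by (intro mult_right_mono) auto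
    finally show "2 ^ n * fact n \<le> (2 * real n + 1) * (fact (2 * n) :: real)" .
  qed simp
  also have "\<dots> = fact (2 * Suc n)" by (simp add: algebra_simps)
  finally show ?case .
qed simp

text \<open>
Termwise comparison of the two power series.
\<close>

lemma cosh_le_exp_square: "cosh x \<le> exp (x\<^sup>2 / 2)" for x :: real
proof -
  have "(\<lambda>n. if even n then x ^ n /\<^sub>R fact n else 0) sums cosh x"
    by (rule cosh_converges)
  then have lhs: "(\<lambda>n. x ^ (2 * n) /\<^sub>R fact (2 * n)) sums cosh x"
    by (subst (asm) sums_mono_reindex[of "\<lambda>n. 2 * n", symmetric])
       (auto simp: strict_mono_def elim!: evenE)
  have rhs: "(\<lambda>n. (x\<^sup>2 / 2) ^ n /\<^sub>R fact n) sums exp (x\<^sup>2 / 2)"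
    by (rule exp_converges)
  have "x ^ (2 * n) /\<^sub>R fact (2 * n) \<le> (x\<^sup>2 / 2) ^ n /\<^sub>R fact n" for n
  proof -
    have "x ^ (2 * n) / fact (2 * n) \<le> x ^ (2 * n) / (2 ^ n * fact n)"
      by (intro divide_left_mono two_pow_fact_le) auto
    also have "\<dots> = (x\<^sup>2 / 2) ^ n / fact n" by (simp add: power_divide power_mult)
    finally show ?thesis by (simp only: real_scaleR_def divide_inverse mult.commute[of "inverse _"])
  qed
  then show ?thesis by (rule sums_le[OF _ lhs rhs])
qed

text \<open>
A vector of signs is encoded by the set of its negative coordinates: averaging over independent signs is
averaging over a power set, and the same set tells which sample points are exchanged with their ghosts.
\<close>

definition flip_sign :: "nat set \<Rightarrow> nat \<Rightarrow> real" where
  "flip_sign \<sigma> i = (if i \<in> \<sigma> then -1 else 1)"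

text \<open>
Sums with random signs are sub-Gaussian: the average over the signs factorises into hyperbolic cosines.
\<close>

lemma sum_exp_flip_sign_le:
  assumes "finite I" "W \<subseteq> I"
  shows "(\<Sum>\<sigma>\<in>Pow I. exp (s * (\<Sum>i\<in>W. flip_sign \<sigma> i * b i)))
    \<le> real (card (Pow I)) * exp (s\<^sup>2 * (\<Sum>i\<in>W. (b i)\<^sup>2) / 2)"
proof -
  define c where "c = (\<lambda>i. if i \<in> W then s * b i else 0)"
  have "(\<Sum>\<sigma>\<in>Pow I. exp (s * (\<Sum>i\<in>W. flip_sign \<sigma> i * b i)))
      = (\<Sum>\<sigma>\<in>Pow I. (\<Prod>i\<in>\<sigma>. exp (- c i)) * (\<Prod>i\<in>I - \<sigma>. exp (c i)))"
  proof (rule sum.cong[OF refl])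
    fix \<sigma> assume "\<sigma> \<in> Pow I"
    then have \<sigma>: "\<sigma> \<subseteq> I" by simp
    have "s * (\<Sum>i\<in>W. flip_sign \<sigma> i * b i) = (\<Sum>i\<in>W. flip_sign \<sigma> i * c i)"
      by (simp add: sum_distrib_left c_def mult.left_commute)
    also have "\<dots> = (\<Sum>i\<in>I. flip_sign \<sigma> i * c i)"
      using assms by (intro sum.mono_neutral_left) (auto simp: c_def)
    also have "\<dots> = (\<Sum>i\<in>\<sigma>. flip_sign \<sigma> i * c i) + (\<Sum>i\<in>I - \<sigma>. flip_sign \<sigma> i * c i)"
      using \<sigma> assms(1) by (metis (no_types, lifting) add.commute sum.subset_diff)
    also have "\<dots> = (\<Sum>i\<in>\<sigma>. - c i) + (\<Sum>i\<in>I - \<sigma>. c i)"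
      by (intro arg_cong2[of _ _ _ _ "(+)"] sum.cong) (auto simp: flip_sign_def)
    finally show "exp (s * (\<Sum>i\<in>W. flip_sign \<sigma> i * b i))
        = (\<Prod>i\<in>\<sigma>. exp (- c i)) * (\<Prod>i\<in>I - \<sigma>. exp (c i))"
      using assms(1) \<sigma> finite_subset[OF \<sigma>] by (simp add: exp_add exp_sum)
  qed
  also have "\<dots> = (\<Prod>i\<in>I. exp (- c i) + exp (c i))"
    using assms(1) by (simp add: prod_add)
  also have "\<dots> \<le> (\<Prod>i\<in>I. 2 * exp ((c i)\<^sup>2 / 2))"
  proof (intro prod_mono conjI)
    show "exp (- c i) + exp (c i) \<le> 2 * exp ((c i)\<^sup>2 / 2)" for i
      using cosh_le_exp_square[of "c i"] by (simp add: cosh_def)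
  qed (simp add: add_nonneg_nonneg)
  also have "\<dots> = 2 ^ card I * exp (\<Sum>i\<in>I. (c i)\<^sup>2 / 2)"
    using assms(1) by (simp add: prod.distrib exp_sum)
  also have "(\<Sum>i\<in>I. (c i)\<^sup>2 / 2) = (\<Sum>i\<in>W. (c i)\<^sup>2 / 2)"
    using assms by (intro sum.mono_neutral_right) (auto simp: c_def)
  also have "\<dots> = s\<^sup>2 * (\<Sum>i\<in>W. (b i)\<^sup>2) / 2"
    by (simp add: c_def sum_distrib_left power_mult_distrib sum_divide_distrib)
  finally show ?thesis using assms(1) by (simp add: card_Pow)
qed

lemma square_diff_le: "(a - b)\<^sup>2 \<le> 2 * (a\<^sup>2 + b\<^sup>2)" for a b :: real
  using zero_le_power2[of "a + b"] by (simp add: power2_sum power2_diff)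

lemma sum_affine_dyadic:
  "(\<Sum>k<n. (A + B * real k) / 2 ^ (k + 1)) = A + B - (A + B * (real n + 1)) / 2 ^ n"
proof (induction n)
  case (Suc n)
  have "(\<Sum>k<Suc n. (A + B * real k) / 2 ^ (k + 1))
      = A + B - (A + B * (real n + 1)) / 2 ^ n + (A + B * real n) / 2 ^ (n + 1)"
    by (simp only: sum.lessThan_Suc Suc)
  also have "(A + B * (real n + 1)) / 2 ^ n = (2 * (A + B * (real n + 1))) / 2 ^ (n + 1)"
    by (simp only: power_add power_one_right mult.commute[of _ "2::real"] mult_divide_mult_cancel_left)
  also have "A + B - (2 * (A + B * (real n + 1))) / 2 ^ (n + 1) + (A + B * real n) / 2 ^ (n + 1)
      = A + B - (2 * (A + B * (real n + 1)) - (A + B * real n)) / 2 ^ (n + 1)"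
    by (simp only: diff_divide_distrib)
  also have "2 * (A + B * (real n + 1)) - (A + B * real n) = A + B * (real (Suc n) + 1)"
    by (simp add: algebra_simps)
  finally show ?case by simp
qed simp

text \<open>
The supremum over \<open>T\<close> enters only through an arbitrary selection \<open>\<gamma>\<close>. The selected vector is a sum of
links between its approximations in successive nets. With weights \<open>w k\<close> proportional to the length of
the links, Jensen's inequality splits the exponential into one exponential per link, in which the
increased factor \<open>s / w k\<close> is balanced by the shorter link. The number of possible links is paid for by
\<open>\<beta> k\<close>, the logarithm of that number, which counts only with weight \<open>w k\<close>; as it grows linearly
in \<open>k\<close>, the total stays bounded.
\<close>

lemma chaining:
  fixes X :: "'s \<Rightarrow> ('q \<Rightarrow> real) \<Rightarrow> real"
  assumes S: "finite S" "S \<noteq> {}"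
    and diff: "\<And>\<sigma> x y. X \<sigma> (\<lambda>q. x q - y q) = X \<sigma> x - X \<sigma> y"
    and subgauss: "\<And>s x. (\<Sum>\<sigma>\<in>S. exp (s * X \<sigma> x)) \<le> real (card S) * exp (s\<^sup>2 * (\<Sum>q\<in>Q. (x q)\<^sup>2) / 2)"
    and radius: "\<And>x. x \<in> T \<Longrightarrow> (\<Sum>q\<in>Q. (x q)\<^sup>2) \<le> m"
    and pos: "0 \<le> \<Lambda>" "0 \<le> a" "0 \<le> b"
    and net: "\<And>k. finite (N k)" "\<And>k. N k \<subseteq> T" "\<And>k. real (card (N k)) \<le> exp (\<Lambda> * (a + b * real k))"
      "\<And>k x. x \<in> T \<Longrightarrow> \<exists>y\<in>N k. (\<Sum>q\<in>Q. (x q - y q)\<^sup>2) \<le> m / 4 ^ (k + 1)"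
    and sel: "\<And>\<sigma>. \<sigma> \<in> S \<Longrightarrow> \<gamma> \<sigma> \<in> T"
  shows "(\<Sum>\<sigma>\<in>S. exp (s * X \<sigma> (\<gamma> \<sigma>))) \<le> real (card S) * exp (\<Lambda> * (2 * a + 3 * b) + 2 * s\<^sup>2 * m)"
proof -
  define nsq where "nsq = (\<lambda>x::'q \<Rightarrow> real. \<Sum>q\<in>Q. (x q)\<^sup>2)"
  have m0: "0 \<le> m" 
  proof -
    obtain \<sigma> where "\<sigma> \<in> S" using S by blast
    have "0 \<le> (\<Sum>q\<in>Q. (\<gamma> \<sigma> q)\<^sup>2)" by (intro sum_nonneg) simp
    also have "\<dots> \<le> m" using sel[OF \<open>\<sigma> \<in> S\<close>] by (rule radius)
    finally show ?thesis .
  qed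
  have cS: "1 \<le> real (card S)" using S by (simp add: Suc_leI card_gt_0_iff)
  have "\<forall>k. \<forall>x\<in>T. \<exists>y. y \<in> N k \<and> nsq (\<lambda>q. x q - y q) \<le> m / 4 ^ (k + 1)"
    using net(4) unfolding nsq_def by blast
  then obtain \<pi> where \<pi>: "\<And>k x. x \<in> T \<Longrightarrow> \<pi> k x \<in> N k"
      "\<And>k x. x \<in> T \<Longrightarrow> nsq (\<lambda>q. x q - \<pi> k x q) \<le> m / 4 ^ (k + 1)"
    by metis
  have bound: "(\<Sum>\<sigma>\<in>S. exp (s * X \<sigma> (\<gamma> \<sigma>)))
      \<le> real (card S) * exp (\<Lambda> * (2 * a + 3 * b) + ln (real (card S)) * (1 / 2) ^ n + 2 * s\<^sup>2 * m)"
    if n: "0 < n" for n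
  proof -
    \<comment> \<open>The chain starts at zero, passes through the first \<open>n\<close> nets and ends at the vector itself.\<close>
    define p where "p = (\<lambda>k x. if k = 0 then (\<lambda>q. 0) else if k \<le> n then \<pi> k x else x)"
    define d where "d = (\<lambda>k x q. p (Suc k) x q - p k x q)"
    \<comment> \<open>The weights sum to one; a link has squared length at most \<open>4 * (w k)\<^sup>2 * m\<close>.\<close>
    define w where "w = (\<lambda>k. if k < n then 1 / 2 ^ (k + 1) else 1 / 2 ^ n :: real)"
    \<comment> \<open>The last link runs over no net; there are at most as many of them as signs, and their weight
      vanishes as \<open>n\<close> tends to infinity.\<close>
    define \<beta> where "\<beta> = (\<lambda>k. if k < n then \<Lambda> * (2 * a + b + 2 * b * real k) else ln (real (card S)))"
    define links where "links = (\<lambda>k. (\<lambda>\<sigma>. d k (\<gamma> \<sigma>)) ` S)"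
    have w_pos: "0 < w k" for k by (simp add: w_def)
    have w_sum: "(\<Sum>k\<le>n. w k) = 1"
      using sum_affine_dyadic[of 1 0 n] by (simp add: w_def lessThan_Suc_atMost[symmetric])
    have telescope: "X \<sigma> x = (\<Sum>k\<le>n. X \<sigma> (d k x))" for \<sigma> x
    proof -
      have "(\<Sum>k\<le>n. X \<sigma> (d k x)) = (\<Sum>k<Suc n. X \<sigma> (p (Suc k) x) - X \<sigma> (p k x))"
        by (simp add: d_def diff lessThan_Suc_atMost)
      also have "\<dots> = X \<sigma> (p (Suc n) x) - X \<sigma> (p 0 x)" by (rule sum_lessThan_telescope)
      also have "\<dots> = X \<sigma> x"
        using diff[of \<sigma> "\<lambda>_. 0" "\<lambda>_. 0"] by (simp add: p_def)
      finally show ?thesis ..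
    qed
    have link_norm: "nsq (d k x) \<le> 4 * (w k)\<^sup>2 * m" if "k \<le> n" "x \<in> T" for k x
    proof -
      consider "k = 0" | "0 < k" "k < n" | "k = n" using \<open>k \<le> n\<close> by linarith
      then show ?thesis
      proof cases
        case 1
        have "nsq (\<pi> 1 x) \<le> m" using radius \<pi>(1)[OF \<open>x \<in> T\<close>] net(2) unfolding nsq_def by blast
        then show ?thesis using n 1 by (simp add: d_def p_def w_def power2_eq_square)
      next
        case 2
        have "nsq (d k x) \<le> (\<Sum>q\<in>Q. 2 * ((x q - \<pi> k x q)\<^sup>2 + (x q - \<pi> (Suc k) x q)\<^sup>2))"
          unfolding nsq_def
        proof (rule sum_mono)
          fix q
          have "(d k x q)\<^sup>2 = ((x q - \<pi> k x q) - (x q - \<pi> (Suc k) x q))\<^sup>2"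
            using 2 by (simp add: d_def p_def)
          also have "\<dots> \<le> 2 * ((x q - \<pi> k x q)\<^sup>2 + (x q - \<pi> (Suc k) x q)\<^sup>2)"
            by (rule square_diff_le)
          finally show "(d k x q)\<^sup>2 \<le> 2 * ((x q - \<pi> k x q)\<^sup>2 + (x q - \<pi> (Suc k) x q)\<^sup>2)" .
        qed
        also have "\<dots> = 2 * (nsq (\<lambda>q. x q - \<pi> k x q) + nsq (\<lambda>q. x q - \<pi> (Suc k) x q))"
          by (simp add: nsq_def sum.distrib sum_distrib_left)
        also have "\<dots> \<le> 2 * (m / 4 ^ (k + 1) + m / 4 ^ (Suc k + 1))"
          by (intro mult_left_mono add_mono \<pi>(2)[OF \<open>x \<in> T\<close>]) simp
        also have "\<dots> \<le> 4 * (m / 4 ^ (k + 1))" using m0 by (simp add: field_simps)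
        also have "\<dots> = 4 * (w k)\<^sup>2 * m"
          using 2 by (simp add: w_def power2_eq_square power_mult_distrib[symmetric])
        finally show ?thesis .
      next
        case 3
        have "nsq (d k x) \<le> m / 4 ^ (n + 1)" using \<pi>(2)[OF \<open>x \<in> T\<close>] 3 n by (simp add: d_def p_def)
        also have "\<dots> \<le> 4 * (m / 4 ^ n)" using m0 by (simp add: field_simps)
        also have "\<dots> = 4 * (w k)\<^sup>2 * m"
          using 3 by (simp add: w_def power2_eq_square power_mult_distrib[symmetric])
        finally show ?thesis .
      qed
    qed
    have finlinks: "finite (links k)" for k using S by (simp add: links_def)
    have link_card: "real (card (links k)) \<le> exp (\<beta> k)" if "k \<le> n" for k
    proof -
      consider "k = 0" | "0 < k" "k < n" | "k = n" using \<open>k \<le> n\<close> by linarith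
      then show ?thesis
      proof cases
        case 1
        have "links k \<subseteq> N 1" using n 1 \<pi>(1) sel by (auto simp: links_def d_def p_def)
        then have "real (card (links k)) \<le> real (card (N 1))" using net(1) by (simp add: card_mono)
        also have "\<dots> \<le> exp (\<Lambda> * (a + b * real 1))" by (rule net(3))
        also have "\<dots> \<le> exp (\<beta> k)" using 1 n pos by (auto simp: \<beta>_def intro!: mult_left_mono)
        finally show ?thesis .
      next
        case 2
        have "links k \<subseteq> (\<lambda>(y, z) q. z q - y q) ` (N k \<times> N (Suc k))"
        proof
          fix l assume "l \<in> links k"
          then obtain \<sigma> where "\<sigma> \<in> S" "l = d k (\<gamma> \<sigma>)" by (auto simp: links_def)
          then show "l \<in> (\<lambda>(y, z) q. z q - y q) ` (N k \<times> N (Suc k))"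
            using 2 \<pi>(1) sel by (intro image_eqI[of _ _ "(\<pi> k (\<gamma> \<sigma>), \<pi> (Suc k) (\<gamma> \<sigma>))"])
              (auto simp: d_def p_def)
        qed
        then have "card (links k) \<le> card (N k \<times> N (Suc k))"
          using net(1) by (meson card_image_le card_mono finite_SigmaI finite_imageI le_trans)
        then have "real (card (links k)) \<le> real (card (N k)) * real (card (N (Suc k)))"
          by (metis card_cartesian_product of_nat_mono of_nat_mult)
        also have "\<dots> \<le> exp (\<Lambda> * (a + b * real k)) * exp (\<Lambda> * (a + b * real (Suc k)))"
          by (intro mult_mono net(3)) auto
        also have "\<dots> = exp (\<beta> k)" using 2 by (simp add: \<beta>_def exp_add[symmetric] algebra_simps)
        finally show ?thesis .
      next
        case 3
        then show ?thesis using cS card_image_le[OF S(1)] by (simp add: \<beta>_def links_def)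
      qed
    qed
    have link_sum: "(\<Sum>\<sigma>\<in>S. exp (s / w k * X \<sigma> (d k (\<gamma> \<sigma>)))) \<le> exp (\<beta> k) * (real (card S) * exp (2 * s\<^sup>2 * m))"
      if "k \<le> n" for k
    proof -
      have "(\<Sum>\<sigma>\<in>S. exp (s / w k * X \<sigma> (d k (\<gamma> \<sigma>)))) \<le> (\<Sum>\<sigma>\<in>S. \<Sum>y\<in>links k. exp (s / w k * X \<sigma> y))"
      proof (rule sum_mono)
        fix \<sigma> assume "\<sigma> \<in> S"
        then have "d k (\<gamma> \<sigma>) \<in> links k" by (auto simp: links_def)
        then show "exp (s / w k * X \<sigma> (d k (\<gamma> \<sigma>))) \<le> (\<Sum>y\<in>links k. exp (s / w k * X \<sigma> y))"
          using finlinks by (intro member_le_sum) auto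
      qed
      also have "\<dots> = (\<Sum>y\<in>links k. \<Sum>\<sigma>\<in>S. exp (s / w k * X \<sigma> y))" by (rule sum.swap)
      also have "\<dots> \<le> (\<Sum>y\<in>links k. real (card S) * exp (2 * s\<^sup>2 * m))"
      proof (rule sum_mono)
        fix y assume "y \<in> links k"
        then have y: "nsq y \<le> 4 * (w k)\<^sup>2 * m" using link_norm[OF that] sel by (auto simp: links_def)
        have "(\<Sum>\<sigma>\<in>S. exp (s / w k * X \<sigma> y)) \<le> real (card S) * exp ((s / w k)\<^sup>2 * nsq y / 2)"
          unfolding nsq_def by (rule subgauss)
        also have "\<dots> \<le> real (card S) * exp ((s / w k)\<^sup>2 * (4 * (w k)\<^sup>2 * m) / 2)"
          using y by (intro mult_left_mono divide_right_mono iffD2[OF exp_le_cancel_iff]) auto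
        also have "(s / w k)\<^sup>2 * (4 * (w k)\<^sup>2 * m) / 2 = 2 * s\<^sup>2 * m"
          using w_pos[of k] by (simp add: power_divide)
        finally show "(\<Sum>\<sigma>\<in>S. exp (s / w k * X \<sigma> y)) \<le> real (card S) * exp (2 * s\<^sup>2 * m)" .
      qed
      also have "\<dots> = real (card (links k)) * (real (card S) * exp (2 * s\<^sup>2 * m))" by simp
      also have "\<dots> \<le> exp (\<beta> k) * (real (card S) * exp (2 * s\<^sup>2 * m))"
        using link_card[OF that] by (intro mult_right_mono) auto
      finally show ?thesis .
    qed
    have jensen: "exp (s * X \<sigma> (\<gamma> \<sigma>)) \<le> exp (\<Sum>k\<le>n. w k * \<beta> k) *
        (\<Sum>k\<le>n. w k * exp (- \<beta> k) * exp (s / w k * X \<sigma> (d k (\<gamma> \<sigma>))))" for \<sigma>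
    proof -
      have "s * X \<sigma> (\<gamma> \<sigma>) = (\<Sum>k\<le>n. w k * (s / w k * X \<sigma> (d k (\<gamma> \<sigma>))))"
        using w_pos by (subst telescope) (auto simp: sum_distrib_left less_imp_neq[symmetric] intro!: sum.cong)
      also have "\<dots> = (\<Sum>k\<le>n. w k * \<beta> k) + (\<Sum>k\<le>n. w k *\<^sub>R (s / w k * X \<sigma> (d k (\<gamma> \<sigma>)) - \<beta> k))"
        by (simp add: sum.distrib[symmetric] algebra_simps)
      finally have "exp (s * X \<sigma> (\<gamma> \<sigma>)) = exp (\<Sum>k\<le>n. w k * \<beta> k) *
          exp (\<Sum>k\<le>n. w k *\<^sub>R (s / w k * X \<sigma> (d k (\<gamma> \<sigma>)) - \<beta> k))"
        by (simp add: exp_add)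
      also have "\<dots> \<le> exp (\<Sum>k\<le>n. w k * \<beta> k) *
          (\<Sum>k\<le>n. w k * exp (s / w k * X \<sigma> (d k (\<gamma> \<sigma>)) - \<beta> k))"
        using w_pos w_sum by (intro mult_left_mono convex_on_sum[OF _ _ exp_convex]) (auto intro: less_imp_le)
      also have "\<dots> = exp (\<Sum>k\<le>n. w k * \<beta> k) *
        (\<Sum>k\<le>n. w k * exp (- \<beta> k) * exp (s / w k * X \<sigma> (d k (\<gamma> \<sigma>))))"
        by (simp add: exp_diff exp_minus divide_inverse mult_ac)
      finally show ?thesis .
    qed
    have "(\<Sum>\<sigma>\<in>S. exp (s * X \<sigma> (\<gamma> \<sigma>))) \<le> (\<Sum>\<sigma>\<in>S. exp (\<Sum>k\<le>n. w k * \<beta> k) *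
        (\<Sum>k\<le>n. w k * exp (- \<beta> k) * exp (s / w k * X \<sigma> (d k (\<gamma> \<sigma>)))))"
      by (intro sum_mono jensen)
    also have "\<dots> = exp (\<Sum>k\<le>n. w k * \<beta> k) *
        (\<Sum>k\<le>n. w k * exp (- \<beta> k) * (\<Sum>\<sigma>\<in>S. exp (s / w k * X \<sigma> (d k (\<gamma> \<sigma>)))))"
      by (simp only: sum_distrib_left[symmetric] sum.swap[of _ "{..n}" S])
    also have "\<dots> \<le> exp (\<Sum>k\<le>n. w k * \<beta> k) *
        (\<Sum>k\<le>n. w k * exp (- \<beta> k) * (exp (\<beta> k) * (real (card S) * exp (2 * s\<^sup>2 * m))))"
      using w_pos link_sum by (intro mult_left_mono sum_mono) (auto intro: less_imp_le)
    also have "\<dots> = exp (\<Sum>k\<le>n. w k * \<beta> k) * (real (card S) * exp (2 * s\<^sup>2 * m))"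
    proof -
      have cancel: "w k * exp (- \<beta> k) * (exp (\<beta> k) * c) = w k * c" for k c
        by (simp add: exp_minus)
      show ?thesis by (simp only: cancel sum_distrib_right[symmetric] w_sum mult_1)
    qed
    also have "\<dots> \<le> exp (\<Lambda> * (2 * a + 3 * b) + ln (real (card S)) * (1 / 2) ^ n) *
        (real (card S) * exp (2 * s\<^sup>2 * m))"
    proof (intro mult_right_mono)
      have "(\<Sum>k\<le>n. w k * \<beta> k) = (\<Sum>k<n. \<Lambda> * ((2 * a + b + 2 * b * real k) / 2 ^ (k + 1))) +
          ln (real (card S)) * (1 / 2) ^ n"
        by (simp add: lessThan_Suc_atMost[symmetric] w_def \<beta>_def power_divide)
      also have "(\<Sum>k<n. \<Lambda> * ((2 * a + b + 2 * b * real k) / 2 ^ (k + 1)))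
          = \<Lambda> * (2 * a + b + 2 * b - (2 * a + b + 2 * b * (real n + 1)) / 2 ^ n)"
        by (simp only: sum_distrib_left[symmetric] sum_affine_dyadic)
      also have "\<dots> \<le> \<Lambda> * (2 * a + 3 * b)" using pos by (intro mult_left_mono) auto
      finally show "exp (\<Sum>k\<le>n. w k * \<beta> k) \<le> exp (\<Lambda> * (2 * a + 3 * b) + ln (real (card S)) * (1 / 2) ^ n)"
        by simp
    qed auto
    also have "\<dots> = real (card S) * exp (\<Lambda> * (2 * a + 3 * b) + ln (real (card S)) * (1 / 2) ^ n + 2 * s\<^sup>2 * m)"
      by (simp add: exp_add mult_ac)
    finally show ?thesis .
  qed
  have "(\<lambda>n. real (card S) * exp (\<Lambda> * (2 * a + 3 * b) + ln (real (card S)) * (1 / 2) ^ n + 2 * s\<^sup>2 * m))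
      \<longlonglongrightarrow> real (card S) * exp (\<Lambda> * (2 * a + 3 * b) + ln (real (card S)) * 0 + 2 * s\<^sup>2 * m)"
    by (intro tendsto_intros LIMSEQ_realpow_zero) auto
  then have "(\<Sum>\<sigma>\<in>S. exp (s * X \<sigma> (\<gamma> \<sigma>)))
      \<le> real (card S) * exp (\<Lambda> * (2 * a + 3 * b) + ln (real (card S)) * 0 + 2 * s\<^sup>2 * m)"
    by (rule LIMSEQ_le_const) (use bound in \<open>auto intro!: exI[of _ 1]\<close>)
  then show ?thesis by simp
qed

text \<open>
A separated subset of maximal cardinality is a net.
\<close>

lemma exists_net:
  fixes H :: "('a \<Rightarrow> real) set" and z :: "'q \<Rightarrow> 'a"
  assumes Q: "finite Q" "\<And>q. q \<in> Q \<Longrightarrow> z q \<in> D"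
    and H: "\<And>f x. f \<in> H \<Longrightarrow> x \<in> D \<Longrightarrow> 0 \<le> f x \<and> f x \<le> 1"
    and vc: "vc_dim (subgraph D ` H) \<le> enat v"
  shows "\<exists>N. finite N \<and> N \<subseteq> H \<and> real (card N) \<le> exp (real v * (6 + 4 * real j)) \<and>
    (\<forall>f\<in>H. \<exists>g\<in>N. (\<Sum>q\<in>Q. (f (z q) - g (z q))\<^sup>2) \<le> real (card Q) / 4 ^ j)"
proof -
  define sep where "sep = (\<lambda>F. finite F \<and> F \<subseteq> H \<and> (\<forall>f\<in>F. \<forall>g\<in>F. f \<noteq> g \<longrightarrow>
      real (card Q) / 4 ^ j < (\<Sum>q\<in>Q. (f (z q) - g (z q))\<^sup>2)))"
  have bound: "real (card F) \<le> exp (real v * (6 + 4 * real j))" if "sep F" for F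
    using that unfolding sep_def by (intro packing_bound[where Q = Q and z = z and D = D and H = H] Q H vc) auto
  have "\<forall>F. sep F \<longrightarrow> card F < nat \<lceil>exp (real v * (6 + 4 * real j))\<rceil> + 1"
  proof (intro allI impI)
    fix F assume "sep F"
    then have "real (card F) \<le> real (nat \<lceil>exp (real v * (6 + 4 * real j))\<rceil>)"
      using bound real_nat_ceiling_ge order_trans by blast
    then show "card F < nat \<lceil>exp (real v * (6 + 4 * real j))\<rceil> + 1" by linarith
  qed
  moreover have "sep {}" by (simp add: sep_def)
  ultimately obtain N where N: "sep N" "\<And>F. sep F \<Longrightarrow> card F \<le> card N"
    by (metis ex_has_greatest_nat)
  show ?thesis
  proof (intro exI[of _ N] conjI ballI)
    show "finite N" "N \<subseteq> H" using N(1) by (auto simp: sep_def)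
    show "real (card N) \<le> exp (real v * (6 + 4 * real j))" using N(1) by (rule bound)
    fix f assume "f \<in> H"
    show "\<exists>g\<in>N. (\<Sum>q\<in>Q. (f (z q) - g (z q))\<^sup>2) \<le> real (card Q) / 4 ^ j"
    proof (rule ccontr)
      assume *: "\<not> ?thesis"
      have "f \<notin> N"
      proof
        assume "f \<in> N"
        with * have "\<not> (\<Sum>q\<in>Q. (f (z q) - f (z q))\<^sup>2) \<le> real (card Q) / 4 ^ j" by blast
        then show False by simp
      qed
      have "sep (insert f N)"
        using N(1) * \<open>f \<in> H\<close> power2_commute[of "f _"] unfolding sep_def by (auto simp: not_le)
      with N(2) have "card (insert f N) \<le> card N" .
      with \<open>f \<notin> N\<close> \<open>finite N\<close> show False by simp
    qed
  qed
qed

text \<open>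
Chaining for vectors of differences \<open>\<psi> g (z i) - \<psi> g (z' i)\<close> where \<open>g\<close> is chosen separately on each block
\<open>{i \<in> W. \<kappa> i = j}\<close>. The nets are products of nets of the blocks, so the logarithm of their cardinality is
proportional to the number of blocks. The squared lengths add up over the blocks, so the variance term
does not see how \<open>W\<close> is divided.
\<close>

lemma sum_exp_flip_sign_selection_le:
  fixes H :: "('a \<Rightarrow> real) set" and z z' :: "nat \<Rightarrow> 'a" and \<kappa> :: "nat \<Rightarrow> 'j"
    and f :: "'j \<Rightarrow> nat set \<Rightarrow> 'a \<Rightarrow> real" and R :: "'a set"
  assumes I: "finite I" "W \<subseteq> I"
    and z: "\<And>i. i \<in> W \<Longrightarrow> z i \<in> D" "\<And>i. i \<in> W \<Longrightarrow> z' i \<in> D"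
    and H: "\<And>f x. f \<in> H \<Longrightarrow> x \<in> D \<Longrightarrow> 0 \<le> f x \<and> f x \<le> 1"
    and vc: "vc_dim (subgraph D ` H) \<le> enat v"
    and f: "\<And>i \<sigma>. i \<in> W \<Longrightarrow> \<sigma> \<subseteq> I \<Longrightarrow> f (\<kappa> i) \<sigma> \<in> H"
  shows "(\<Sum>\<sigma>\<in>Pow I. exp (s * (\<Sum>i\<in>W. flip_sign \<sigma> i *
        (f (\<kappa> i) \<sigma> (z i) * indicator R (z i) - f (\<kappa> i) \<sigma> (z' i) * indicator R (z' i)))))
    \<le> real (card (Pow I)) * exp (40 * real (card (\<kappa> ` W)) * real v
        + 2 * s\<^sup>2 * (\<Sum>i\<in>W. indicator R (z i) + indicator R (z' i)))"
proof -
  define J where "J = \<kappa> ` W"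
  define zz where "zz = (\<lambda>(i, b). if b then z i else z' i)"
  \<comment> \<open>The points of both samples in the tail region, block by block; the approximation is in mean
    square over these points.\<close>
  define Q where "Q = (\<lambda>j. {q \<in> {i \<in> W. \<kappa> i = j} \<times> UNIV. zz q \<in> R})"
  define \<psi> where "\<psi> = (\<lambda>(g :: 'a \<Rightarrow> real) x. g x * indicator R x :: real)"
  define vec where "vec = (\<lambda>(\<phi> :: 'j \<Rightarrow> 'a \<Rightarrow> real) i. \<psi> (\<phi> (\<kappa> i)) (z i) - \<psi> (\<phi> (\<kappa> i)) (z' i))"
  define \<Phi> where "\<Phi> = {\<phi>. \<forall>j\<in>J. \<phi> j \<in> H}"
  define m :: real where "m = (\<Sum>i\<in>W. indicator R (z i) + indicator R (z' i))"
  have finW: "finite W" using I finite_subset by blast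
  then have finJ: "finite J" by (simp add: J_def)
  have finQ: "finite (Q j)" for j
    unfolding Q_def using finW by (intro finite_Collect_conjI disjI1) (simp add: finite_cartesian_product)
  have sumQ: "(\<Sum>q\<in>Q j. h q) = (\<Sum>i\<in>{i\<in>W. \<kappa> i = j}. indicator R (z i) * h (i, True) + indicator R (z' i) * h (i, False))"
    for j and h :: "nat \<times> bool \<Rightarrow> real"
  proof -
    have "(\<Sum>q\<in>Q j. h q) = (\<Sum>q\<in>{i \<in> W. \<kappa> i = j} \<times> UNIV. if zz q \<in> R then h q else 0)"
      unfolding Q_def using finW by (subst sum.inter_filter) (auto intro: finite_cartesian_product)
    also have "\<dots> = (\<Sum>i\<in>{i\<in>W. \<kappa> i = j}. \<Sum>b\<in>UNIV. if zz (i, b) \<in> R then h (i, b) else 0)"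
      by (simp add: sum.cartesian_product)
    also have "\<dots> = (\<Sum>i\<in>{i\<in>W. \<kappa> i = j}. indicator R (z i) * h (i, True) + indicator R (z' i) * h (i, False))"
      by (intro sum.cong) (auto simp: UNIV_bool zz_def indicator_def)
    finally show ?thesis .
  qed
  have sum_blocks: "(\<Sum>i\<in>W. h i) = (\<Sum>j\<in>J. \<Sum>i\<in>{i\<in>W. \<kappa> i = j}. h i)" for h :: "nat \<Rightarrow> real"
    using finW finJ by (subst sum.group) (auto simp: J_def)
  have m_blocks: "m = (\<Sum>j\<in>J. real (card (Q j)))"
  proof -
    have "m = (\<Sum>j\<in>J. \<Sum>q\<in>Q j. 1)" unfolding m_def sum_blocks sumQ by simp
    then show ?thesis by simp
  qed
  \<comment> \<open>One level finer than the chain requires: a factor \<open>2\<close> is lost when differences over the two samples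
    are estimated by the points of both.\<close>
  define is_net where "is_net = (\<lambda>j k N. finite N \<and> N \<subseteq> H \<and> real (card N) \<le> exp (real v * (6 + 4 * real (k + 2))) \<and>
      (\<forall>g\<in>H. \<exists>h\<in>N. (\<Sum>q\<in>Q j. (g (zz q) - h (zz q))\<^sup>2) \<le> real (card (Q j)) / 4 ^ (k + 2)))"
  have "\<exists>N. is_net j k N" for j k
  proof -
    have "zz q \<in> D" if "q \<in> Q j" for q using that z by (auto simp: Q_def zz_def split: if_splits)
    then show ?thesis unfolding is_net_def
      by (intro exists_net[where D = D and H = H and v = v] finQ H vc)
  qed
  then obtain net where is_net: "\<And>j k. is_net j k (net j k)" by metis
  have net: "\<And>j k. finite (net j k)" "\<And>j k. net j k \<subseteq> H"
      "\<And>j k. real (card (net j k)) \<le> exp (real v * (6 + 4 * real (k + 2)))"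
      "\<And>j k g. g \<in> H \<Longrightarrow> \<exists>h\<in>net j k. (\<Sum>q\<in>Q j. (g (zz q) - h (zz q))\<^sup>2) \<le> real (card (Q j)) / 4 ^ (k + 2)"
    using is_net unfolding is_net_def by blast+
  define N where "N = (\<lambda>k. vec ` (\<Pi>\<^sub>E j\<in>J. net j k))"
  define X where "X = (\<lambda>\<sigma> (x :: nat \<Rightarrow> real). \<Sum>i\<in>W. flip_sign \<sigma> i * x i)"
  have "(\<Sum>\<sigma>\<in>Pow I. exp (s * X \<sigma> (vec (\<lambda>j. f j \<sigma>))))
    \<le> real (card (Pow I)) * exp (real (card J) * real v * (2 * 14 + 3 * 4) + 2 * s\<^sup>2 * m)"
  proof (rule chaining[where X = X and \<gamma> = "\<lambda>\<sigma>. vec (\<lambda>j. f j \<sigma>)" and Q = W and T = "vec ` \<Phi>" and N = N])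
    show "finite (Pow I)" "Pow I \<noteq> {}" using I by auto
    show "X \<sigma> (\<lambda>q. x q - y q) = X \<sigma> x - X \<sigma> y" for \<sigma> x y
      by (simp add: X_def sum_subtractf[symmetric] algebra_simps)
    show "(\<Sum>\<sigma>\<in>Pow I. exp (s * X \<sigma> x)) \<le> real (card (Pow I)) * exp (s\<^sup>2 * (\<Sum>q\<in>W. (x q)\<^sup>2) / 2)" for s x
      unfolding X_def using I by (rule sum_exp_flip_sign_le)
    show "(\<Sum>q\<in>W. (x q)\<^sup>2) \<le> m" if "x \<in> vec ` \<Phi>" for x
      unfolding m_def
    proof (rule sum_mono)
      fix i assume i: "i \<in> W"
      obtain \<phi> where \<phi>: "\<phi> \<in> \<Phi>" "x = vec \<phi>" using \<open>x \<in> vec ` \<Phi>\<close> by blast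
      have "\<phi> (\<kappa> i) \<in> H" using \<phi> i by (auto simp: \<Phi>_def J_def)
      with H z i have b: "0 \<le> \<phi> (\<kappa> i) (z i)" "\<phi> (\<kappa> i) (z i) \<le> 1" "0 \<le> \<phi> (\<kappa> i) (z' i)" "\<phi> (\<kappa> i) (z' i) \<le> 1"
        by blast+
      then have "\<bar>\<phi> (\<kappa> i) (z i) - \<phi> (\<kappa> i) (z' i)\<bar> \<le> 1" by linarith
      then have "(\<phi> (\<kappa> i) (z i) - \<phi> (\<kappa> i) (z' i))\<^sup>2 \<le> 1" by (simp add: abs_square_le_1)
      with b show "(x i)\<^sup>2 \<le> indicator R (z i) + indicator R (z' i)"
        unfolding \<phi> vec_def \<psi>_def by (auto simp: indicator_def power_le_one)
    qed
    show "finite (N k)" for k using finJ net(1) by (auto simp: N_def intro!: finite_PiE)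
    show "N k \<subseteq> vec ` \<Phi>" for k using net(2) by (fastforce simp: N_def \<Phi>_def PiE_def Pi_def)
    show "real (card (N k)) \<le> exp (real (card J) * real v * (14 + 4 * real k))" for k
    proof -
      have "card (N k) \<le> card (\<Pi>\<^sub>E j\<in>J. net j k)"
        unfolding N_def using finJ net(1) by (intro card_image_le finite_PiE) auto
      then have "real (card (N k)) \<le> (\<Prod>j\<in>J. real (card (net j k)))"
        using finJ by (simp add: card_PiE flip: of_nat_prod)
      also have "\<dots> \<le> (\<Prod>j\<in>J. exp (real v * (6 + 4 * real (k + 2))))"
        by (intro prod_mono conjI net(3)) simp
      also have "\<dots> = exp (real (card J) * real v * (14 + 4 * real k))"
        by (simp add: exp_of_nat_mult[symmetric] algebra_simps)
      finally show ?thesis .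
    qed
    show "\<exists>y\<in>N k. (\<Sum>q\<in>W. (x q - y q)\<^sup>2) \<le> m / 4 ^ (k + 1)" if "x \<in> vec ` \<Phi>" for k x
    proof -
      obtain \<phi> where \<phi>: "\<phi> \<in> \<Phi>" "x = vec \<phi>" using \<open>x \<in> vec ` \<Phi>\<close> by blast
      have "\<forall>j\<in>J. \<exists>h\<in>net j k. (\<Sum>q\<in>Q j. (\<phi> j (zz q) - h (zz q))\<^sup>2) \<le> real (card (Q j)) / 4 ^ (k + 2)"
        using net(4) \<phi>(1) by (auto simp: \<Phi>_def)
      then obtain \<eta>0 where \<eta>0: "\<And>j. j \<in> J \<Longrightarrow> \<eta>0 j \<in> net j k"
        "\<And>j. j \<in> J \<Longrightarrow> (\<Sum>q\<in>Q j. (\<phi> j (zz q) - \<eta>0 j (zz q))\<^sup>2) \<le> real (card (Q j)) / 4 ^ (k + 2)"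
        by metis
      define \<eta> where "\<eta> = restrict \<eta>0 J"
      have \<eta>: "\<And>j. j \<in> J \<Longrightarrow> (\<Sum>q\<in>Q j. (\<phi> j (zz q) - \<eta> j (zz q))\<^sup>2) \<le> real (card (Q j)) / 4 ^ (k + 2)"
        using \<eta>0(2) by (simp add: \<eta>_def)
      have "vec \<eta> \<in> N k" using \<eta>0(1) by (auto simp: N_def \<eta>_def)
      moreover have "(\<Sum>i\<in>W. (x i - vec \<eta> i)\<^sup>2) \<le> m / 4 ^ (k + 1)"
      proof -
        have "(\<Sum>i\<in>W. (x i - vec \<eta> i)\<^sup>2) = (\<Sum>j\<in>J. \<Sum>i\<in>{i\<in>W. \<kappa> i = j}. (x i - vec \<eta> i)\<^sup>2)"
          by (rule sum_blocks)
        also have "\<dots> \<le> (\<Sum>j\<in>J. 2 * (real (card (Q j)) / 4 ^ (k + 2)))"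
        proof (rule sum_mono)
          fix j assume j: "j \<in> J"
          have "(\<Sum>i\<in>{i\<in>W. \<kappa> i = j}. (x i - vec \<eta> i)\<^sup>2)
              \<le> (\<Sum>i\<in>{i\<in>W. \<kappa> i = j}. 2 * (indicator R (z i) * (\<phi> j (z i) - \<eta> j (z i))\<^sup>2
                + indicator R (z' i) * (\<phi> j (z' i) - \<eta> j (z' i))\<^sup>2))"
          proof (rule sum_mono)
            fix i assume "i \<in> {i\<in>W. \<kappa> i = j}"
            then have "x i - vec \<eta> i = indicator R (z i) * (\<phi> j (z i) - \<eta> j (z i))
                - indicator R (z' i) * (\<phi> j (z' i) - \<eta> j (z' i))" (is "_ = ?a - ?b")
              unfolding \<phi> vec_def \<psi>_def by (auto simp: algebra_simps)
            then have "(x i - vec \<eta> i)\<^sup>2 = (?a - ?b)\<^sup>2" by simp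
            also have "\<dots> \<le> 2 * (?a\<^sup>2 + ?b\<^sup>2)"
              by (rule square_diff_le)
            also have "\<dots> = 2 * (indicator R (z i) * (\<phi> j (z i) - \<eta> j (z i))\<^sup>2
                + indicator R (z' i) * (\<phi> j (z' i) - \<eta> j (z' i))\<^sup>2)"
              by (auto simp: indicator_def)
            finally show "(x i - vec \<eta> i)\<^sup>2 \<le> \<dots>" .
          qed
          also have "\<dots> = 2 * (\<Sum>q\<in>Q j. (\<phi> j (zz q) - \<eta> j (zz q))\<^sup>2)"
            by (simp add: sumQ sum_distrib_left zz_def)
          also have "\<dots> \<le> 2 * (real (card (Q j)) / 4 ^ (k + 2))"
            using \<eta>[OF j] by simp
          finally show "(\<Sum>i\<in>{i\<in>W. \<kappa> i = j}. (x i - vec \<eta> i)\<^sup>2) \<le> 2 * (real (card (Q j)) / 4 ^ (k + 2))" .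
        qed
        also have "\<dots> = m * (2 / 4 ^ (k + 2))"
          unfolding m_blocks by (simp add: sum_divide_distrib)
        also have "\<dots> \<le> m * (1 / 4 ^ (k + 1))"
          unfolding m_blocks by (intro mult_left_mono sum_nonneg) (auto simp: field_simps)
        finally show ?thesis by simp
      qed
      ultimately show ?thesis by blast
    qed
    show "vec (\<lambda>j. f j \<sigma>) \<in> vec ` \<Phi>" if "\<sigma> \<in> Pow I" for \<sigma>
      using f that by (auto simp: \<Phi>_def J_def)
  qed auto
  then show ?thesis
    unfolding X_def vec_def \<psi>_def m_def J_def by (simp add: mult.commute mult.left_commute)
qed

section \<open>Exponential moments of deviations at data-dependent functions\<close>

lemma nn_integral_exp_count_le:
  fixes P :: "'a measure"
  assumes "prob_space P" and R: "R \<in> sets P" and K: "finite K" "L \<subseteq> K"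
  shows "(\<integral>\<^sup>+y. ennreal (exp (c * (\<Sum>i\<in>L. indicator R (y i)))) \<partial>PiM K (\<lambda>_. P))
    \<le> ennreal (exp (real (card L) * measure P R * (exp c - 1)))"
proof -
  interpret P: prob_space P by fact
  interpret product_sigma_finite "\<lambda>_ :: 'b. P" by standard
  note R[measurable]
  define f where "f = (\<lambda>i x. if i \<in> L then ennreal (exp (c * indicator R x)) else 1)"
  have finL: "finite L" using K finite_subset by blast
  have "(\<integral>\<^sup>+y. ennreal (exp (c * (\<Sum>i\<in>L. indicator R (y i)))) \<partial>PiM K (\<lambda>_. P))
      = (\<integral>\<^sup>+y. (\<Prod>i\<in>K. f i (y i)) \<partial>PiM K (\<lambda>_. P))"
  proof (rule nn_integral_cong)
    fix y :: "'b \<Rightarrow> 'a"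
    have "(\<Prod>i\<in>K. f i (y i)) = (\<Prod>i\<in>L. ennreal (exp (c * indicator R (y i))))"
      using K by (intro prod.mono_neutral_cong_right) (auto simp: f_def)
    also have "\<dots> = ennreal (\<Prod>i\<in>L. exp (c * indicator R (y i)))"
      by (intro prod_ennreal) simp
    also have "\<dots> = ennreal (exp (c * (\<Sum>i\<in>L. indicator R (y i))))"
      by (simp only: sum_distrib_left exp_sum[OF finL])
    finally show "ennreal (exp (c * (\<Sum>i\<in>L. indicator R (y i)))) = (\<Prod>i\<in>K. f i (y i))" ..
  qed
  also have "\<dots> = (\<Prod>i\<in>K. \<integral>\<^sup>+x. f i x \<partial>P)"
    using K by (intro product_nn_integral_prod) (auto simp: f_def)
  also have "\<dots> = (\<Prod>i\<in>L. \<integral>\<^sup>+x. ennreal (exp (c * indicator R x)) \<partial>P)"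
    using K by (intro prod.mono_neutral_cong_right) (auto simp: f_def P.emeasure_space_1)
  also have "(\<integral>\<^sup>+x. ennreal (exp (c * indicator R x)) \<partial>P) = ennreal (1 + measure P R * (exp c - 1))"
  proof -
    have int: "integrable P (\<lambda>x. 1 + indicator R x * (exp c - 1))"
      using R by (intro Bochner_Integration.integrable_add integrable_mult_left integrable_real_indicator)
        (auto simp: P.emeasure_eq_measure)
    have "(\<integral>\<^sup>+x. ennreal (exp (c * indicator R x)) \<partial>P) = (\<integral>\<^sup>+x. ennreal (1 + indicator R x * (exp c - 1)) \<partial>P)"
      by (intro nn_integral_cong) (auto simp: indicator_def)
    also have "\<dots> = ennreal (\<integral>x. 1 + indicator R x * (exp c - 1) \<partial>P)"
      using int by (intro nn_integral_eq_integral) (auto simp: indicator_def)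
    also have "(\<integral>x. 1 + indicator R x * (exp c - 1) \<partial>P) = 1 + measure P R * (exp c - 1)"
      using R by (subst Bochner_Integration.integral_add)
        (auto simp: P.prob_space P.emeasure_eq_measure intro!: integrable_mult_left integrable_real_indicator)
    finally show ?thesis .
  qed
  also have "(\<Prod>i\<in>L. ennreal (1 + measure P R * (exp c - 1))) \<le> (\<Prod>i\<in>L. ennreal (exp (measure P R * (exp c - 1))))"
    by (intro prod_mono_ennreal ennreal_leI exp_ge_add_one_self)
  also have "\<dots> = ennreal (exp (real (card L) * measure P R * (exp c - 1)))"
    by (simp add: ennreal_power exp_of_nat_mult[symmetric] mult.assoc)
  finally show ?thesis .
qed

text \<open>
The expectation is that of an independent ghost point, and Jensen's inequality moves it out of the
exponential.
\<close>

lemma exp_centred_sum_le_ghost: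
  fixes P :: "'a measure" and g :: "nat \<Rightarrow> 'a \<Rightarrow> real"
  assumes "prob_space P" and W: "finite W" "\<And>i. i \<in> W \<Longrightarrow> r i \<in> K"
    and g: "\<And>i. i \<in> W \<Longrightarrow> g i \<in> borel_measurable P"
      "\<And>i x. i \<in> W \<Longrightarrow> x \<in> space P \<Longrightarrow> 0 \<le> g i x \<and> g i x \<le> 1"
  shows "ennreal (exp (s * (\<Sum>i\<in>W. a i - (\<integral>x. g i x \<partial>P))))
    \<le> (\<integral>\<^sup>+y. ennreal (exp (s * (\<Sum>i\<in>W. a i - g i (y (r i))))) \<partial>PiM K (\<lambda>_. P))"
proof -
  interpret P: prob_space P by fact
  interpret prod: product_prob_space "\<lambda>_. P" K by standard
  let ?M = "PiM K (\<lambda>_. P)"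
  define Y where "Y = (\<lambda>y. s * (\<Sum>i\<in>W. a i - g i (y (r i))))"
  have comp [measurable]: "(\<lambda>y. g i (y (r i))) \<in> borel_measurable ?M" if "i \<in> W" for i
    using measurable_compose[OF measurable_component_singleton[OF W(2)[OF that]] g(1)[OF that]] .
  have Ym [measurable]: "Y \<in> borel_measurable ?M" unfolding Y_def by measurable
  have in_space: "y (r i) \<in> space P" if "y \<in> space ?M" "i \<in> W" for y i
    using that W(2) by (auto simp: space_PiM)
  define B where "B = \<bar>s\<bar> * (\<Sum>i\<in>W. \<bar>a i\<bar> + 1)"
  have Yb: "\<bar>Y y\<bar> \<le> B" if "y \<in> space ?M" for y
  proof -
    have "\<bar>\<Sum>i\<in>W. a i - g i (y (r i))\<bar> \<le> (\<Sum>i\<in>W. \<bar>a i\<bar> + 1)"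
    proof (rule order_trans[OF sum_abs], rule sum_mono)
      fix i assume "i \<in> W"
      with g(2)[OF this in_space[OF that this]] show "\<bar>a i - g i (y (r i))\<bar> \<le> \<bar>a i\<bar> + 1" by linarith
    qed
    then show ?thesis unfolding Y_def B_def abs_mult by (rule mult_left_mono) simp
  qed
  have int_comp: "integrable ?M (\<lambda>y. g i (y (r i)))" if "i \<in> W" for i
    using g(2)[OF that in_space[OF _ that]] that
    by (intro prod.P.integrable_const_bound[of _ 1]) auto
  have intY: "integrable ?M Y" using Yb by (intro prod.P.integrable_const_bound[of _ B]) auto
  have intE: "integrable ?M (\<lambda>y. exp (Y y))"
    using Yb by (intro prod.P.integrable_const_bound[of _ "exp B"]) (auto simp: abs_le_iff)
  have "s * (\<Sum>i\<in>W. a i - (\<integral>x. g i x \<partial>P)) = (\<integral>y. Y y \<partial>?M)"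
  proof -
    have "(\<integral>y. g i (y (r i)) \<partial>?M) = (\<integral>x. g i x \<partial>P)" if "i \<in> W" for i
      using that W(2) g(1) by (subst prod.PiM_component[of "r i", symmetric]) (auto simp: integral_distr)
    then show ?thesis unfolding Y_def using int_comp prod.P.prob_space
      by (simp add: Bochner_Integration.integral_sum Bochner_Integration.integral_diff)
  qed
  also have "exp (\<integral>y. Y y \<partial>?M) \<le> (\<integral>y. exp (Y y) \<partial>?M)"
    using intY intE exp_convex by (intro prod.P.jensens_inequality[where I = UNIV]) auto
  finally have "ennreal (exp (s * (\<Sum>i\<in>W. a i - (\<integral>x. g i x \<partial>P)))) \<le> ennreal (\<integral>y. exp (Y y) \<partial>?M)"
    by (intro ennreal_leI) simp
  also have "\<dots> = (\<integral>\<^sup>+y. ennreal (exp (Y y)) \<partial>?M)"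
    using intE by (intro nn_integral_eq_integral[symmetric]) auto
  finally show ?thesis unfolding Y_def .
qed

text \<open>
Symmetrisation for a measurable selection. The ghost sample is stored at the indices \<open>n+1, \<dots>, 2 n\<close> of one
product space, so exchanging points with their ghosts is a permutation of coordinates. The selected
function depends on the exchanged sample, which is why the bound for a fixed configuration of points has
to hold for functions that vary with the signs.
\<close>

lemma selection_mgf_bound:
  fixes P :: "'a measure" and H :: "('a \<Rightarrow> real) set" and h :: "'j \<Rightarrow> (nat \<Rightarrow> 'a) \<Rightarrow> 'a \<Rightarrow> real"
    and \<kappa> :: "nat \<Rightarrow> 'j" and n :: nat
  defines "\<Omega> \<equiv> PiM {1..n} (\<lambda>_. P)"
  assumes P: "prob_space P" and W: "W \<subseteq> {1..n}" and R: "R \<in> sets P"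
    and H: "\<And>f x. f \<in> H \<Longrightarrow> x \<in> space P \<Longrightarrow> 0 \<le> f x \<and> f x \<le> 1"
    and vc: "vc_dim (subgraph (space P) ` H) \<le> enat v"
    and sel: "\<And>i \<omega>. i \<in> W \<Longrightarrow> \<omega> \<in> space \<Omega> \<Longrightarrow> h (\<kappa> i) \<omega> \<in> H"
    and meas: "\<And>i. i \<in> W \<Longrightarrow> (\<lambda>(\<omega>, x). h (\<kappa> i) \<omega> x) \<in> borel_measurable (\<Omega> \<Otimes>\<^sub>M P)"
  shows "(\<integral>\<^sup>+\<omega>. ennreal (exp (s * (\<Sum>i\<in>W. h (\<kappa> i) \<omega> (\<omega> i) * indicator R (\<omega> i)
        - (\<integral>x. h (\<kappa> i) \<omega> x * indicator R x \<partial>P)))) \<partial>\<Omega>)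
    \<le> ennreal (exp (40 * real (card (\<kappa> ` W)) * real v + 2 * real (card W) * measure P R * (exp (2 * s\<^sup>2) - 1)))"
proof -
  interpret P: prob_space P by fact
  interpret product_sigma_finite "\<lambda>_ :: nat. P" by standard
  note R[measurable]
  define I where "I = {1..n}"
  define I' where "I' = {n+1..2*n}"
  define K where "K = I \<union> I'"
  have \<Omega>: "\<Omega> = PiM I (\<lambda>_. P)" by (simp add: \<Omega>_def I_def)
  have II': "finite I" "finite I'" "I \<inter> I' = {}" "finite K" "I \<subseteq> K" "W \<subseteq> I" "\<And>i. i \<in> I \<Longrightarrow> i + n \<in> I'"
    using W by (auto simp: I_def I'_def K_def)
  have finW: "finite W" using II' finite_subset by blast
  define g where "g = (\<lambda>i \<omega> x. h (\<kappa> i) \<omega> x * indicator R x :: real)"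
  have gm: "(\<lambda>(\<omega>, x). g i \<omega> x) \<in> borel_measurable (\<Omega> \<Otimes>\<^sub>M P)" if "i \<in> W" for i
    using meas[OF that] unfolding g_def by (auto simp: case_prod_beta)
  have gm1: "g i \<omega> \<in> borel_measurable P" if "i \<in> W" "\<omega> \<in> space \<Omega>" for i \<omega>
    using measurable_Pair2[OF gm[OF that(1)] that(2)] by simp
  have g01: "0 \<le> g i \<omega> x \<and> g i \<omega> x \<le> 1" if "i \<in> W" "\<omega> \<in> space \<Omega>" "x \<in> space P" for i \<omega> x
    using H[OF sel[OF that(1,2)] that(3)] by (auto simp: g_def indicator_def)
  define F where "F = (\<lambda>y. ennreal (exp (s * (\<Sum>i\<in>W. g i (restrict y I) (y i) - g i (restrict y I) (y (i + n))))))"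
  have Fm [measurable]: "F \<in> borel_measurable (PiM K (\<lambda>_. P))"
  proof -
    have "(\<lambda>y. g i (restrict y I) (y k)) \<in> borel_measurable (PiM K (\<lambda>_. P))" if "i \<in> W" "k \<in> K" for i k
    proof -
      have "(\<lambda>y. (restrict y I, y k)) \<in> PiM K (\<lambda>_. P) \<rightarrow>\<^sub>M \<Omega> \<Otimes>\<^sub>M P"
        unfolding \<Omega> using that II' by (intro measurable_Pair measurable_restrict_subset measurable_component_singleton)
      from measurable_compose[OF this gm[OF that(1)]] show ?thesis by simp
    qed
    moreover have "i \<in> K" "i + n \<in> K" if "i \<in> W" for i using that II' by (auto simp: K_def)
    ultimately show ?thesis unfolding F_def
      by (intro measurable_compose[OF _ measurable_ennreal] borel_measurable_exp borel_measurable_times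
          borel_measurable_sum borel_measurable_diff) auto
  qed
  \<comment> \<open>\<open>T \<sigma>\<close> exchanges the points with index in \<open>\<sigma>\<close> with their ghosts.\<close>
  define p where "p = (\<lambda>\<sigma> i. if i \<in> I \<inter> \<sigma> then i + n else if i \<in> I' \<and> i - n \<in> \<sigma> then i - n else i)"
  define T where "T = (\<lambda>\<sigma> (y :: nat \<Rightarrow> 'a). \<lambda>i\<in>K. y (p \<sigma> i))"
  have T: "T \<sigma> \<in> PiM K (\<lambda>_. P) \<rightarrow>\<^sub>M PiM K (\<lambda>_. P)" "distr (PiM K (\<lambda>_. P)) (PiM K (\<lambda>_. P)) (T \<sigma>) = PiM K (\<lambda>_. P)"
    if "\<sigma> \<subseteq> I" for \<sigma>
  proof -
    have K_cases: "x \<in> I \<or> (\<exists>i\<in>I. x = i + n)" if "x \<in> K" for x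
      using that by (cases "x \<le> n") (auto simp: K_def I_def I'_def intro!: bexI[of _ "x - n"])
    have p_low: "p \<sigma> i = (if i \<in> \<sigma> then i + n else i)" if "i \<in> I" for i
      using that II'(3) by (auto simp: p_def)
    have p_high: "p \<sigma> (i + n) = (if i \<in> \<sigma> then i else i + n)" if "i \<in> I" for i
      using II'(3) II'(7)[OF that] by (auto simp: p_def)
    have involution: "p \<sigma> x \<in> K \<and> p \<sigma> (p \<sigma> x) = x" if "x \<in> K" for x
      using K_cases[OF that]
    proof (elim disjE bexE)
      assume "x \<in> I"
      then show ?thesis using p_low p_high II'(7) by (auto simp: K_def)
    next
      fix i assume "i \<in> I" "x = i + n"
      then show ?thesis using p_low p_high II'(7) by (auto simp: K_def)
    qed
    then have pK: "p \<sigma> \<in> K \<rightarrow> K" by auto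
    have "inj_on (p \<sigma>) K"
      using involution by (metis inj_onI)
    then show "distr (PiM K (\<lambda>_. P)) (PiM K (\<lambda>_. P)) (T \<sigma>) = PiM K (\<lambda>_. P)"
      unfolding T_def using pK by (intro distr_PiM_reindex P) auto
    show "T \<sigma> \<in> PiM K (\<lambda>_. P) \<rightarrow>\<^sub>M PiM K (\<lambda>_. P)"
      unfolding T_def using pK by (intro measurable_restrict measurable_component_singleton) auto
  qed
  have FT: "F (T \<sigma> y) = ennreal (exp (s * (\<Sum>i\<in>W. flip_sign \<sigma> i *
      (g i (restrict (T \<sigma> y) I) (y i) - g i (restrict (T \<sigma> y) I) (y (i + n))))))"
    if "\<sigma> \<subseteq> I" for \<sigma> y
  proof -
    have "g i (restrict (T \<sigma> y) I) (T \<sigma> y i) - g i (restrict (T \<sigma> y) I) (T \<sigma> y (i + n)) = flip_sign \<sigma> i *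
      (g i (restrict (T \<sigma> y) I) (y i) - g i (restrict (T \<sigma> y) I) (y (i + n)))" if "i \<in> W" for i
    proof -
      have i: "i \<in> I" "i \<notin> I'" "i + n \<in> I'" "i + n \<notin> I" using that II' by auto
      then have "T \<sigma> y i = (if i \<in> \<sigma> then y (i + n) else y i)"
        "T \<sigma> y (i + n) = (if i \<in> \<sigma> then y i else y (i + n))"
        by (auto simp: T_def p_def K_def)
      then show ?thesis by (simp add: flip_sign_def)
    qed
    then show ?thesis unfolding F_def by simp
  qed
  define E where "E = 40 * real (card (\<kappa> ` W)) * real v"
  define cnt where "cnt = (\<lambda>y. \<Sum>i\<in>W. indicator R (y i) + indicator R (y (i + n)) :: real)"
  have pointwise: "(\<Sum>\<sigma>\<in>Pow I. F (T \<sigma> y)) \<le> of_nat (card (Pow I)) * ennreal (exp E * exp (2 * s\<^sup>2 * cnt y))"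
    if y: "y \<in> space (PiM K (\<lambda>_. P))" for y
  proof -
    have "(\<Sum>\<sigma>\<in>Pow I. F (T \<sigma> y)) = ennreal (\<Sum>\<sigma>\<in>Pow I. exp (s * (\<Sum>i\<in>W. flip_sign \<sigma> i *
        (h (\<kappa> i) (restrict (T \<sigma> y) I) (y i) * indicator R (y i)
          - h (\<kappa> i) (restrict (T \<sigma> y) I) (y (i + n)) * indicator R (y (i + n))))))"
      by (subst sum_ennreal[symmetric]) (auto simp: FT g_def intro!: sum.cong)
    also have "\<dots> \<le> ennreal (real (card (Pow I)) * exp (E + 2 * s\<^sup>2 * cnt y))"
      unfolding E_def cnt_def
    proof (intro ennreal_leI sum_exp_flip_sign_selection_le[where D = "space P" and H = H] II'(1) II'(6) H vc)
      show "y i \<in> space P" "y (i + n) \<in> space P" if "i \<in> W" for i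
        using y that II' by (auto simp: space_PiM K_def)
      show "h (\<kappa> i) (restrict (T \<sigma> y) I) \<in> H" if "i \<in> W" "\<sigma> \<subseteq> I" for i \<sigma>
      proof (rule sel[OF that(1)])
        have "T \<sigma> y \<in> space (PiM K (\<lambda>_. P))" using T(1)[OF that(2)] y by (rule measurable_space)
        then show "restrict (T \<sigma> y) I \<in> space \<Omega>"
          unfolding \<Omega> space_PiM using II'(5) by auto
      qed
    qed
    also have "\<dots> = of_nat (card (Pow I)) * ennreal (exp E * exp (2 * s\<^sup>2 * cnt y))"
      by (simp add: ennreal_mult exp_add ennreal_of_nat_eq_real_of_nat)
    finally show ?thesis .
  qed
  have "(\<integral>\<^sup>+\<omega>. ennreal (exp (s * (\<Sum>i\<in>W. g i \<omega> (\<omega> i) - (\<integral>x. g i \<omega> x \<partial>P)))) \<partial>\<Omega>)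
      \<le> (\<integral>\<^sup>+\<omega>. (\<integral>\<^sup>+y. F (merge I I' (\<omega>, y)) \<partial>PiM I' (\<lambda>_. P)) \<partial>\<Omega>)"
  proof (rule nn_integral_mono)
    fix \<omega> assume \<omega>: "\<omega> \<in> space \<Omega>"
    have "ennreal (exp (s * (\<Sum>i\<in>W. g i \<omega> (\<omega> i) - (\<integral>x. g i \<omega> x \<partial>P))))
      \<le> (\<integral>\<^sup>+y. ennreal (exp (s * (\<Sum>i\<in>W. g i \<omega> (\<omega> i) - g i \<omega> (y (i + n))))) \<partial>PiM I' (\<lambda>_. P))"
      using finW II' gm1[OF _ \<omega>] g01[OF _ \<omega>]
      by (intro exp_centred_sum_le_ghost[where r = "\<lambda>i. i + n"] P) auto
    also have "\<dots> = (\<integral>\<^sup>+y. F (merge I I' (\<omega>, y)) \<partial>PiM I' (\<lambda>_. P))"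
    proof (rule nn_integral_cong)
      fix y
      have "restrict (merge I I' (\<omega>, y)) I = \<omega>"
        using \<omega> II'(3) unfolding \<Omega> space_PiM by (simp add: merge_def restrict_def PiE_def extensional_def fun_eq_iff)
      moreover have "merge I I' (\<omega>, y) i = \<omega> i" "merge I I' (\<omega>, y) (i + n) = y (i + n)" if "i \<in> W" for i
        using that II' by (auto simp: merge_def)
      ultimately show "ennreal (exp (s * (\<Sum>i\<in>W. g i \<omega> (\<omega> i) - g i \<omega> (y (i + n))))) = F (merge I I' (\<omega>, y))"
        unfolding F_def by simp
    qed
    finally show "ennreal (exp (s * (\<Sum>i\<in>W. g i \<omega> (\<omega> i) - (\<integral>x. g i \<omega> x \<partial>P)))) \<le> \<dots>" .
  qed
  also have "\<dots> = (\<integral>\<^sup>+y. F y \<partial>PiM K (\<lambda>_. P))"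
    unfolding \<Omega> K_def using II' Fm by (intro product_nn_integral_fold[symmetric]) (auto simp: K_def)
  finally have ghost: "(\<integral>\<^sup>+\<omega>. ennreal (exp (s * (\<Sum>i\<in>W. g i \<omega> (\<omega> i) - (\<integral>x. g i \<omega> x \<partial>P)))) \<partial>\<Omega>)
    \<le> (\<integral>\<^sup>+y. F y \<partial>PiM K (\<lambda>_. P))" .
  have "of_nat (card (Pow I)) * (\<integral>\<^sup>+y. F y \<partial>PiM K (\<lambda>_. P)) = (\<Sum>\<sigma>\<in>Pow I. \<integral>\<^sup>+y. F y \<partial>distr (PiM K (\<lambda>_. P)) (PiM K (\<lambda>_. P)) (T \<sigma>))"
    using T(2) by simp
  also have "\<dots> = (\<Sum>\<sigma>\<in>Pow I. \<integral>\<^sup>+y. F (T \<sigma> y) \<partial>PiM K (\<lambda>_. P))"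
    using T(1) by (intro sum.cong nn_integral_distr) auto
  also have "\<dots> = (\<integral>\<^sup>+y. (\<Sum>\<sigma>\<in>Pow I. F (T \<sigma> y)) \<partial>PiM K (\<lambda>_. P))"
    using T(1) Fm by (intro nn_integral_sum[symmetric]) (auto intro: measurable_compose)
  also have "\<dots> \<le> (\<integral>\<^sup>+y. of_nat (card (Pow I)) * ennreal (exp E * exp (2 * s\<^sup>2 * cnt y)) \<partial>PiM K (\<lambda>_. P))"
    by (intro nn_integral_mono pointwise)
  also have "\<dots> = of_nat (card (Pow I)) * (ennreal (exp E) * (\<integral>\<^sup>+y. ennreal (exp (2 * s\<^sup>2 * cnt y)) \<partial>PiM K (\<lambda>_. P)))"
  proof -
    have "i \<in> K" "i + n \<in> K" if "i \<in> W" for i using that II' by (auto simp: K_def)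
    then have "(\<lambda>y. ennreal (exp (2 * s\<^sup>2 * cnt y))) \<in> borel_measurable (PiM K (\<lambda>_. P))"
      unfolding cnt_def by measurable
    then show ?thesis by (simp add: ennreal_mult nn_integral_cmult)
  qed
  also have "(\<integral>\<^sup>+y. ennreal (exp (2 * s\<^sup>2 * cnt y)) \<partial>PiM K (\<lambda>_. P))
     \<le> ennreal (exp (real (2 * card W) * measure P R * (exp (2 * s\<^sup>2) - 1)))"
  proof -
    define L where "L = W \<union> (\<lambda>i. i + n) ` W"
    have disj: "W \<inter> (\<lambda>i. i + n) ` W = {}" using II' by blast
    have "cnt y = (\<Sum>i\<in>L. indicator R (y i))" for y
      unfolding cnt_def L_def using finW disj
      by (subst sum.union_disjoint) (auto simp: sum.reindex sum.distrib)
    moreover have "card L = 2 * card W"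
      unfolding L_def using finW disj by (subst card_Un_disjoint) (auto simp: card_image)
    moreover have "L \<subseteq> K" using II' by (auto simp: L_def K_def)
    ultimately show ?thesis
      using nn_integral_exp_count_le[OF P R II'(4), of L "2 * s\<^sup>2"] by simp
  qed
  finally have "of_nat (card (Pow I)) * (\<integral>\<^sup>+y. F y \<partial>PiM K (\<lambda>_. P))
    \<le> of_nat (card (Pow I)) * (ennreal (exp E) * ennreal (exp (real (2 * card W) * measure P R * (exp (2 * s\<^sup>2) - 1))))"
    by (simp add: mult_left_mono)
  moreover have "card (Pow I) \<noteq> 0" using II'(1) by (simp add: card_Pow)
  ultimately have "(\<integral>\<^sup>+y. F y \<partial>PiM K (\<lambda>_. P))
    \<le> ennreal (exp E) * ennreal (exp (real (2 * card W) * measure P R * (exp (2 * s\<^sup>2) - 1)))"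
    by (subst (asm) ennreal_mult_le_mult_iff) auto
  also have "\<dots> = ennreal (exp (E + 2 * real (card W) * measure P R * (exp (2 * s\<^sup>2) - 1)))"
    by (simp add: ennreal_mult[symmetric] exp_add)
  finally show ?thesis using ghost unfolding E_def g_def by (meson order_trans)
qed

section \<open>The empirical threshold\<close>

lemma rev_sort_nth_less_iff:
  fixes xs :: "'a :: linorder list"
  assumes "1 \<le> k" "k \<le> length xs"
  shows "rev (sort xs) ! (k - 1) < x \<longleftrightarrow> length (filter (\<lambda>y. x \<le> y) xs) < k"
proof -
  define ys where "ys = sort xs"
  define L where "L = length xs"
  have ys: "sorted ys" "length ys = L" by (simp_all add: ys_def L_def)
  have nth: "rev ys ! (k - 1) = ys ! (L - k)"
    using assms ys by (subst rev_nth) (auto simp: L_def)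
  have "length (filter (\<lambda>y. x \<le> y) xs) = size (filter_mset (\<lambda>y. x \<le> y) (mset ys))"
    by (simp add: ys_def flip: mset_filter)
  also have "\<dots> = length (filter (\<lambda>y. x \<le> y) ys)" by (simp flip: mset_filter)
  also have "\<dots> = card {i. i < L \<and> x \<le> ys ! i}" by (simp add: length_filter_conv_card ys)
  finally have len: "length (filter (\<lambda>y. x \<le> y) xs) = card {i. i < L \<and> x \<le> ys ! i}" .
  have k: "1 \<le> k" "k \<le> L" using assms by (auto simp: L_def)
  have "ys ! (L - k) < x \<longleftrightarrow> card {i. i < L \<and> x \<le> ys ! i} < k"
  proof
    assume less: "ys ! (L - k) < x"
    have "{i. i < L \<and> x \<le> ys ! i} \<subseteq> {L - k<..<L}"
    proof
      fix i assume i: "i \<in> {i. i < L \<and> x \<le> ys ! i}"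
      have "\<not> i \<le> L - k"
      proof
        assume "i \<le> L - k"
        then have "ys ! i \<le> ys ! (L - k)" using ys k by (intro sorted_nth_mono) auto
        with less i show False by auto
      qed
      with i show "i \<in> {L - k<..<L}" by auto
    qed
    then have "card {i. i < L \<and> x \<le> ys ! i} \<le> card {L - k<..<L}" by (intro card_mono) auto
    also have "\<dots> < k" using k by simp
    finally show "card {i. i < L \<and> x \<le> ys ! i} < k" .
  next
    assume less: "card {i. i < L \<and> x \<le> ys ! i} < k"
    show "ys ! (L - k) < x"
    proof (rule ccontr)
      assume "\<not> ?thesis"
      then have le: "x \<le> ys ! (L - k)" by simp
      have "{L - k..<L} \<subseteq> {i. i < L \<and> x \<le> ys ! i}"
      proof
        fix i assume "i \<in> {L - k..<L}"
        then have "ys ! (L - k) \<le> ys ! i" "i < L" using ys by (auto intro!: sorted_nth_mono)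
        with le show "i \<in> {i. i < L \<and> x \<le> ys ! i}" by auto
      qed
      then have "card {L - k..<L} \<le> card {i. i < L \<and> x \<le> ys ! i}" by (intro card_mono) auto
      with less k show False by simp
    qed
  qed
  with nth len show ?thesis by (simp add: ys_def)
qed

text \<open>
The only property of the empirical threshold that is used below: it lies under \<open>x\<close> if and only if fewer
than \<open>k\<close> norms reach \<open>x\<close>.
\<close>

lemma emp_threshold_less_iff:
  assumes k: "1 \<le> k" "k \<le> n" and \<alpha>: "\<alpha> = real k / real n"
  shows "emp_threshold n \<alpha> N \<omega> < x \<longleftrightarrow> card {i\<in>{1..n}. x \<le> N (fst (\<omega> i))} < k"
proof -
  let ?f = "\<lambda>i. N (fst (\<omega> i))"
  have "\<alpha> * real n = real k" using k \<alpha> by simp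
  then have floor: "nat \<lfloor>\<alpha> * real n\<rfloor> = k" by simp
  have "length (filter (\<lambda>y. x \<le> y) (map ?f [1..<Suc n])) = length (filter (\<lambda>i. x \<le> ?f i) [1..<Suc n])"
    by (simp add: filter_map o_def)
  also have "\<dots> = card (set (filter (\<lambda>i. x \<le> ?f i) [1..<Suc n]))"
    by (rule distinct_card[symmetric]) simp
  also have "set (filter (\<lambda>i. x \<le> ?f i) [1..<Suc n]) = {i\<in>{1..n}. x \<le> ?f i}" by auto
  finally show ?thesis
    unfolding emp_threshold_def rev_order_stat_def floor
    using k by (subst rev_sort_nth_less_iff) auto
qed

text \<open>
The smallest norm above the threshold is reached exactly by the norms above the threshold.
\<close>

lemma card_above_emp_threshold_less:
  assumes k: "1 \<le> k" "k \<le> n" and \<alpha>: "\<alpha> = real k / real n"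
  shows "card {i\<in>{1..n}. emp_threshold n \<alpha> N \<omega> < N (fst (\<omega> i))} < k"
proof (cases "{i\<in>{1..n}. emp_threshold n \<alpha> N \<omega> < N (fst (\<omega> i))} = {}")
  case True
  with k show ?thesis by (simp only: card.empty)
next
  case False
  let ?E = "{i\<in>{1..n}. emp_threshold n \<alpha> N \<omega> < N (fst (\<omega> i))}"
  define x where "x = Min ((\<lambda>i. N (fst (\<omega> i))) ` ?E)"
  have "x \<in> (\<lambda>i. N (fst (\<omega> i))) ` ?E" unfolding x_def using False by (intro Min_in) auto
  then have "emp_threshold n \<alpha> N \<omega> < x" by auto
  then have "card {i\<in>{1..n}. x \<le> N (fst (\<omega> i))} < k" by (simp only: emp_threshold_less_iff[OF assms])
  moreover have "?E \<subseteq> {i\<in>{1..n}. x \<le> N (fst (\<omega> i))}" by (auto simp: x_def)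
  then have "card ?E \<le> card {i\<in>{1..n}. x \<le> N (fst (\<omega> i))}" by (intro card_mono) auto
  ultimately show ?thesis by linarith
qed

text \<open>
The points above the empirical threshold and the points that reach \<open>t\<close> form nested sets, so the number of
mismatches is the difference of the cardinalities. If the threshold is below \<open>t\<close>, the first set is the
larger one and has fewer than \<open>k\<close> elements, with or without ties. Otherwise it is the smaller one and,
as at most one norm is equal to the threshold, has at least \<open>k - 1\<close> elements.
\<close>

lemma sum_threshold_mismatch_le:
  fixes t :: real
  assumes k: "1 \<le> k" "k \<le> n" and \<alpha>: "\<alpha> = real k / real n"
    and no_ties: "\<And>i j. i \<in> {1..n} \<Longrightarrow> j \<in> {1..n} \<Longrightarrow> N (fst (\<omega> i)) = N (fst (\<omega> j)) \<Longrightarrow>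
      t \<le> N (fst (\<omega> i)) \<Longrightarrow> i = j"
  shows "(\<Sum>i=1..n. \<bar>of_bool (N (fst (\<omega> i)) > emp_threshold n \<alpha> N \<omega>) - of_bool (t \<le> N (fst (\<omega> i)))\<bar> :: real)
    \<le> \<bar>(\<Sum>i=1..n. of_bool (t \<le> N (fst (\<omega> i)))) - real k\<bar> + 1"
proof -
  define thr where "thr = emp_threshold n \<alpha> N \<omega>"
  define A where "A = {i\<in>{1..n}. thr < N (fst (\<omega> i))}"
  define B where "B = {i\<in>{1..n}. t \<le> N (fst (\<omega> i))}"
  have fin: "finite A" "finite B" by (auto simp: A_def B_def)
  have A_less: "card A < k" unfolding A_def thr_def by (rule card_above_emp_threshold_less[OF assms(1-3)])
  have sumA: "(\<Sum>i=1..n. of_bool (thr < N (fst (\<omega> i))) :: real) = real (card A)"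
    unfolding A_def by (subst sum_of_bool_eq) (auto intro!: arg_cong[of _ _ card])
  have sumB: "(\<Sum>i=1..n. of_bool (t \<le> N (fst (\<omega> i))) :: real) = real (card B)"
    unfolding B_def by (subst sum_of_bool_eq) (auto intro!: arg_cong[of _ _ card])
  show ?thesis
  proof (cases "thr < t")
    case True
    have "(\<Sum>i=1..n. \<bar>of_bool (thr < N (fst (\<omega> i))) - of_bool (t \<le> N (fst (\<omega> i)))\<bar> :: real)
        = (\<Sum>i=1..n. of_bool (thr < N (fst (\<omega> i))) - of_bool (t \<le> N (fst (\<omega> i))))"
      using True by (intro sum.cong) auto
    also have "\<dots> = real (card A) - real (card B)" by (simp only: sum_subtractf sumA sumB)
    finally show ?thesis using A_less unfolding sumB thr_def by linarith
  next
    case False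
    have "(\<Sum>i=1..n. \<bar>of_bool (thr < N (fst (\<omega> i))) - of_bool (t \<le> N (fst (\<omega> i)))\<bar> :: real)
        = (\<Sum>i=1..n. of_bool (t \<le> N (fst (\<omega> i))) - of_bool (thr < N (fst (\<omega> i))))"
      using False by (intro sum.cong) auto
    also have "\<dots> = real (card B) - real (card A)" by (simp only: sum_subtractf sumA sumB)
    finally have eq: "(\<Sum>i=1..n. \<bar>of_bool (thr < N (fst (\<omega> i))) - of_bool (t \<le> N (fst (\<omega> i)))\<bar> :: real)
        = real (card B) - real (card A)" .
    define C where "C = {i\<in>{1..n}. N (fst (\<omega> i)) = thr}"
    have "\<not> card {i\<in>{1..n}. thr \<le> N (fst (\<omega> i))} < k"
      using emp_threshold_less_iff[OF assms(1-3), of N \<omega> thr] by (simp add: thr_def)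
    moreover have "card {i\<in>{1..n}. thr \<le> N (fst (\<omega> i))} \<le> card A + card C"
    proof -
      have "{i\<in>{1..n}. thr \<le> N (fst (\<omega> i))} = A \<union> C" by (auto simp: A_def C_def)
      then show ?thesis by (simp add: card_Un_le)
    qed
    moreover have "card C \<le> Suc 0"
    proof (subst card_le_Suc0_iff_eq)
      show "finite C" by (simp add: C_def)
      show "\<forall>i\<in>C. \<forall>j\<in>C. i = j" using False no_ties by (auto simp: C_def)
    qed
    ultimately have "k \<le> card A + 1" by linarith
    then show ?thesis using eq unfolding sumB thr_def by linarith
  qed
qed

section \<open>Measurability of norms, ties and tail bounds\<close>

lemma norm_on_le_coordinates:
  assumes N: "norm_on d N" and x: "x \<in> space (borel_vect d)"
  shows "N x \<le> (\<Sum>i<d. \<bar>x i\<bar> * N (\<lambda>j\<in>{..<d}. if j = i then 1 else 0))"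
proof -
  define e where "e = (\<lambda>i. \<lambda>j\<in>{..<d}. if j = i then 1 else 0 :: real)"
  define part where "part = (\<lambda>k. \<lambda>i\<in>{..<d}. if i < k then x i else 0)"
  have sp: "e i \<in> space (borel_vect d)" "part i \<in> space (borel_vect d)"
      "(\<lambda>j\<in>{..<d}. a * e i j) \<in> space (borel_vect d)" for i a
    by (auto simp: e_def part_def space_PiM)
  have "N (part k) \<le> (\<Sum>i<k. \<bar>x i\<bar> * N (e i))" if "k \<le> d" for k
    using that
  proof (induction k)
    case 0
    have "N (part 0) = 0" using N sp(2)[of 0] unfolding norm_on_def by (auto simp: part_def)
    then show ?case by simp
  next
    case (Suc k)
    have "part (Suc k) = (\<lambda>i\<in>{..<d}. part k i + (\<lambda>j\<in>{..<d}. x k * e k j) i)"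
      by (auto simp: part_def e_def restrict_def fun_eq_iff less_Suc_eq)
    then have "N (part (Suc k)) \<le> N (part k) + N (\<lambda>j\<in>{..<d}. x k * e k j)"
      using N sp unfolding norm_on_def by metis
    also have "N (\<lambda>j\<in>{..<d}. x k * e k j) = \<bar>x k\<bar> * N (e k)"
      using N sp unfolding norm_on_def by blast
    finally show ?case using Suc by simp
  qed
  from this[of d] have "N (part d) \<le> (\<Sum>i<d. \<bar>x i\<bar> * N (e i))" by simp
  moreover have "part d = x" using x by (auto simp: part_def space_PiM PiE_def extensional_def fun_eq_iff)
  ultimately show ?thesis by (simp add: e_def)
qed

text \<open>
A norm is Lipschitz with respect to a weighted sum of the coordinates, so \<open>N x\<close> is the infimum of
\<open>N q\<close> plus the distance from \<open>x\<close> to \<open>q\<close> over the countably many rational points \<open>q\<close>.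
\<close>

lemma norm_on_measurable:
  assumes N: "norm_on d N"
  shows "N \<in> borel_measurable (borel_vect d)"
proof (subst borel_measurable_iff_less, rule allI)
  fix a :: real
  define S where "S = space (borel_vect d)"
  define e where "e = (\<lambda>i. N (\<lambda>j\<in>{..<d}. if j = i then 1 else 0))"
  define l1 where "l1 = (\<lambda>x y :: vect. \<Sum>i<d. \<bar>x i - y i\<bar> * e i)"
  define \<D> where "\<D> = (\<Pi>\<^sub>E i\<in>{..<d}. \<rat> :: real set)"
  have e0: "0 \<le> e i" for i
    using N unfolding norm_on_def e_def by (auto simp: space_PiM)
  have \<D>: "countable \<D>" "\<D> \<subseteq> S" unfolding \<D>_def S_def
    by (auto intro!: countable_PiE countable_rat simp: space_PiM)
  have lip: "N x \<le> N y + l1 x y" if "x \<in> S" "y \<in> S" for x y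
  proof -
    define u where "u = (\<lambda>i\<in>{..<d}. x i - y i)"
    have u: "u \<in> S" by (auto simp: u_def S_def space_PiM)
    have "x = (\<lambda>i\<in>{..<d}. y i + u i)"
      using that by (auto simp: u_def S_def space_PiM PiE_def extensional_def fun_eq_iff)
    then have "N x \<le> N y + N u" using N that u unfolding norm_on_def S_def by metis
    moreover have "N u \<le> l1 x y"
      using norm_on_le_coordinates[OF N u[unfolded S_def]] by (simp add: l1_def e_def u_def)
    ultimately show ?thesis by linarith
  qed
  have "{x \<in> space (borel_vect d). N x < a} = (\<Union>q\<in>\<D>. {x \<in> space (borel_vect d). N q + l1 x q < a})"
  proof (intro equalityI subsetI)
    fix x assume "x \<in> {x \<in> space (borel_vect d). N x < a}"
    then have x: "x \<in> S" "N x < a" by (auto simp: S_def)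
    \<comment> \<open>Adding \<open>1\<close> avoids a division by zero in dimension zero.\<close>
    define C where "C = (\<Sum>i<d. e i) + 1"
    have C: "0 < C" using e0 by (auto simp: C_def add_nonneg_pos sum_nonneg)
    define \<eta> where "\<eta> = (a - N x) / (2 * C)"
    have \<eta>: "0 < \<eta>" using x C by (simp add: \<eta>_def)
    have "\<exists>r\<in>\<rat>. \<bar>x i - r\<bar> < \<eta>" for i
      using Rats_dense_in_real[of "x i - \<eta>" "x i + \<eta>"] \<eta> by (auto simp: abs_less_iff intro!: bexI)
    then obtain q0 where q0: "\<And>i. q0 i \<in> \<rat>" "\<And>i. \<bar>x i - q0 i\<bar> < \<eta>" by metis
    define q where "q = restrict q0 {..<d}"
    have q: "q \<in> \<D>" using q0 by (auto simp: q_def \<D>_def)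
    have "l1 x q \<le> (\<Sum>i<d. \<eta> * e i)"
      unfolding l1_def using q0(2) e0 by (intro sum_mono mult_right_mono) (auto simp: q_def intro: less_imp_le)
    also have "\<dots> < \<eta> * C" using \<eta> by (simp add: C_def sum_distrib_left[symmetric] algebra_simps)
    also have "\<dots> = (a - N x) / 2" using C by (simp add: \<eta>_def)
    finally have "2 * l1 x q < a - N x" by (simp add: field_simps)
    moreover have "l1 q x = l1 x q" unfolding l1_def by (simp add: abs_minus_commute)
    moreover have "N q \<le> N x + l1 q x" using q \<D> x by (intro lip) auto
    ultimately have "N q + l1 x q < a" by linarith
    with q x show "x \<in> (\<Union>q\<in>\<D>. {x \<in> space (borel_vect d). N q + l1 x q < a})" by (auto simp: S_def)
  next
    fix x assume "x \<in> (\<Union>q\<in>\<D>. {x \<in> space (borel_vect d). N q + l1 x q < a})"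
    then obtain q where "q \<in> \<D>" "x \<in> S" "N q + l1 x q < a" by (auto simp: S_def)
    with lip[of x q] \<D> show "x \<in> {x \<in> space (borel_vect d). N x < a}" by (auto simp: S_def)
  qed
  also have "\<dots> \<in> sets (borel_vect d)"
  proof (rule sets.countable_UN'[OF \<D>(1)], rule image_subsetI)
    fix q
    have "(\<lambda>x. N q + l1 x q) \<in> borel_measurable (borel_vect d)"
      unfolding l1_def by measurable
    then show "{x \<in> space (borel_vect d). N q + l1 x q < a} \<in> sets (borel_vect d)" by measurable
  qed
  finally show "{w \<in> space (borel_vect d). N w < a} \<in> sets (borel_vect d)" .
qed

text \<open>
By Fubini's theorem: given the coordinate \<open>j\<close>, the coordinate \<open>i\<close> hits the level \<open>f (\<omega> j)\<close> with
probability zero as soon as this level is at least \<open>t\<close>.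
\<close>

lemma AE_no_ties:
  fixes P :: "'a measure" and f :: "'a \<Rightarrow> real"
  assumes P: "prob_space P" and f: "f \<in> borel_measurable P" and I: "finite I"
    and no_atom: "\<And>u. t \<le> u \<Longrightarrow> measure P {z \<in> space P. f z = u} = 0"
  shows "AE \<omega> in PiM I (\<lambda>_. P). \<forall>i\<in>I. \<forall>j\<in>I. f (\<omega> i) = f (\<omega> j) \<longrightarrow> t \<le> f (\<omega> i) \<longrightarrow> i = j"
proof -
  interpret P: prob_space P by fact
  interpret product_sigma_finite "\<lambda>_. P" by standard
  note f[measurable]
  have "AE \<omega> in PiM I (\<lambda>_. P). \<not> (f (\<omega> i) = f (\<omega> j) \<and> t \<le> f (\<omega> j))"
    if ij: "i \<in> I" "j \<in> I" "i \<noteq> j" for i j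
  proof -
    define A where "A = {\<omega> \<in> space (PiM I (\<lambda>_. P)). f (\<omega> i) = f (\<omega> j) \<and> t \<le> f (\<omega> j)}"
    define I0 where "I0 = I - {i}"
    have I0: "I = insert i I0" "i \<notin> I0" "finite I0" "j \<in> I0" using ij I by (auto simp: I0_def)
    have comp: "(\<lambda>\<omega>. f (\<omega> l)) \<in> borel_measurable (PiM I (\<lambda>_. P))" if "l \<in> I" for l
      using measurable_compose[OF measurable_component_singleton[OF that] f] .
    have A: "A \<in> sets (PiM I (\<lambda>_. P))"
    proof -
      define u w where "u = (\<lambda>\<omega>. f (\<omega> i))" and "w = (\<lambda>\<omega>. f (\<omega> j))"
      have uw: "u \<in> borel_measurable (PiM I (\<lambda>_. P))" "w \<in> borel_measurable (PiM I (\<lambda>_. P))"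
        unfolding u_def w_def using ij by (auto intro: comp)
      have "{\<omega> \<in> space (PiM I (\<lambda>_. P)). (u \<omega> \<le> w \<omega> \<and> w \<omega> \<le> u \<omega>) \<and> t \<le> w \<omega>} \<in> sets (PiM I (\<lambda>_. P))"
        by (intro sets.sets_Collect_conj borel_measurable_le uw borel_measurable_const)
      then have "{\<omega> \<in> space (PiM I (\<lambda>_. P)). u \<omega> = w \<omega> \<and> t \<le> w \<omega>} \<in> sets (PiM I (\<lambda>_. P))"
        by (simp add: eq_iff)
      then show ?thesis by (simp add: A_def u_def w_def)
    qed
    have "emeasure (PiM I (\<lambda>_. P)) A = (\<integral>\<^sup>+\<omega>. indicator A \<omega> \<partial>PiM (insert i I0) (\<lambda>_. P))"
      using A by (simp flip: I0(1))
    also have "\<dots> = (\<integral>\<^sup>+x. (\<integral>\<^sup>+y. indicator A (x(i := y)) \<partial>P) \<partial>PiM I0 (\<lambda>_. P))"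
      using I0 A by (intro product_nn_integral_insert) auto
    also have "\<dots> = (\<integral>\<^sup>+x. 0 \<partial>PiM I0 (\<lambda>_. P))"
    proof (rule nn_integral_cong)
      fix x assume x: "x \<in> space (PiM I0 (\<lambda>_. P))"
      have "(\<integral>\<^sup>+y. indicator A (x(i := y)) \<partial>P) \<le> (\<integral>\<^sup>+y. indicator {z \<in> space P. t \<le> f (x j) \<and> f z = f (x j)} y \<partial>P)"
        using ij by (intro nn_integral_mono) (auto simp: A_def indicator_def)
      also have "\<dots> = emeasure P {z \<in> space P. t \<le> f (x j) \<and> f z = f (x j)}"
        by (intro nn_integral_indicator) measurable
      also have "\<dots> = 0"
        using no_atom[of "f (x j)"] by (cases "t \<le> f (x j)") (auto simp: P.emeasure_eq_measure)
      finally show "(\<integral>\<^sup>+y. indicator A (x(i := y)) \<partial>P) = 0" by simp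
    qed
    finally have "emeasure (PiM I (\<lambda>_. P)) A = 0" by simp
    then show ?thesis using A by (subst AE_iff_measurable[of A]) (auto simp: A_def)
  qed
  then have "AE \<omega> in PiM I (\<lambda>_. P). \<forall>i\<in>I. \<forall>j\<in>I. i \<noteq> j \<longrightarrow> \<not> (f (\<omega> i) = f (\<omega> j) \<and> t \<le> f (\<omega> j))"
    using I by (auto simp: AE_finite_all)
  then show ?thesis by eventually_elim metis
qed

lemma exp_moment_tail:
  assumes "prob_space M" and Z [measurable]: "Z \<in> borel_measurable M"
    and mgf: "(\<integral>\<^sup>+\<omega>. ennreal (exp (s * Z \<omega>)) \<partial>M) \<le> ennreal (exp b)"
    and s: "0 \<le> s" and b: "b - s * y \<le> - l"
  shows "measure M {\<omega> \<in> space M. y < Z \<omega>} \<le> exp (- l)"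
proof -
  interpret prob_space M by fact
  have "emeasure M {\<omega> \<in> space M. y < Z \<omega>} = (\<integral>\<^sup>+\<omega>. indicator {\<omega> \<in> space M. y < Z \<omega>} \<omega> \<partial>M)"
    by (intro nn_integral_indicator[symmetric]) measurable
  also have "\<dots> \<le> (\<integral>\<^sup>+\<omega>. ennreal (exp (- s * y)) * ennreal (exp (s * Z \<omega>)) \<partial>M)"
  proof (rule nn_integral_mono)
    fix \<omega>
    have "1 \<le> exp (s * Z \<omega> - s * y)" if "y < Z \<omega>"
      using that s by (simp add: mult_left_mono)
    then show "indicator {\<omega> \<in> space M. y < Z \<omega>} \<omega> \<le> ennreal (exp (- s * y)) * ennreal (exp (s * Z \<omega>))"
      by (auto simp: indicator_def ennreal_mult[symmetric] exp_add[symmetric])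
  qed
  also have "\<dots> = ennreal (exp (- s * y)) * (\<integral>\<^sup>+\<omega>. ennreal (exp (s * Z \<omega>)) \<partial>M)"
    by (intro nn_integral_cmult) measurable
  also have "\<dots> \<le> ennreal (exp (- s * y)) * ennreal (exp b)"
    using mgf by (intro mult_left_mono) auto
  also have "\<dots> = ennreal (exp (b - s * y))"
    by (simp add: ennreal_mult[symmetric] exp_add[symmetric])
  also have "\<dots> \<le> ennreal (exp (- l))" using b by (intro ennreal_leI) simp
  finally show ?thesis by (simp add: emeasure_eq_measure)
qed

lemma exp_minus_one_minus_id_le: "exp x - 1 - x \<le> x\<^sup>2" if "\<bar>x\<bar> \<le> 1" for x :: real
proof (cases "0 \<le> x")
  case True
  then show ?thesis using exp_bound[of x] that by simp
next
  case False
  define u where "u = - x"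
  have u: "0 \<le> u" "u \<le> 1" using False that by (auto simp: u_def)
  have "1 \<le> (1 - u + u\<^sup>2) * (1 + u)" using u by (simp add: algebra_simps power2_eq_square power3_eq_cube)
  also have "\<dots> \<le> (1 - u + u\<^sup>2) * exp u"
    using u by (intro mult_left_mono exp_ge_add_one_self) (auto intro: add_nonneg_nonneg)
  finally have "exp (- u) \<le> 1 - u + u\<^sup>2" by (simp add: exp_minus field_simps)
  then show ?thesis by (simp add: u_def)
qed

text \<open>
Chernoff's bound for a binomial count with the variance term of order of its mean.
\<close>

lemma count_deviation_tail:
  fixes P :: "'a measure"
  assumes P: "prob_space P" and R: "R \<in> sets P" and K: "finite K"
    and l: "0 \<le> l" "l \<le> real (card K) * measure P R" and \<epsilon>: "\<epsilon> \<in> {-1, 1 :: real}"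
  shows "measure (PiM K (\<lambda>_. P)) {\<omega> \<in> space (PiM K (\<lambda>_. P)).
      2 * sqrt (real (card K) * measure P R * l)
        < \<epsilon> * ((\<Sum>i\<in>K. indicator R (\<omega> i)) - real (card K) * measure P R)} \<le> exp (- l)"
proof -
  define \<mu> where "\<mu> = real (card K) * measure P R"
  define s where "s = sqrt (l / \<mu>)"
  have \<mu>: "0 \<le> \<mu>" by (simp add: \<mu>_def)
  have s: "0 \<le> s" "s\<^sup>2 = l / \<mu>" "\<mu> * s\<^sup>2 \<le> l" "s \<le> 1"
    using l \<mu> by (auto simp: s_def \<mu>_def[symmetric] divide_le_eq_1)
  have [measurable]: "(\<lambda>\<omega>. indicator R (\<omega> i) :: real) \<in> borel_measurable (PiM K (\<lambda>_. P))" if "i \<in> K" for i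
    using measurable_compose[OF measurable_component_singleton[OF that] borel_measurable_indicator[OF R]] .
  have "measure (PiM K (\<lambda>_. P)) {\<omega> \<in> space (PiM K (\<lambda>_. P)).
      2 * sqrt (\<mu> * l) < \<epsilon> * ((\<Sum>i\<in>K. indicator R (\<omega> i)) - \<mu>)} \<le> exp (- l)"
  proof (rule exp_moment_tail[where s = s and b = l])
    show "prob_space (PiM K (\<lambda>_. P))" by (intro prob_space_PiM P)
    show "(\<lambda>\<omega>. \<epsilon> * ((\<Sum>i\<in>K. indicator R (\<omega> i)) - \<mu>)) \<in> borel_measurable (PiM K (\<lambda>_. P))" by measurable
    have "(\<integral>\<^sup>+\<omega>. ennreal (exp (s * (\<epsilon> * ((\<Sum>i\<in>K. indicator R (\<omega> i)) - \<mu>)))) \<partial>PiM K (\<lambda>_. P))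
        = (\<integral>\<^sup>+\<omega>. ennreal (exp (- (s * \<epsilon> * \<mu>))) * ennreal (exp (s * \<epsilon> * (\<Sum>i\<in>K. indicator R (\<omega> i)))) \<partial>PiM K (\<lambda>_. P))"
      by (intro nn_integral_cong) (simp add: ennreal_mult[symmetric] exp_add[symmetric] algebra_simps)
    also have "\<dots> = ennreal (exp (- (s * \<epsilon> * \<mu>))) * (\<integral>\<^sup>+\<omega>. ennreal (exp (s * \<epsilon> * (\<Sum>i\<in>K. indicator R (\<omega> i)))) \<partial>PiM K (\<lambda>_. P))"
      by (intro nn_integral_cmult) measurable
    also have "\<dots> \<le> ennreal (exp (- (s * \<epsilon> * \<mu>))) * ennreal (exp (\<mu> * (exp (s * \<epsilon>) - 1)))"
      using nn_integral_exp_count_le[OF P R K order_refl, of "s * \<epsilon>"] unfolding \<mu>_def by (intro mult_left_mono) auto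
    also have "\<dots> = ennreal (exp (\<mu> * (exp (s * \<epsilon>) - 1 - s * \<epsilon>)))"
      by (simp add: ennreal_mult[symmetric] exp_add[symmetric] algebra_simps)
    also have "\<dots> \<le> ennreal (exp l)"
    proof (intro ennreal_leI, subst exp_le_cancel_iff)
      have "\<bar>s * \<epsilon>\<bar> \<le> 1" "(s * \<epsilon>)\<^sup>2 = s\<^sup>2" using \<epsilon> s by auto
      then have "exp (s * \<epsilon>) - 1 - s * \<epsilon> \<le> s\<^sup>2" using exp_minus_one_minus_id_le by metis
      then have "\<mu> * (exp (s * \<epsilon>) - 1 - s * \<epsilon>) \<le> \<mu> * s\<^sup>2" using \<mu> by (rule mult_left_mono)
      with s show "\<mu> * (exp (s * \<epsilon>) - 1 - s * \<epsilon>) \<le> l" by linarith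
    qed
    finally show "(\<integral>\<^sup>+\<omega>. ennreal (exp (s * (\<epsilon> * ((\<Sum>i\<in>K. indicator R (\<omega> i)) - \<mu>)))) \<partial>PiM K (\<lambda>_. P)) \<le> ennreal (exp l)" .
    show "0 \<le> s" by (rule s)
    have "s * (2 * sqrt (\<mu> * l)) = 2 * sqrt (l / \<mu> * (\<mu> * l))"
      by (simp only: s_def real_sqrt_mult mult.left_commute[of _ 2])
    also have "\<dots> = 2 * l"
    proof (cases "\<mu> = 0")
      case True
      moreover have "l \<le> \<mu>" using l(2) by (simp add: \<mu>_def)
      ultimately show ?thesis using l(1) by simp
    next
      case False
      then have "l / \<mu> * (\<mu> * l) = l\<^sup>2" by (simp add: power2_eq_square)
      then show ?thesis using l by simp
    qed
    finally show "l - s * (2 * sqrt (\<mu> * l)) \<le> - l" by simp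
  qed
  then show ?thesis by (simp add: \<mu>_def)
qed

section \<open>Cross-validation of an empirical conditional risk minimiser\<close>

lemma sqrt_mult_eq: "sqrt (u * y) = u * sqrt (y / u)" if "0 < u"
proof -
  have "u * sqrt (y / u) = sqrt (u\<^sup>2) * sqrt (y / u)" using that by simp
  also have "\<dots> = sqrt (u\<^sup>2 * (y / u))" by (rule real_sqrt_mult[symmetric])
  also have "u\<^sup>2 * (y / u) = u * y" using that by (simp add: power2_eq_square)
  finally show ?thesis ..
qed

text \<open>
Each index lies in one validation fold and in \<open>K - 1\<close> training sets, all of the same cardinality, so the
means over the folds and the means over the training sets both average to the mean over the sample.
\<close>

lemma avg_over_folds:
  fixes f :: "nat \<Rightarrow> real"
  assumes V: "kfold n K V" and K: "2 \<le> K" "K dvd n" and n: "0 < n"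
  shows "(\<Sum>j=1..K. (\<Sum>i\<in>V j. f i) / real (card (V j))) / real K = (\<Sum>i=1..n. f i) / real n"
    and "(\<Sum>j=1..K. (\<Sum>i\<in>{1..n} - V j. f i) / real (card ({1..n} - V j))) / real K = (\<Sum>i=1..n. f i) / real n"
    and "\<And>j. j \<in> {1..K} \<Longrightarrow> V j \<subseteq> {1..n}"
    and "\<And>j. j \<in> {1..K} \<Longrightarrow> real (card (V j)) = real n / real K"
    and "\<And>j. j \<in> {1..K} \<Longrightarrow> real (card ({1..n} - V j)) = real n - real n / real K"
    and "(\<Sum>j=1..K. \<Sum>i\<in>V j. f i) = (\<Sum>i=1..n. f i)"
proof -
  have Vd: "disjoint_family_on V {1..K}" "(\<Union>j\<in>{1..K}. V j) = {1..n}" "\<And>j. j \<in> {1..K} \<Longrightarrow> card (V j) = n div K"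
    using V by (auto simp: kfold_def)
  show sub: "V j \<subseteq> {1..n}" if "j \<in> {1..K}" for j using Vd(2) that by blast
  show card: "real (card (V j)) = real n / real K" if "j \<in> {1..K}" for j
    using Vd(3)[OF that] K by (simp add: real_of_nat_div)
  show cardT: "real (card ({1..n} - V j)) = real n - real n / real K" if "j \<in> {1..K}" for j
  proof -
    have "card ({1..n} - V j) = n - card (V j)"
      using sub[OF that] by (subst card_Diff_subset) (auto intro: finite_subset)
    moreover have "card (V j) \<le> n" using card_mono[OF _ sub[OF that]] by simp
    ultimately show ?thesis using card[OF that] by (simp add: of_nat_diff)
  qed
  have fin: "finite (V j)" if "j \<in> {1..K}" for j using sub[OF that] finite_subset by blast
  show total: "(\<Sum>j=1..K. \<Sum>i\<in>V j. f i) = (\<Sum>i=1..n. f i)"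
    unfolding Vd(2)[symmetric] using fin Vd(1)
    by (subst sum.UNION_disjoint) (auto simp: disjoint_family_on_def)
  have "(\<Sum>j=1..K. (\<Sum>i\<in>V j. f i) / real (card (V j))) = (\<Sum>j=1..K. (\<Sum>i\<in>V j. f i) * (real K / real n))"
    by (intro sum.cong refl) (simp only: card divide_divide_eq_right times_divide_eq_right)
  also have "\<dots> = (\<Sum>i=1..n. f i) * (real K / real n)" by (simp only: sum_distrib_right[symmetric] total)
  finally show "(\<Sum>j=1..K. (\<Sum>i\<in>V j. f i) / real (card (V j))) / real K = (\<Sum>i=1..n. f i) / real n"
    using K by simp
  have T: "(\<Sum>i\<in>{1..n} - V j. f i) = (\<Sum>i=1..n. f i) - (\<Sum>i\<in>V j. f i)" if "j \<in> {1..K}" for j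
    using sub[OF that] by (subst sum_diff) auto
  define w where "w = real n - real n / real K"
  have w: "0 < w" "real K * w = real n * (real K - 1)" using K n by (auto simp: w_def field_simps)
  have "(\<Sum>j=1..K. (\<Sum>i\<in>{1..n} - V j. f i) / real (card ({1..n} - V j)))
      = (\<Sum>j=1..K. ((\<Sum>i=1..n. f i) - (\<Sum>i\<in>V j. f i)) / w)"
    by (intro sum.cong refl) (simp only: cardT T w_def)
  also have "\<dots> = (real K * (\<Sum>i=1..n. f i) - (\<Sum>i=1..n. f i)) / w"
    by (simp only: sum_divide_distrib[symmetric] sum_subtractf total) simp
  also have "\<dots> / real K = (real K - 1) * (\<Sum>i=1..n. f i) / (real K * w)"
    by (simp add: algebra_simps)
  also have "\<dots> = (\<Sum>i=1..n. f i) / real n" unfolding w(2) using K by simp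
  finally show "(\<Sum>j=1..K. (\<Sum>i\<in>{1..n} - V j. f i) / real (card ({1..n} - V j))) / real K = (\<Sum>i=1..n. f i) / real n" .
qed

lemma abs_avg_diff_le:
  fixes p q h :: "nat \<Rightarrow> real"
  assumes "\<And>j. j \<in> {1..K} \<Longrightarrow> \<bar>p j - q j\<bar> \<le> h j"
  shows "\<bar>(\<Sum>j=1..K. p j) / real K - (\<Sum>j=1..K. q j) / real K\<bar> \<le> (\<Sum>j=1..K. h j) / real K"
proof -
  have "\<bar>(\<Sum>j=1..K. p j) / real K - (\<Sum>j=1..K. q j) / real K\<bar> = \<bar>\<Sum>j=1..K. p j - q j\<bar> / real K"
    by (simp add: sum_subtractf diff_divide_distrib[symmetric])
  also have "\<dots> \<le> (\<Sum>j=1..K. h j) / real K"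
    using assms by (intro divide_right_mono order_trans[OF sum_abs] sum_mono) auto
  finally show ?thesis .
qed

locale cross_validated_erm =
  fixes d :: nat and X :: "vect set" and N :: "vect \<Rightarrow> real" and P :: "obs measure"
    and n k :: nat and \<alpha> :: real and G :: "'g set" and c :: "'g \<Rightarrow> obs \<Rightarrow> real"
    and \<Psi> :: "nat set \<Rightarrow> (nat \<Rightarrow> obs) \<Rightarrow> 'g" and v K :: nat and V :: "nat \<Rightarrow> nat set"
  assumes X: "X \<subseteq> space (borel_vect d)"
    and N: "norm_on d N"
    and P: "prob_space P"
    and sets_P: "sets P = sets (obs_space d X)"
    and k: "1 \<le> k" "k \<le> n"
    and \<alpha>: "\<alpha> = real k / real n"
    and tail_prob: "measure P {z \<in> space P. N (fst z) \<ge> tail_quantile N P \<alpha>} = \<alpha>"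
    and no_atom: "\<And>u. tail_quantile N P \<alpha> \<le> u \<Longrightarrow> measure P {z \<in> space P. N (fst z) = u} = 0"
    and c_measurable: "\<And>g. g \<in> G \<Longrightarrow> c g \<in> borel_measurable P"
    and rule: "learning_rule n \<alpha> N P G c \<Psi>"
    and erm: "cond_erm n \<alpha> N P G c \<Psi>"
    and vc: "vc_dim ((\<lambda>g. subgraph (X \<times> {-1, 1}) (c g)) ` G) = enat v"
    and c01: "\<And>g z. g \<in> G \<Longrightarrow> z \<in> X \<times> {-1, 1} \<Longrightarrow> 0 \<le> c g z \<and> c g z \<le> 1"
    and K: "2 \<le> K" "K dvd n"
    and V: "kfold n K V"
begin

sublocale P: prob_space P by (rule P)

abbreviation \<Omega> :: "(nat \<Rightarrow> obs) measure" where "\<Omega> \<equiv> sample_measure n P"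

definition t where "t = tail_quantile N P \<alpha>"

definition R where "R = {z \<in> space P. t \<le> N (fst z)}"

definition T :: "nat \<Rightarrow> nat set" where "T j = {1..n} - V j"

text \<open>
The empirical risk with the quantile \<open>t\<close> in place of the empirical threshold.
\<close>

definition trim_risk :: "'g \<Rightarrow> nat set \<Rightarrow> (nat \<Rightarrow> obs) \<Rightarrow> real" where
  "trim_risk g S \<omega> = (\<Sum>i\<in>S. c g (\<omega> i) * indicator R (\<omega> i)) / (\<alpha> * real (card S))"

abbreviation risk :: "'g \<Rightarrow> real" where "risk g \<equiv> cond_risk N P \<alpha> c g"

abbreviation emp :: "(nat \<Rightarrow> obs) \<Rightarrow> 'g \<Rightarrow> nat set \<Rightarrow> real" where
  "emp \<omega> g S \<equiv> emp_risk n \<alpha> N c \<omega> g S"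

text \<open>
The index \<open>i\<close> is evaluated at the rule trained on \<open>\<tau> i\<close>. The three deviations of the proof correspond to
three choices of \<open>\<tau>\<close> and \<open>W\<close>.
\<close>

definition dev :: "(nat \<Rightarrow> nat set) \<Rightarrow> nat set \<Rightarrow> (nat \<Rightarrow> obs) \<Rightarrow> real" where
  "dev \<tau> W \<omega> = (\<Sum>i\<in>W. c (\<Psi> (\<tau> i) \<omega>) (\<omega> i) * indicator R (\<omega> i)
      - (\<integral>x. c (\<Psi> (\<tau> i) \<omega>) x * indicator R x \<partial>P))"

lemma n_pos: "0 < n" and \<alpha>_pos: "0 < \<alpha>" and \<alpha>n: "real n * \<alpha> = real k"
  using k \<alpha> by auto

lemmas folds = avg_over_folds[OF V K n_pos]

lemma space_P: "space P = X \<times> {-1, 1}"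
  using X sets_eq_imp_space_eq[OF sets_P]
  by (auto simp: obs_space_def space_pair_measure space_restrict_space)

lemma norm_measurable: "(\<lambda>z. N (fst z)) \<in> borel_measurable P"
proof -
  have "fst \<in> obs_space d X \<rightarrow>\<^sub>M restrict_space (borel_vect d) X"
    unfolding obs_space_def by (rule measurable_fst)
  moreover have "N \<in> borel_measurable (restrict_space (borel_vect d) X)"
    by (intro measurable_restrict_space1 norm_on_measurable[OF N])
  ultimately have "(\<lambda>z. N (fst z)) \<in> borel_measurable (obs_space d X)"
    by (rule measurable_compose)
  then show ?thesis by (simp only: measurable_cong_sets[OF sets_P refl])
qed

lemma R_sets: "R \<in> sets P"
  unfolding R_def using norm_measurable by measurable

lemma prob_R: "measure P R = \<alpha>"
  using tail_prob by (simp add: R_def t_def)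

lemma space_\<Omega>: "\<omega> \<in> space \<Omega> \<Longrightarrow> i \<in> {1..n} \<Longrightarrow> \<omega> i \<in> space P"
  by (auto simp: sample_measure_def space_PiM)

lemma prob_\<Omega>: "prob_space \<Omega>"
  unfolding sample_measure_def by (intro prob_space_PiM P)

lemma \<Psi>_in: "S \<subseteq> {1..n} \<Longrightarrow> S \<noteq> {} \<Longrightarrow> \<omega> \<in> space \<Omega> \<Longrightarrow> \<Psi> S \<omega> \<in> G"
  using rule unfolding learning_rule_def by blast

lemma \<Psi>_measurable: "S \<subseteq> {1..n} \<Longrightarrow> S \<noteq> {} \<Longrightarrow>
    (\<lambda>(\<omega>, z). c (\<Psi> S \<omega>) z) \<in> borel_measurable (\<Omega> \<Otimes>\<^sub>M P)"
  using rule unfolding learning_rule_def by blast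

lemma emp_minimal: "S \<subseteq> {1..n} \<Longrightarrow> S \<noteq> {} \<Longrightarrow> \<omega> \<in> space \<Omega> \<Longrightarrow> g \<in> G \<Longrightarrow> emp \<omega> (\<Psi> S \<omega>) S \<le> emp \<omega> g S"
  using erm unfolding cond_erm_def is_arg_min_def by (metis not_le)

lemma T_subset: "T j \<subseteq> {1..n}" by (auto simp: T_def)

lemma card_T: "j \<in> {1..K} \<Longrightarrow> real (card (T j)) = real n - real n / real K"
  unfolding T_def by (rule folds(5))

lemma T_ne: "j \<in> {1..K} \<Longrightarrow> T j \<noteq> {}"
proof
  assume "j \<in> {1..K}" "T j = {}"
  with card_T[of j] have "real n = real n / real K" by simp
  with K n_pos show False by (simp add: field_simps)
qed

lemma risk_eq: "g \<in> G \<Longrightarrow> risk g = (\<integral>z. c g z * indicator R z \<partial>P) / \<alpha>"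
proof -
  assume g: "g \<in> G"
  have "uniform_measure P R = density P (\<lambda>z. ennreal (indicator R z / \<alpha>))"
    unfolding uniform_measure_def
    using \<alpha>_pos by (intro arg_cong[of _ _ "density P"])
      (auto simp: fun_eq_iff indicator_def P.emeasure_eq_measure prob_R divide_ennreal[symmetric])
  then have "risk g = (\<integral>z. c g z \<partial>density P (\<lambda>z. ennreal (indicator R z / \<alpha>)))"
    unfolding cond_risk_def R_def t_def by simp
  also have "\<dots> = (\<integral>z. (indicator R z / \<alpha>) *\<^sub>R c g z \<partial>P)"
    using \<alpha>_pos R_sets c_measurable[OF g] by (intro integral_density) auto
  also have "\<dots> = (\<integral>z. c g z * indicator R z / \<alpha> \<partial>P)"
    by (intro Bochner_Integration.integral_cong) auto
  finally show ?thesis by simp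
qed

lemma risk_bounds: "g \<in> G \<Longrightarrow> 0 \<le> risk g \<and> risk g \<le> 1"
proof -
  assume g: "g \<in> G"
  have b: "0 \<le> c g z * indicator R z" "c g z * indicator R z \<le> indicator R z" if "z \<in> space P" for z
    using c01[OF g] that by (auto simp: space_P indicator_def)
  have int: "integrable P (\<lambda>z. indicator R z :: real)"
    using R_sets by (intro integrable_real_indicator) (auto simp: P.emeasure_eq_measure)
  have "(\<integral>z. c g z * indicator R z \<partial>P) \<le> (\<integral>z. indicator R z \<partial>P)"
    using b by (intro integral_mono_AE' int) auto
  also have "\<dots> = \<alpha>" using R_sets by (simp add: prob_R)
  finally have "(\<integral>z. c g z * indicator R z \<partial>P) \<le> \<alpha>" .
  moreover have "0 \<le> (\<integral>z. c g z * indicator R z \<partial>P)" using b by (intro integral_nonneg_AE) auto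
  ultimately show ?thesis using \<alpha>_pos unfolding risk_eq[OF g] by simp
qed

lemma dev_const:
  assumes "S \<subseteq> {1..n}" "S \<noteq> {}" "\<omega> \<in> space \<Omega>" "W \<noteq> {}" "finite W"
    and "\<And>i. i \<in> W \<Longrightarrow> \<tau> i = S"
  shows "dev \<tau> W \<omega> = \<alpha> * real (card W) * (trim_risk (\<Psi> S \<omega>) W \<omega> - risk (\<Psi> S \<omega>))"
proof -
  have "dev \<tau> W \<omega> = (\<Sum>i\<in>W. c (\<Psi> S \<omega>) (\<omega> i) * indicator R (\<omega> i) - \<alpha> * risk (\<Psi> S \<omega>))"
    unfolding dev_def using assms(6) \<alpha>_pos risk_eq[OF \<Psi>_in[OF assms(1-3)]] by (intro sum.cong) auto
  also have "\<dots> = (\<Sum>i\<in>W. c (\<Psi> S \<omega>) (\<omega> i) * indicator R (\<omega> i)) - \<alpha> * real (card W) * risk (\<Psi> S \<omega>)"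
    by (simp add: sum_subtractf mult_ac)
  also have "(\<Sum>i\<in>W. c (\<Psi> S \<omega>) (\<omega> i) * indicator R (\<omega> i)) = \<alpha> * real (card W) * trim_risk (\<Psi> S \<omega>) W \<omega>"
    unfolding trim_risk_def using \<alpha>_pos assms(4,5) by simp
  finally show ?thesis by (simp add: algebra_simps)
qed

lemma dev_mgf:
  assumes W: "W \<subseteq> {1..n}" and \<tau>: "\<And>i. i \<in> W \<Longrightarrow> \<tau> i \<subseteq> {1..n} \<and> \<tau> i \<noteq> {}"
  shows "(\<integral>\<^sup>+\<omega>. ennreal (exp (s * dev \<tau> W \<omega>)) \<partial>\<Omega>)
    \<le> ennreal (exp (40 * real (card (\<tau> ` W)) * real v + 2 * real (card W) * \<alpha> * (exp (2 * s\<^sup>2) - 1)))"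
proof -
  have vc': "vc_dim (subgraph (space P) ` c ` G) \<le> enat v"
    using vc by (simp add: space_P image_image)
  have "(\<integral>\<^sup>+\<omega>. ennreal (exp (s * (\<Sum>i\<in>W. c (\<Psi> (\<tau> i) \<omega>) (\<omega> i) * indicator R (\<omega> i)
      - (\<integral>x. c (\<Psi> (\<tau> i) \<omega>) x * indicator R x \<partial>P)))) \<partial>PiM {1..n} (\<lambda>_. P))
    \<le> ennreal (exp (40 * real (card (\<tau> ` W)) * real v + 2 * real (card W) * measure P R * (exp (2 * s\<^sup>2) - 1)))"
    by (rule selection_mgf_bound[where h = "\<lambda>S \<omega>. c (\<Psi> S \<omega>)" and H = "c ` G", OF P W R_sets _ vc'])
      (use c01 \<tau> \<Psi>_in \<Psi>_measurable in \<open>auto simp: space_P sample_measure_def\<close>)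
  then show ?thesis unfolding dev_def sample_measure_def prob_R .
qed

lemma eval_measurable:
  assumes "S \<subseteq> {1..n}" "S \<noteq> {}" "i \<in> {1..n}"
  shows "(\<lambda>\<omega>. c (\<Psi> S \<omega>) (\<omega> i)) \<in> borel_measurable \<Omega>"
proof -
  have "(\<lambda>\<omega>. (\<omega>, \<omega> i)) \<in> \<Omega> \<rightarrow>\<^sub>M \<Omega> \<Otimes>\<^sub>M P"
    unfolding sample_measure_def using assms(3)
    by (intro measurable_Pair measurable_ident_sets[OF refl] measurable_component_singleton)
  from measurable_compose[OF this \<Psi>_measurable[OF assms(1,2)]] show ?thesis by simp
qed

lemma trimmed_integral_measurable:
  assumes "S \<subseteq> {1..n}" "S \<noteq> {}"
  shows "(\<lambda>\<omega>. \<integral>x. c (\<Psi> S \<omega>) x * indicator R x \<partial>P) \<in> borel_measurable \<Omega>"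
proof (rule P.borel_measurable_lebesgue_integral)
  have "(\<lambda>p. indicator R (snd p) :: real) \<in> borel_measurable (\<Omega> \<Otimes>\<^sub>M P)"
    by (rule measurable_compose[OF measurable_snd borel_measurable_indicator[OF R_sets]])
  moreover have "(\<lambda>p. c (\<Psi> S (fst p)) (snd p)) \<in> borel_measurable (\<Omega> \<Otimes>\<^sub>M P)"
    using \<Psi>_measurable[OF assms] by (simp add: case_prod_beta)
  ultimately have "(\<lambda>p. c (\<Psi> S (fst p)) (snd p) * indicator R (snd p)) \<in> borel_measurable (\<Omega> \<Otimes>\<^sub>M P)"
    by (intro borel_measurable_times)
  then show "(\<lambda>(\<omega>, x). c (\<Psi> S \<omega>) x * indicator R x) \<in> borel_measurable (\<Omega> \<Otimes>\<^sub>M P)"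
    by (simp add: case_prod_beta)
qed

lemma indicator_R_measurable:
  "i \<in> {1..n} \<Longrightarrow> (\<lambda>\<omega>. indicator R (\<omega> i) :: real) \<in> borel_measurable \<Omega>"
  unfolding sample_measure_def
  by (rule measurable_compose[OF measurable_component_singleton[of i "{1..n}" "\<lambda>_. P"] borel_measurable_indicator[OF R_sets]])

lemma dev_measurable:
  assumes W: "W \<subseteq> {1..n}" and \<tau>: "\<And>i. i \<in> W \<Longrightarrow> \<tau> i \<subseteq> {1..n} \<and> \<tau> i \<noteq> {}"
  shows "dev \<tau> W \<in> borel_measurable \<Omega>"
  unfolding dev_def
proof (intro borel_measurable_sum borel_measurable_diff borel_measurable_times)
  fix i assume "i \<in> W"
  then have i: "i \<in> {1..n}" "\<tau> i \<subseteq> {1..n}" "\<tau> i \<noteq> {}" using W \<tau> by blast+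
  show "(\<lambda>\<omega>. c (\<Psi> (\<tau> i) \<omega>) (\<omega> i)) \<in> borel_measurable \<Omega>"
    "(\<lambda>\<omega>. indicator R (\<omega> i) :: real) \<in> borel_measurable \<Omega>"
    "(\<lambda>\<omega>. \<integral>x. c (\<Psi> (\<tau> i) \<omega>) x * indicator R x \<partial>P) \<in> borel_measurable \<Omega>"
    by (rule eval_measurable[OF i(2,3,1)] indicator_R_measurable[OF i(1)] trimmed_integral_measurable[OF i(2,3)])+
qed

text \<open>
Chernoff's bound for averages of deviations that need not be independent of each other: convexity of the
exponential bounds the exponential moment of an average by the largest one among its terms.
\<close>

lemma mean_dev_tail:
  fixes W :: "'j \<Rightarrow> nat set" and \<tau> :: "'j \<Rightarrow> nat \<Rightarrow> nat set" and w :: nat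
  assumes J: "finite J" "J \<noteq> {}"
    and W: "\<And>j. j \<in> J \<Longrightarrow> W j \<subseteq> {1..n}" "\<And>j. j \<in> J \<Longrightarrow> card (W j) = w"
    and \<tau>: "\<And>j i. j \<in> J \<Longrightarrow> i \<in> W j \<Longrightarrow> \<tau> j i \<subseteq> {1..n} \<and> \<tau> j i \<noteq> {}"
    and card_\<tau>: "\<And>j. j \<in> J \<Longrightarrow> card (\<tau> j ` W j) \<le> K"
    and \<epsilon>: "\<epsilon> \<in> {-1, 1}" and l: "0 \<le> l"
    and \<Lambda>: "\<Lambda> = l + 40 * real K * real v" "2 * \<Lambda> \<le> 9 * real w * \<alpha>"
  shows "measure \<Omega> {\<omega> \<in> space \<Omega>. 6 * sqrt (real w * \<alpha> * \<Lambda>) < \<epsilon> * ((\<Sum>j\<in>J. dev (\<tau> j) (W j) \<omega>) / real (card J))}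
    \<le> exp (- l)"
proof -
  \<comment> \<open>The minimiser of \<open>9 * w * \<alpha> * s\<^sup>2 - s * y\<close> for \<open>y = 6 * sqrt (w * \<alpha> * \<Lambda>)\<close>, where it
    is \<open>- \<Lambda>\<close>.\<close>
  define s where "s = sqrt (\<Lambda> / (9 * real w * \<alpha>))"
  define b where "b = 40 * real K * real v + \<Lambda>"
  have \<Lambda>0: "0 \<le> \<Lambda>" using l by (simp add: \<Lambda>)
  have s0: "0 \<le> s" using \<Lambda>0 \<alpha>_pos by (simp add: s_def)
  have s2: "s\<^sup>2 = \<Lambda> / (9 * real w * \<alpha>)" using \<Lambda>0 \<alpha>_pos by (simp add: s_def)
  have s2_le: "2 * s\<^sup>2 \<le> 1" "9 * real w * \<alpha> * s\<^sup>2 \<le> \<Lambda>"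
    using \<Lambda>(2) \<Lambda>0 \<alpha>_pos by (auto simp: s2 divide_le_eq_1)
  have card_J: "0 < real (card J)" using J by (simp add: card_gt_0_iff)
  have devm: "dev (\<tau> j) (W j) \<in> borel_measurable \<Omega>" if "j \<in> J" for j
    using W(1) \<tau> that by (intro dev_measurable) auto
  have mgf: "(\<integral>\<^sup>+\<omega>. ennreal (exp (s * \<epsilon> * dev (\<tau> j) (W j) \<omega>)) \<partial>\<Omega>) \<le> ennreal (exp b)" if j: "j \<in> J" for j
  proof -
    have "(\<integral>\<^sup>+\<omega>. ennreal (exp (s * \<epsilon> * dev (\<tau> j) (W j) \<omega>)) \<partial>\<Omega>)
      \<le> ennreal (exp (40 * real (card (\<tau> j ` W j)) * real v + 2 * real (card (W j)) * \<alpha> * (exp (2 * (s * \<epsilon>)\<^sup>2) - 1)))"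
      using W(1)[OF j] \<tau>[OF j] by (rule dev_mgf)
    also have "\<dots> \<le> ennreal (exp b)"
    proof (intro ennreal_leI, subst exp_le_cancel_iff)
      have "(s * \<epsilon>)\<^sup>2 = s\<^sup>2" using \<epsilon> by auto
      moreover have "exp (2 * s\<^sup>2) - 1 \<le> 9 / 2 * s\<^sup>2"
      proof -
        have "exp (2 * s\<^sup>2) \<le> 1 + 2 * s\<^sup>2 + (2 * s\<^sup>2)\<^sup>2" using s2_le by (intro exp_bound) auto
        also have "(2 * s\<^sup>2)\<^sup>2 \<le> 2 * s\<^sup>2 * 1" unfolding power2_eq_square[of "2 * s\<^sup>2"]
          using s2_le by (intro mult_left_mono) auto
        finally show ?thesis using zero_le_power2[of s] by linarith
      qed
      then have "2 * real w * \<alpha> * (exp (2 * s\<^sup>2) - 1) \<le> 2 * real w * \<alpha> * (9 / 2 * s\<^sup>2)"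
        using \<alpha>_pos by (intro mult_left_mono) auto
      moreover have "real (card (\<tau> j ` W j)) * real v \<le> real K * real v"
        using card_\<tau>[OF j] by (intro mult_right_mono) auto
      ultimately show "40 * real (card (\<tau> j ` W j)) * real v + 2 * real (card (W j)) * \<alpha> * (exp (2 * (s * \<epsilon>)\<^sup>2) - 1) \<le> b"
        using s2_le W(2)[OF j] unfolding b_def by (simp add: mult_ac)
    qed
    finally show ?thesis .
  qed
  show ?thesis
  proof (rule exp_moment_tail[OF prob_\<Omega>, where s = s and b = b])
    show "(\<lambda>\<omega>. \<epsilon> * ((\<Sum>j\<in>J. dev (\<tau> j) (W j) \<omega>) / real (card J))) \<in> borel_measurable \<Omega>"
      by (intro borel_measurable_times borel_measurable_const borel_measurable_divide borel_measurable_sum devm)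
    show "0 \<le> s" by (rule s0)
    have "(\<integral>\<^sup>+\<omega>. ennreal (exp (s * (\<epsilon> * ((\<Sum>j\<in>J. dev (\<tau> j) (W j) \<omega>) / real (card J))))) \<partial>\<Omega>)
        \<le> (\<integral>\<^sup>+\<omega>. (\<Sum>j\<in>J. ennreal (1 / real (card J)) * ennreal (exp (s * \<epsilon> * dev (\<tau> j) (W j) \<omega>))) \<partial>\<Omega>)"
    proof (rule nn_integral_mono)
      fix \<omega>
      have "exp (s * (\<epsilon> * ((\<Sum>j\<in>J. dev (\<tau> j) (W j) \<omega>) / real (card J))))
          = exp (\<Sum>j\<in>J. (1 / real (card J)) *\<^sub>R (s * \<epsilon> * dev (\<tau> j) (W j) \<omega>))"
        by (simp add: sum_distrib_left sum_divide_distrib mult.assoc)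
      also have "\<dots> \<le> (\<Sum>j\<in>J. (1 / real (card J)) * exp (s * \<epsilon> * dev (\<tau> j) (W j) \<omega>))"
        using J card_J by (intro convex_on_sum[OF _ _ exp_convex]) auto
      finally have "ennreal (exp (s * (\<epsilon> * ((\<Sum>j\<in>J. dev (\<tau> j) (W j) \<omega>) / real (card J)))))
          \<le> ennreal (\<Sum>j\<in>J. (1 / real (card J)) * exp (s * \<epsilon> * dev (\<tau> j) (W j) \<omega>))"
        by (rule ennreal_leI)
      also have "\<dots> = (\<Sum>j\<in>J. ennreal (1 / real (card J)) * ennreal (exp (s * \<epsilon> * dev (\<tau> j) (W j) \<omega>)))"
        using card_J by (simp add: ennreal_mult[symmetric] del: sum_ennreal) (subst sum_ennreal, auto)
      finally show "ennreal (exp (s * (\<epsilon> * ((\<Sum>j\<in>J. dev (\<tau> j) (W j) \<omega>) / real (card J))))) \<le> \<dots>" .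
    qed
    also have "\<dots> = (\<Sum>j\<in>J. ennreal (1 / real (card J)) * (\<integral>\<^sup>+\<omega>. ennreal (exp (s * \<epsilon> * dev (\<tau> j) (W j) \<omega>)) \<partial>\<Omega>))"
      using devm by (simp add: nn_integral_sum nn_integral_cmult)
    also have "\<dots> \<le> (\<Sum>j\<in>J. ennreal (1 / real (card J)) * ennreal (exp b))"
      by (intro sum_mono mult_left_mono mgf) auto
    also have "\<dots> = (\<Sum>j\<in>J. ennreal (1 / real (card J) * exp b))"
      by (intro sum.cong refl ennreal_mult'[symmetric]) simp
    also have "\<dots> = ennreal (\<Sum>j\<in>J. 1 / real (card J) * exp b)"
      by (intro sum_ennreal) simp
    also have "(\<Sum>j\<in>J. 1 / real (card J) * exp b) = exp b" using card_J by simp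
    finally show "(\<integral>\<^sup>+\<omega>. ennreal (exp (s * (\<epsilon> * ((\<Sum>j\<in>J. dev (\<tau> j) (W j) \<omega>) / real (card J))))) \<partial>\<Omega>) \<le> ennreal (exp b)" .
    have "s * (6 * sqrt (real w * \<alpha> * \<Lambda>)) = 6 * sqrt (\<Lambda> / (9 * real w * \<alpha>) * (real w * \<alpha> * \<Lambda>))"
      by (simp only: s_def real_sqrt_mult mult.left_commute[of _ 6])
    also have "\<dots> = 2 * \<Lambda>"
    proof (cases "w = 0")
      case True
      with \<Lambda>(2) \<Lambda>0 show ?thesis by simp
    next
      case False
      then have "\<Lambda> / (9 * real w * \<alpha>) * (real w * \<alpha> * \<Lambda>) = (\<Lambda> / 3)\<^sup>2"
        using \<alpha>_pos by (simp add: power2_eq_square field_simps)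
      then show ?thesis using \<Lambda>0 by simp
    qed
    finally show "b - s * (6 * sqrt (real w * \<alpha> * \<Lambda>)) \<le> - l" by (simp add: b_def \<Lambda>)
  qed
qed

definition mismatch :: "(nat \<Rightarrow> obs) \<Rightarrow> nat \<Rightarrow> real" where
  "mismatch \<omega> i = \<bar>of_bool (N (fst (\<omega> i)) > emp_threshold n \<alpha> N \<omega>) - indicator R (\<omega> i)\<bar>"

lemma emp_minus_trim_le:
  assumes g: "g \<in> G" and \<omega>: "\<omega> \<in> space \<Omega>" and S: "S \<subseteq> {1..n}"
  shows "\<bar>emp \<omega> g S - trim_risk g S \<omega>\<bar> \<le> (\<Sum>i\<in>S. mismatch \<omega> i) / (\<alpha> * real (card S))"
proof -
  let ?b = "\<lambda>i. of_bool (N (fst (\<omega> i)) > emp_threshold n \<alpha> N \<omega>) :: real"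
  have "emp \<omega> g S - trim_risk g S \<omega>
      = (\<Sum>i\<in>S. c g (\<omega> i) * ?b i - c g (\<omega> i) * indicator R (\<omega> i)) / (\<alpha> * real (card S))"
    by (simp add: emp_risk_def trim_risk_def sum_subtractf diff_divide_distrib)
  also have "\<bar>\<dots>\<bar> = \<bar>\<Sum>i\<in>S. c g (\<omega> i) * ?b i - c g (\<omega> i) * indicator R (\<omega> i)\<bar> / (\<alpha> * real (card S))"
    using \<alpha>_pos by (simp add: abs_mult)
  also have "\<dots> \<le> (\<Sum>i\<in>S. mismatch \<omega> i) / (\<alpha> * real (card S))"
  proof (intro divide_right_mono order_trans[OF sum_abs] sum_mono)
    fix i assume "i \<in> S"
    then have "\<omega> i \<in> X \<times> {-1, 1}" using \<omega> S space_\<Omega> space_P by blast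
    from c01[OF g this] have "\<bar>c g (\<omega> i)\<bar> \<le> 1" by simp
    then have "\<bar>c g (\<omega> i)\<bar> * mismatch \<omega> i \<le> 1 * mismatch \<omega> i"
      by (intro mult_right_mono) (auto simp: mismatch_def)
    then show "\<bar>c g (\<omega> i) * ?b i - c g (\<omega> i) * indicator R (\<omega> i)\<bar> \<le> mismatch \<omega> i"
      by (simp add: mismatch_def abs_mult[symmetric] right_diff_distrib)
  qed (use \<alpha>_pos in auto)
  finally show ?thesis .
qed

text \<open>
The empirical risk on the sample as a mean over training sets, and as a convex combination of a validation
and a training risk. These two identities connect the risks that the minimality of the rules compares.
\<close>

lemma avg_emp:
  shows "(\<Sum>j=1..K. emp \<omega> g (T j)) / real K = emp \<omega> g {1..n}"
    and "j \<in> {1..K} \<Longrightarrow> emp \<omega> g {1..n} = emp \<omega> g (V j) / real K + (1 - 1 / real K) * emp \<omega> g (T j)"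
proof -
  define f where "f = (\<lambda>i. c g (\<omega> i) * of_bool (N (fst (\<omega> i)) > emp_threshold n \<alpha> N \<omega>) / \<alpha>)"
  have emp: "emp \<omega> g S = (\<Sum>i\<in>S. f i) / real (card S)" for S
    unfolding emp_risk_def f_def by (simp add: sum_divide_distrib[symmetric])
  show "(\<Sum>j=1..K. emp \<omega> g (T j)) / real K = emp \<omega> g {1..n}"
    unfolding emp T_def using folds(2)[of f] by simp
  show "emp \<omega> g {1..n} = emp \<omega> g (V j) / real K + (1 - 1 / real K) * emp \<omega> g (T j)" if j: "j \<in> {1..K}"
  proof -
    have K1: "1 < real K" using K by simp
    have e1: "emp \<omega> g (V j) / real K = (\<Sum>i\<in>V j. f i) / real n"
      unfolding emp folds(4)[OF j] using K1 by simp
    have e2: "(1 - 1 / real K) * emp \<omega> g (T j) = (\<Sum>i\<in>T j. f i) / real n"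
    proof -
      have "real n - real n / real K = real n * (1 - 1 / real K)" by (simp add: algebra_simps)
      moreover have "1 - 1 / real K \<noteq> 0" using K1 by simp
      ultimately show ?thesis unfolding emp card_T[OF j] by simp
    qed
    have "(\<Sum>i\<in>{1..n}. f i) = (\<Sum>i\<in>V j. f i) + (\<Sum>i\<in>T j. f i)"
      using sum.subset_diff[OF folds(3)[OF j], of f] by (simp add: T_def)
    moreover have "emp \<omega> g {1..n} = (\<Sum>i\<in>{1..n}. f i) / real n" by (simp add: emp)
    ultimately show ?thesis by (simp only: e1 e2 add_divide_distrib)
  qed
qed

definition valid_dev :: "(nat \<Rightarrow> obs) \<Rightarrow> real" where
  "valid_dev \<omega> = (\<Sum>j=1..K. trim_risk (\<Psi> (T j) \<omega>) (V j) \<omega> - risk (\<Psi> (T j) \<omega>)) / real K"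

definition train_dev :: "(nat \<Rightarrow> obs) \<Rightarrow> real" where
  "train_dev \<omega> = (\<Sum>j=1..K. trim_risk (\<Psi> (T j) \<omega>) (T j) \<omega> - risk (\<Psi> (T j) \<omega>)) / real K"

definition full_dev :: "(nat \<Rightarrow> obs) \<Rightarrow> real" where
  "full_dev \<omega> = trim_risk (\<Psi> {1..n} \<omega>) {1..n} \<omega> - risk (\<Psi> {1..n} \<omega>)"

lemma full_ne: "{1..n} \<noteq> {}" using n_pos by auto

text \<open>
From above: with the training risks in the middle, minimality of each rule on its training set replaces it
by the rule trained on the sample. From below: minimality on the sample replaces the latter by the rule of
a fold, whose risk on the sample is a convex combination of its validation and training risks. Both of
these are close to its true risk.
\<close>

lemma cv_error_decomposition:
  assumes \<omega>: "\<omega> \<in> space \<Omega>"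
  shows "\<bar>cv_risk n \<alpha> N c \<Psi> K V \<omega> - risk (\<Psi> {1..n} \<omega>)\<bar>
    \<le> \<bar>valid_dev \<omega>\<bar> + \<bar>train_dev \<omega>\<bar> + \<bar>full_dev \<omega>\<bar> + 3 * ((\<Sum>i=1..n. mismatch \<omega> i) / real k)"
proof -
  define D where "D = (\<Sum>i=1..n. mismatch \<omega> i) / real k"
  define a where "a = (\<Sum>j=1..K. emp \<omega> (\<Psi> (T j) \<omega>) (V j)) / real K"
  define b where "b = (\<Sum>j=1..K. emp \<omega> (\<Psi> (T j) \<omega>) (T j)) / real K"
  define a' where "a' = (\<Sum>j=1..K. trim_risk (\<Psi> (T j) \<omega>) (V j) \<omega>) / real K"
  define b' where "b' = (\<Sum>j=1..K. trim_risk (\<Psi> (T j) \<omega>) (T j) \<omega>) / real K"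
  define r where "r = (\<Sum>j=1..K. risk (\<Psi> (T j) \<omega>)) / real K"
  define e where "e = emp \<omega> (\<Psi> {1..n} \<omega>) {1..n}"
  have K0: "0 < real K" using K by simp
  have G: "\<Psi> (T j) \<omega> \<in> G" if "j \<in> {1..K}" for j using T_subset T_ne[OF that] \<omega> by (rule \<Psi>_in)
  have Gn: "\<Psi> {1..n} \<omega> \<in> G" using full_ne \<omega> by (intro \<Psi>_in) auto
  have cv: "cv_risk n \<alpha> N c \<Psi> K V \<omega> = a" by (simp add: cv_risk_def a_def T_def)
  have avg_mismatch: "(\<Sum>j=1..K. h j / \<alpha>) / real K = D"
    if "(\<Sum>j=1..K. h j) / real K = (\<Sum>i=1..n. mismatch \<omega> i) / real n" for h :: "nat \<Rightarrow> real"
  proof -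
    have "(\<Sum>j=1..K. h j / \<alpha>) / real K = (\<Sum>j=1..K. h j) / \<alpha> / real K"
      by (simp only: sum_divide_distrib[symmetric])
    also have "\<dots> = (\<Sum>j=1..K. h j) / real K / \<alpha>" by (simp add: mult.commute)
    also have "\<dots> = D" unfolding that D_def \<alpha>n[symmetric] by simp
    finally show ?thesis .
  qed
  have 1: "\<bar>a - a'\<bar> \<le> D"
    unfolding a_def a'_def avg_mismatch[OF folds(1), symmetric]
  proof (rule abs_avg_diff_le)
    show "\<bar>emp \<omega> (\<Psi> (T j) \<omega>) (V j) - trim_risk (\<Psi> (T j) \<omega>) (V j) \<omega>\<bar>
        \<le> (\<Sum>i\<in>V j. mismatch \<omega> i) / real (card (V j)) / \<alpha>" if "j \<in> {1..K}" for j
      using emp_minus_trim_le[OF G[OF that] \<omega> folds(3)[OF that]] by (simp add: mult.commute)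
  qed
  have 2: "\<bar>b - b'\<bar> \<le> D"
    unfolding b_def b'_def avg_mismatch[OF folds(2), symmetric]
  proof (rule abs_avg_diff_le)
    show "\<bar>emp \<omega> (\<Psi> (T j) \<omega>) (T j) - trim_risk (\<Psi> (T j) \<omega>) (T j) \<omega>\<bar>
        \<le> (\<Sum>i\<in>{1..n} - V j. mismatch \<omega> i) / real (card ({1..n} - V j)) / \<alpha>" if "j \<in> {1..K}" for j
      using emp_minus_trim_le[OF G[OF that] \<omega> T_subset[of j]] by (simp add: mult.commute T_def)
  qed
  have 3: "\<bar>e - trim_risk (\<Psi> {1..n} \<omega>) {1..n} \<omega>\<bar> \<le> D"
    using emp_minus_trim_le[OF Gn \<omega> order_refl] \<alpha>n by (simp add: e_def D_def mult.commute)
  have A: "valid_dev \<omega> = a' - r" by (simp add: valid_dev_def a'_def r_def sum_subtractf diff_divide_distrib)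
  have B: "train_dev \<omega> = b' - r" by (simp add: train_dev_def b'_def r_def sum_subtractf diff_divide_distrib)
  have 4: "b \<le> e"
  proof -
    have "b \<le> (\<Sum>j=1..K. emp \<omega> (\<Psi> {1..n} \<omega>) (T j)) / real K"
      unfolding b_def using T_subset T_ne \<omega> Gn K0
      by (intro divide_right_mono sum_mono emp_minimal) auto
    also have "\<dots> = e" unfolding e_def by (rule avg_emp)
    finally show ?thesis .
  qed
  have 5: "e \<le> a / real K + (1 - 1 / real K) * b"
  proof -
    have "e = (\<Sum>j=1..K. e) / real K" using K0 by simp
    also have "\<dots> \<le> (\<Sum>j=1..K. emp \<omega> (\<Psi> (T j) \<omega>) {1..n}) / real K"
      unfolding e_def using G \<omega> full_ne K0 by (intro divide_right_mono sum_mono emp_minimal) auto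
    also have "(\<Sum>j=1..K. emp \<omega> (\<Psi> (T j) \<omega>) {1..n}) = (\<Sum>j=1..K. emp \<omega> (\<Psi> (T j) \<omega>) (V j) / real K
        + (1 - 1 / real K) * emp \<omega> (\<Psi> (T j) \<omega>) (T j))"
      by (intro sum.cong refl avg_emp(2))
    also have "\<dots> / real K = a / real K + (1 - 1 / real K) * b"
      by (simp add: a_def b_def sum.distrib sum_divide_distrib[symmetric] sum_distrib_left[symmetric] add_divide_distrib)
    finally show ?thesis .
  qed
  have 6: "e - a \<le> \<bar>b - a\<bar>"
  proof -
    have "e - a \<le> (1 - 1 / real K) * (b - a)" using 5 by (simp add: algebra_simps diff_divide_distrib)
    also have "\<dots> \<le> \<bar>(1 - 1 / real K) * (b - a)\<bar>" by simp
    also have "\<dots> \<le> 1 * \<bar>b - a\<bar>" unfolding abs_mult using K0 by (intro mult_right_mono) (auto simp: abs_le_iff)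
    finally show ?thesis by simp
  qed
  have D: "3 * ((\<Sum>i=1..n. mismatch \<omega> i) / real k) = 3 * D" by (simp add: D_def)
  show ?thesis
    unfolding cv A B full_dev_def D using 1 2 3 4 6 by linarith
qed

text \<open>
Fewer than \<open>k\<close> points exceed the empirical threshold, so the cross-validation estimate does not exceed \<open>1\<close>.
\<close>

lemma cv_error_le_1:
  assumes \<omega>: "\<omega> \<in> space \<Omega>"
  shows "\<bar>cv_risk n \<alpha> N c \<Psi> K V \<omega> - risk (\<Psi> {1..n} \<omega>)\<bar> \<le> 1"
proof -
  define f where "f = (\<lambda>i. of_bool (N (fst (\<omega> i)) > emp_threshold n \<alpha> N \<omega>) :: real)"
  have K0: "0 < real K" using K by simp
  have emp_b: "0 \<le> emp \<omega> (\<Psi> (T j) \<omega>) (V j) \<and> emp \<omega> (\<Psi> (T j) \<omega>) (V j) \<le> (\<Sum>i\<in>V j. f i) / real (card (V j)) / \<alpha>"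
    if j: "j \<in> {1..K}" for j
  proof -
    have G: "\<Psi> (T j) \<omega> \<in> G" using T_subset T_ne[OF j] \<omega> by (rule \<Psi>_in)
    have c: "0 \<le> c (\<Psi> (T j) \<omega>) (\<omega> i) \<and> c (\<Psi> (T j) \<omega>) (\<omega> i) \<le> 1" if "i \<in> V j" for i
      using space_\<Omega>[OF \<omega>, of i] folds(3)[OF j] that c01[OF G] space_P by blast
    have emp: "emp \<omega> (\<Psi> (T j) \<omega>) (V j) = (\<Sum>i\<in>V j. c (\<Psi> (T j) \<omega>) (\<omega> i) * f i) / real (card (V j)) / \<alpha>"
      by (simp add: emp_risk_def f_def mult.commute)
    have "(\<Sum>i\<in>V j. c (\<Psi> (T j) \<omega>) (\<omega> i) * f i) \<le> (\<Sum>i\<in>V j. f i)"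
      using c by (intro sum_mono) (auto simp: f_def mult_left_le)
    moreover have "0 \<le> (\<Sum>i\<in>V j. c (\<Psi> (T j) \<omega>) (\<omega> i) * f i)"
      using c by (intro sum_nonneg) (auto simp: f_def)
    ultimately show ?thesis unfolding emp using \<alpha>_pos by (auto intro!: divide_right_mono)
  qed
  have cv: "cv_risk n \<alpha> N c \<Psi> K V \<omega> = (\<Sum>j=1..K. emp \<omega> (\<Psi> (T j) \<omega>) (V j)) / real K"
    by (simp add: cv_risk_def T_def)
  have "0 \<le> cv_risk n \<alpha> N c \<Psi> K V \<omega>"
    unfolding cv using emp_b K0 by (intro divide_nonneg_nonneg sum_nonneg) auto
  moreover have "cv_risk n \<alpha> N c \<Psi> K V \<omega> \<le> 1"
  proof -
    have "cv_risk n \<alpha> N c \<Psi> K V \<omega> \<le> (\<Sum>j=1..K. (\<Sum>i\<in>V j. f i) / real (card (V j)) / \<alpha>) / real K"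
      unfolding cv using emp_b K0 by (intro divide_right_mono sum_mono) auto
    also have "\<dots> = (\<Sum>j=1..K. (\<Sum>i\<in>V j. f i) / real (card (V j))) / \<alpha> / real K"
      by (simp only: sum_divide_distrib[symmetric])
    also have "\<dots> = (\<Sum>j=1..K. (\<Sum>i\<in>V j. f i) / real (card (V j))) / real K / \<alpha>"
      by (simp add: mult.commute)
    also have "\<dots> = (\<Sum>i=1..n. f i) / real k" unfolding folds(1) \<alpha>n[symmetric] by simp
    also have "(\<Sum>i=1..n. f i) = real (card {i\<in>{1..n}. emp_threshold n \<alpha> N \<omega> < N (fst (\<omega> i))})"
      unfolding f_def by (subst sum_of_bool_eq) (auto intro!: arg_cong[of _ _ card])
    also have "\<dots> / real k \<le> 1"
      using card_above_emp_threshold_less[OF k \<alpha>, of N \<omega>] by (simp add: divide_le_eq)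
    finally show ?thesis .
  qed
  moreover have "0 \<le> risk (\<Psi> {1..n} \<omega>) \<and> risk (\<Psi> {1..n} \<omega>) \<le> 1"
    using full_ne \<omega> by (intro risk_bounds \<Psi>_in) auto
  ultimately show ?thesis by linarith
qed

lemma cv_error_measurable:
  "(\<lambda>\<omega>. cv_risk n \<alpha> N c \<Psi> K V \<omega> - risk (\<Psi> {1..n} \<omega>)) \<in> borel_measurable \<Omega>"
proof -
  have Nm: "(\<lambda>\<omega>. N (fst (\<omega> i))) \<in> borel_measurable \<Omega>" if "i \<in> {1..n}" for i
    unfolding sample_measure_def
    by (rule measurable_compose[OF measurable_component_singleton[OF that] norm_measurable])
  have above: "(\<lambda>\<omega>. of_bool (N (fst (\<omega> i)) > emp_threshold n \<alpha> N \<omega>) :: real) \<in> borel_measurable \<Omega>"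
    if i: "i \<in> {1..n}" for i
  proof -
    define Le where "Le = (\<lambda>j. {\<omega> \<in> space \<Omega>. N (fst (\<omega> i)) \<le> N (fst (\<omega> j))})"
    define f where "f = (\<lambda>\<omega>. \<Sum>j=1..n. indicator (Le j) \<omega> :: real)"
    have "Le j \<in> sets \<Omega>" if "j \<in> {1..n}" for j
      unfolding Le_def by (intro borel_measurable_le Nm i that)
    then have "f \<in> borel_measurable \<Omega>"
      unfolding f_def by (intro borel_measurable_sum borel_measurable_indicator) auto
    then have "{\<omega> \<in> space \<Omega>. f \<omega> < real k} \<in> sets \<Omega>" by (intro borel_measurable_less borel_measurable_const)
    then have "(\<lambda>\<omega>. indicator {\<omega> \<in> space \<Omega>. f \<omega> < real k} \<omega> :: real) \<in> borel_measurable \<Omega>"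
      by (intro borel_measurable_indicator)
    moreover have "indicator {\<omega> \<in> space \<Omega>. f \<omega> < real k} \<omega> = (of_bool (N (fst (\<omega> i)) > emp_threshold n \<alpha> N \<omega>) :: real)"
      if "\<omega> \<in> space \<Omega>" for \<omega>
    proof -
      have "f \<omega> = (\<Sum>j=1..n. of_bool (N (fst (\<omega> i)) \<le> N (fst (\<omega> j))))"
        unfolding f_def Le_def using that by (intro sum.cong) (auto simp: indicator_def)
      also have "\<dots> = real (card {j\<in>{1..n}. N (fst (\<omega> i)) \<le> N (fst (\<omega> j))})"
        by (subst sum_of_bool_eq) (auto intro!: arg_cong[of _ _ card])
      finally have "f \<omega> < real k \<longleftrightarrow> emp_threshold n \<alpha> N \<omega> < N (fst (\<omega> i))"
        unfolding emp_threshold_less_iff[OF k \<alpha>] by simp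
      then show ?thesis using that by (simp add: indicator_def)
    qed
    ultimately show ?thesis by (subst measurable_cong) auto
  qed
  have "(\<lambda>\<omega>. cv_risk n \<alpha> N c \<Psi> K V \<omega>) \<in> borel_measurable \<Omega>"
    unfolding cv_risk_def emp_risk_def T_def[symmetric]
  proof (intro borel_measurable_times borel_measurable_const borel_measurable_sum)
    fix j i assume j: "j \<in> {1..K}" and "i \<in> V j"
    then have i: "i \<in> {1..n}" using folds(3) by blast
    show "(\<lambda>\<omega>. c (\<Psi> (T j) \<omega>) (\<omega> i)) \<in> borel_measurable \<Omega>"
      using T_subset T_ne[OF j] i by (rule eval_measurable)
    show "(\<lambda>\<omega>. of_bool (N (fst (\<omega> i)) > emp_threshold n \<alpha> N \<omega>) :: real) \<in> borel_measurable \<Omega>"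
      using i by (rule above)
  qed
  moreover have "(\<lambda>\<omega>. risk (\<Psi> {1..n} \<omega>)) \<in> borel_measurable \<Omega>"
  proof (subst measurable_cong)
    show "risk (\<Psi> {1..n} \<omega>) = (\<integral>x. c (\<Psi> {1..n} \<omega>) x * indicator R x \<partial>P) / \<alpha>" if "\<omega> \<in> space \<Omega>" for \<omega>
      using full_ne that by (intro risk_eq \<Psi>_in) auto
    show "(\<lambda>\<omega>. (\<integral>x. c (\<Psi> {1..n} \<omega>) x * indicator R x \<partial>P) / \<alpha>) \<in> borel_measurable \<Omega>"
      using full_ne by (intro borel_measurable_divide borel_measurable_const trimmed_integral_measurable) auto
  qed
  ultimately show ?thesis by (rule borel_measurable_diff)
qed

definition fold_of :: "nat \<Rightarrow> nat" where
  "fold_of i = (THE j. j \<in> {1..K} \<and> i \<in> V j)"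

lemma fold_of_eq: "j \<in> {1..K} \<Longrightarrow> i \<in> V j \<Longrightarrow> fold_of i = j"
  using V unfolding fold_of_def kfold_def disjoint_family_on_def
  by (intro the_equality) blast+

lemma fold_of_in: "i \<in> {1..n} \<Longrightarrow> fold_of i \<in> {1..K}"
  using V fold_of_eq unfolding kfold_def by (metis UN_E)

lemma fold_ne: "j \<in> {1..K} \<Longrightarrow> V j \<noteq> {}"
  using folds(4)[of j] n_pos K by auto

lemma fold_finite: "j \<in> {1..K} \<Longrightarrow> finite (V j)"
  using folds(3) finite_subset by blast

text \<open>
All validation deviations are one deviation on the whole sample, with one block for each fold.
\<close>

lemma dev_valid:
  assumes \<omega>: "\<omega> \<in> space \<Omega>"
  shows "dev (\<lambda>i. T (fold_of i)) {1..n} \<omega> = real k * valid_dev \<omega>"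
proof -
  have "dev (\<lambda>i. T (fold_of i)) {1..n} \<omega> = (\<Sum>j=1..K. dev (\<lambda>i. T (fold_of i)) (V j) \<omega>)"
    unfolding dev_def by (rule folds(6)[symmetric])
  also have "\<dots> = (\<Sum>j=1..K. \<alpha> * real (card (V j)) * (trim_risk (\<Psi> (T j) \<omega>) (V j) \<omega> - risk (\<Psi> (T j) \<omega>)))"
    using T_subset T_ne \<omega> fold_ne fold_finite fold_of_eq by (intro sum.cong refl dev_const) auto
  also have "\<dots> = (\<Sum>j=1..K. real k / real K * (trim_risk (\<Psi> (T j) \<omega>) (V j) \<omega> - risk (\<Psi> (T j) \<omega>)))"
    by (intro sum.cong refl) (simp add: folds(4) \<alpha>n[symmetric] mult.commute)
  also have "\<dots> = real k / real K * (\<Sum>j=1..K. trim_risk (\<Psi> (T j) \<omega>) (V j) \<omega> - risk (\<Psi> (T j) \<omega>))"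
    by (rule sum_distrib_left[symmetric])
  also have "\<dots> = real k * valid_dev \<omega>" by (simp add: valid_dev_def)
  finally show ?thesis .
qed

lemma dev_train:
  assumes \<omega>: "\<omega> \<in> space \<Omega>"
  shows "(\<Sum>j=1..K. dev (\<lambda>_. T j) (T j) \<omega>) / real K = \<alpha> * real (card (T 1)) * train_dev \<omega>"
proof -
  have "1 \<in> {1..K}" using K by auto
  then have cT: "real (card (T j)) = real (card (T 1))" if "j \<in> {1..K}" for j
    using card_T that by simp
  have "(\<Sum>j=1..K. dev (\<lambda>_. T j) (T j) \<omega>)
      = (\<Sum>j=1..K. \<alpha> * real (card (T j)) * (trim_risk (\<Psi> (T j) \<omega>) (T j) \<omega> - risk (\<Psi> (T j) \<omega>)))"
    using T_subset T_ne \<omega> finite_subset[OF T_subset] by (intro sum.cong refl dev_const) auto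
  also have "\<dots> = (\<Sum>j=1..K. \<alpha> * real (card (T 1)) * (trim_risk (\<Psi> (T j) \<omega>) (T j) \<omega> - risk (\<Psi> (T j) \<omega>)))"
    by (intro sum.cong refl) (simp only: cT)
  finally show ?thesis by (simp add: train_dev_def sum_distrib_left[symmetric])
qed

lemma dev_full:
  assumes \<omega>: "\<omega> \<in> space \<Omega>"
  shows "dev (\<lambda>_. {1..n}) {1..n} \<omega> = real k * full_dev \<omega>"
  using dev_const[of "{1..n}" \<omega> "{1..n}" "\<lambda>_. {1..n}"] full_ne \<omega> \<alpha>n
  by (simp add: full_dev_def mult.commute)

lemma fold_1: "1 \<in> {1..K}"
  using K by auto

text \<open>
As \<open>K\<close> is at least \<open>2\<close>, training sets contain at least half of the sample.
\<close>

lemma card_train: "real n * \<alpha> / 2 \<le> real (card (T 1)) * \<alpha>"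
proof -
  have "real n / real K \<le> real n / 2" using K by (intro divide_left_mono) auto
  then have "real n / 2 \<le> real (card (T 1))" unfolding card_T[OF fold_1] by linarith
  then show ?thesis using \<alpha>_pos by simp
qed

lemma high_probability_event:
  assumes l: "0 \<le> l" and \<Lambda>: "\<Lambda> = l + 40 * real K * real v" "\<Lambda> \<le> real k"
  defines "w \<equiv> card (T 1)"
  shows "measure \<Omega> {\<omega> \<in> space \<Omega>. \<bar>real k * valid_dev \<omega>\<bar> \<le> 6 * sqrt (real k * \<Lambda>)
      \<and> \<bar>\<alpha> * real w * train_dev \<omega>\<bar> \<le> 6 * sqrt (real w * \<alpha> * \<Lambda>)
      \<and> \<bar>real k * full_dev \<omega>\<bar> \<le> 6 * sqrt (real k * \<Lambda>)
      \<and> \<bar>(\<Sum>i=1..n. indicator R (\<omega> i)) - real k\<bar> \<le> 2 * sqrt (real k * l)} \<ge> 1 - 8 * exp (- l)"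
proof -
  interpret O: prob_space \<Omega> by (rule prob_\<Omega>)
  define dA where "dA = (\<lambda>\<omega>. dev (\<lambda>i. T (fold_of i)) {1..n} \<omega>)"
  define dB where "dB = (\<lambda>\<omega>. (\<Sum>j=1..K. dev (\<lambda>_. T j) (T j) \<omega>) / real K)"
  define dC where "dC = (\<lambda>\<omega>. dev (\<lambda>_. {1..n}) {1..n} \<omega>)"
  define dD where "dD = (\<lambda>\<omega>. (\<Sum>i=1..n. indicator R (\<omega> i)) - real k)"
  have finT: "finite (T j)" for j using T_subset finite_subset by blast
  have kw: "real n * \<alpha> = real k" by (rule \<alpha>n)
  have wk: "real k / 2 \<le> real w * \<alpha>" using card_train by (simp add: kw w_def)
  have \<Lambda>w: "2 * \<Lambda> \<le> 9 * real n * \<alpha>" "2 * \<Lambda> \<le> 9 * real w * \<alpha>"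
    using \<Lambda>(2) wk kw by (simp_all add: mult.assoc)
  have "0 \<le> 40 * real K * real v" by simp
  with \<Lambda> have l_le: "l \<le> real k" by linarith
  have tailA: "measure \<Omega> {\<omega> \<in> space \<Omega>. 6 * sqrt (real k * \<Lambda>) < \<epsilon> * dA \<omega>} \<le> exp (- l)" if "\<epsilon> \<in> {-1, 1}" for \<epsilon>
  proof -
    have "card ((\<lambda>i. T (fold_of i)) ` {1..n}) \<le> card (T ` {1..K})"
      using fold_of_in by (intro card_mono) auto
    also have "\<dots> \<le> K" using card_image_le[of "{1..K}" T] by simp
    finally have "card ((\<lambda>i. T (fold_of i)) ` {1..n}) \<le> K" .
    then show ?thesis
      using mean_dev_tail[where J = "{0::nat}" and W = "\<lambda>_. {1..n}" and \<tau> = "\<lambda>_ i. T (fold_of i)" and w = n,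
          OF _ _ _ _ _ _ that l \<Lambda>(1) \<Lambda>w(1)] T_subset T_ne fold_of_in
      by (simp add: dA_def kw)
  qed
  have tailB: "measure \<Omega> {\<omega> \<in> space \<Omega>. 6 * sqrt (real w * \<alpha> * \<Lambda>) < \<epsilon> * dB \<omega>} \<le> exp (- l)" if "\<epsilon> \<in> {-1, 1}" for \<epsilon>
  proof -
    have "card (T j) = w" if "j \<in> {1..K}" for j
      using card_T[OF that] card_T[OF fold_1] by (simp add: w_def)
    moreover have "card ((\<lambda>_. T j) ` T j) \<le> K" for j
      using K by (simp add: image_constant_conv)
    ultimately show ?thesis
      using mean_dev_tail[where J = "{1..K}" and W = T and \<tau> = "\<lambda>j _. T j" and w = w,
          OF _ _ _ _ _ _ that l \<Lambda>(1) \<Lambda>w(2)] T_subset T_ne K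
      by (simp add: dB_def)
  qed
  have tailC: "measure \<Omega> {\<omega> \<in> space \<Omega>. 6 * sqrt (real k * \<Lambda>) < \<epsilon> * dC \<omega>} \<le> exp (- l)" if "\<epsilon> \<in> {-1, 1}" for \<epsilon>
  proof -
    have "card ((\<lambda>_. {1..n}) ` {1..n}) \<le> K"
      using K by (simp add: image_constant_conv)
    then show ?thesis
      using mean_dev_tail[where J = "{0::nat}" and W = "\<lambda>_. {1..n}" and \<tau> = "\<lambda>_ _. {1..n}" and w = n,
          OF _ _ _ _ _ _ that l \<Lambda>(1) \<Lambda>w(1)] full_ne
      by (simp add: dC_def kw)
  qed
  have tailD: "measure \<Omega> {\<omega> \<in> space \<Omega>. 2 * sqrt (real k * l) < \<epsilon> * dD \<omega>} \<le> exp (- l)" if "\<epsilon> \<in> {-1, 1}" for \<epsilon>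
    using count_deviation_tail[OF P R_sets, of "{1..n}" l \<epsilon>] l l_le that
    by (simp add: sample_measure_def prob_R kw dD_def)
  have meas: "dA \<in> borel_measurable \<Omega>" "dB \<in> borel_measurable \<Omega>" "dC \<in> borel_measurable \<Omega>" "dD \<in> borel_measurable \<Omega>"
  proof -
    show "dA \<in> borel_measurable \<Omega>"
      unfolding dA_def using T_subset T_ne fold_of_in by (intro dev_measurable) auto
    show "dB \<in> borel_measurable \<Omega>"
      unfolding dB_def using T_subset T_ne
      by (intro borel_measurable_divide borel_measurable_sum borel_measurable_const dev_measurable) auto
    show "dC \<in> borel_measurable \<Omega>"
      unfolding dC_def using full_ne by (intro dev_measurable) auto
    show "dD \<in> borel_measurable \<Omega>"
      unfolding dD_def by (intro borel_measurable_diff borel_measurable_sum borel_measurable_const indicator_R_measurable)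
  qed
  define bad where "bad = (\<lambda>y f. {\<omega> \<in> space \<Omega>. y < (1::real) * f \<omega>} \<union> {\<omega> \<in> space \<Omega>. y < (-1) * f \<omega>})"
  have bad_sets: "bad y f \<in> sets \<Omega>" if "f \<in> borel_measurable \<Omega>" for y f
    unfolding bad_def using that by measurable
  have bad_prob: "measure \<Omega> (bad y f) \<le> 2 * exp (- l)"
    if "f \<in> borel_measurable \<Omega>" "\<And>\<epsilon>. \<epsilon> \<in> {-1, 1} \<Longrightarrow> measure \<Omega> {\<omega> \<in> space \<Omega>. y < \<epsilon> * f \<omega>} \<le> exp (- l)" for y f
  proof -
    have "measure \<Omega> (bad y f) \<le> measure \<Omega> {\<omega> \<in> space \<Omega>. y < 1 * f \<omega>} + measure \<Omega> {\<omega> \<in> space \<Omega>. y < (-1) * f \<omega>}"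
      unfolding bad_def using that(1) by (intro measure_Un_le; measurable)
    with that(2)[of 1] that(2)[of "-1"] show ?thesis by simp
  qed
  define Bad where "Bad = bad (6 * sqrt (real k * \<Lambda>)) dA \<union> bad (6 * sqrt (real w * \<alpha> * \<Lambda>)) dB
      \<union> bad (6 * sqrt (real k * \<Lambda>)) dC \<union> bad (2 * sqrt (real k * l)) dD"
  have Bad_sets: "Bad \<in> sets \<Omega>" unfolding Bad_def using bad_sets meas by auto
  have "measure \<Omega> Bad \<le> 2 * exp (- l) + 2 * exp (- l) + 2 * exp (- l) + 2 * exp (- l)"
    unfolding Bad_def using bad_sets meas tailA tailB tailC tailD
    by (intro order_trans[OF measure_Un_le] add_mono bad_prob sets.Un) auto
  then have "1 - 8 * exp (- l) \<le> measure \<Omega> (space \<Omega> - Bad)"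
    using O.prob_compl[OF Bad_sets] by simp
  also have "space \<Omega> - Bad = {\<omega> \<in> space \<Omega>. \<bar>dA \<omega>\<bar> \<le> 6 * sqrt (real k * \<Lambda>) \<and> \<bar>dB \<omega>\<bar> \<le> 6 * sqrt (real w * \<alpha> * \<Lambda>)
      \<and> \<bar>dC \<omega>\<bar> \<le> 6 * sqrt (real k * \<Lambda>) \<and> \<bar>dD \<omega>\<bar> \<le> 2 * sqrt (real k * l)}"
    by (auto simp: Bad_def bad_def abs_le_iff not_less)
  also have "\<dots> = {\<omega> \<in> space \<Omega>. \<bar>real k * valid_dev \<omega>\<bar> \<le> 6 * sqrt (real k * \<Lambda>)
      \<and> \<bar>\<alpha> * real w * train_dev \<omega>\<bar> \<le> 6 * sqrt (real w * \<alpha> * \<Lambda>)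
      \<and> \<bar>real k * full_dev \<omega>\<bar> \<le> 6 * sqrt (real k * \<Lambda>)
      \<and> \<bar>(\<Sum>i=1..n. indicator R (\<omega> i)) - real k\<bar> \<le> 2 * sqrt (real k * l)}"
    by (intro Collect_cong conj_cong refl)
      (simp_all only: dA_def dB_def dC_def dD_def dev_valid dev_train dev_full w_def)
  finally show ?thesis .
qed

lemma AE_mismatch_le:
  "AE \<omega> in \<Omega>. (\<Sum>i=1..n. mismatch \<omega> i) \<le> \<bar>(\<Sum>i=1..n. indicator R (\<omega> i)) - real k\<bar> + 1"
proof -
  have "AE \<omega> in \<Omega>. \<forall>i\<in>{1..n}. \<forall>j\<in>{1..n}. N (fst (\<omega> i)) = N (fst (\<omega> j)) \<longrightarrow> t \<le> N (fst (\<omega> i)) \<longrightarrow> i = j"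
    unfolding sample_measure_def using no_atom by (intro AE_no_ties P norm_measurable) (auto simp: t_def)
  then show ?thesis using AE_space
  proof eventually_elim
    case (elim \<omega>)
    have ind: "indicator R (\<omega> i) = (of_bool (t \<le> N (fst (\<omega> i))) :: real)" if "i \<in> {1..n}" for i
      using space_\<Omega>[OF elim(2) that] by (simp add: R_def indicator_def)
    have "(\<Sum>i=1..n. mismatch \<omega> i)
        = (\<Sum>i=1..n. \<bar>of_bool (N (fst (\<omega> i)) > emp_threshold n \<alpha> N \<omega>) - of_bool (t \<le> N (fst (\<omega> i)))\<bar>)"
      unfolding mismatch_def by (intro sum.cong refl) (simp only: ind)
    also have "\<dots> \<le> \<bar>(\<Sum>i=1..n. of_bool (t \<le> N (fst (\<omega> i)))) - real k\<bar> + 1"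
      using elim(1) by (intro sum_threshold_mismatch_le k \<alpha>) blast
    also have "(\<Sum>i=1..n. of_bool (t \<le> N (fst (\<omega> i)))) = (\<Sum>i=1..n. indicator R (\<omega> i) :: real)"
      by (intro sum.cong refl) (simp only: ind)
    finally show ?case .
  qed
qed

text \<open>
The choice of the constant: the square root of \<open>40\<close> that comes with the VC-dimension is rounded to \<open>7\<close>, and
\<open>7 * (6 + 6 * sqrt 2 + 6)\<close> is below \<open>5 * 100\<close>.
\<close>

lemma sum_of_deviations_le:
  fixes a b e D :: real
  assumes l: "0 \<le> l" and \<Lambda>: "\<Lambda> = l + 40 * real K * real v"
    and a: "\<bar>real k * a\<bar> \<le> 6 * sqrt (real k * \<Lambda>)"
    and b: "\<bar>\<alpha> * real (card (T 1)) * b\<bar> \<le> 6 * sqrt (real (card (T 1)) * \<alpha> * \<Lambda>)"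
    and e: "\<bar>real k * e\<bar> \<le> 6 * sqrt (real k * \<Lambda>)"
    and D: "D \<le> 2 * sqrt (real k * l) + 1"
  shows "\<bar>a\<bar> + \<bar>b\<bar> + \<bar>e\<bar> + 3 * (D / real k)
    \<le> E_kfold 100 v n K \<alpha> + 20 / (3 * real n * \<alpha>) * l + 20 * sqrt (2 / (real n * \<alpha>) * l)"
proof -
  have \<Lambda>0: "0 \<le> \<Lambda>" using l by (simp add: \<Lambda>)
  have k0: "0 < real k" using k by simp
  have scaled: "\<bar>x\<bar> \<le> C * sqrt (y / u)" if "\<bar>u * x\<bar> \<le> C * sqrt (u * y)" "0 < u" "0 \<le> y" for u x C y :: real
  proof -
    have "sqrt (u * y) = u * sqrt (y / u)" using that(2) by (rule sqrt_mult_eq)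
    with that have "u * \<bar>x\<bar> \<le> u * (C * sqrt (y / u))" by (simp add: abs_mult mult_ac)
    with that(2) show ?thesis by simp
  qed
  define q where "q = sqrt (\<Lambda> / real k)"
  define p where "p = sqrt (l / real k)"
  define u where "u = sqrt (real v * real K / real k)"
  have pq: "0 \<le> q" "0 \<le> p" "0 \<le> u" using \<Lambda>0 l k0 by (simp_all add: q_def p_def u_def)
  have sqrt2: "14 / 10 \<le> sqrt 2" "sqrt 2 \<le> 142 / 100"
    by (rule real_le_rsqrt, simp add: power2_eq_square) (rule real_le_lsqrt, simp_all add: power2_eq_square)
  have sqrt40: "sqrt 40 \<le> 7" by (rule real_le_lsqrt) simp_all
  have A: "\<bar>a\<bar> \<le> 6 * q" using scaled[OF a k0 \<Lambda>0] by (simp add: q_def)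
  have E: "\<bar>e\<bar> \<le> 6 * q" using scaled[OF e k0 \<Lambda>0] by (simp add: q_def)
  have B: "\<bar>b\<bar> \<le> 6 * (sqrt 2 * q)"
  proof -
    have w: "real k / 2 \<le> real (card (T 1)) * \<alpha>" using card_train by (simp add: \<alpha>n)
    then have w0: "0 < real (card (T 1)) * \<alpha>" using k0 by linarith
    have "\<bar>b\<bar> \<le> 6 * sqrt (\<Lambda> / (real (card (T 1)) * \<alpha>))"
      using scaled[OF _ w0 \<Lambda>0, of b 6] b by (simp add: mult.commute)
    also have "\<dots> \<le> 6 * sqrt (\<Lambda> / (real k / 2))"
      using w w0 k0 \<Lambda>0 by (intro mult_left_mono real_sqrt_le_mono divide_left_mono) auto
    also have "\<Lambda> / (real k / 2) = 2 * (\<Lambda> / real k)" by simp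
    also have "6 * sqrt (2 * (\<Lambda> / real k)) = 6 * (sqrt 2 * q)" by (simp only: q_def real_sqrt_mult)
    finally show ?thesis .
  qed
  have q: "q \<le> p + 7 * u"
  proof -
    have "q = sqrt (l / real k + 40 * (real v * real K / real k))"
      by (simp add: q_def \<Lambda> add_divide_distrib mult_ac)
    also have "\<dots> \<le> sqrt (l / real k) + sqrt (40 * (real v * real K / real k))"
      using l by (intro sqrt_add_le_add_sqrt) auto
    also have "sqrt (40 * (real v * real K / real k)) = sqrt 40 * u" by (simp only: u_def real_sqrt_mult)
    also have "\<dots> \<le> 7 * u" using sqrt40 pq by (intro mult_right_mono)
    finally show ?thesis by (simp add: p_def)
  qed
  have D': "D / real k \<le> 2 * p + 1 / real k"
  proof -
    have "sqrt (real k * l) = real k * p" unfolding p_def using k0 by (rule sqrt_mult_eq)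
    then have "D / real k \<le> (2 * (real k * p) + 1) / real k" using D k0 by (intro divide_right_mono) auto
    also have "\<dots> = 2 * p + 1 / real k" using k0 by (simp add: add_divide_distrib)
    finally show ?thesis .
  qed
  have sqrt2q: "sqrt 2 * q \<le> 142 / 100 * q" using sqrt2 pq by (intro mult_right_mono)
  have sqrt2p: "14 / 10 * p \<le> sqrt 2 * p" using sqrt2 pq by (intro mult_right_mono)
  have Ekfold: "500 * u + 3 * (1 / real k) \<le> E_kfold 100 v n K \<alpha>"
  proof -
    have "5 * real K / ((real K - 1) * real n * \<alpha>) = 5 * (real K / (real K - 1)) * (1 / real k)"
      using \<alpha>n by (simp add: mult.assoc)
    moreover have "3 \<le> 5 * (real K / (real K - 1))" using K by (simp add: field_simps)
    then have "3 * (1 / real k) \<le> 5 * (real K / (real K - 1)) * (1 / real k)"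
      using k0 by (intro mult_right_mono) auto
    ultimately show ?thesis unfolding E_kfold_def u_def \<alpha>n by linarith
  qed
  have "sqrt (2 / (real n * \<alpha>) * l) = sqrt 2 * p"
    unfolding \<alpha>n p_def real_sqrt_mult[symmetric] by simp
  moreover have "0 \<le> 20 / (3 * real n * \<alpha>) * l" using l \<alpha>_pos by simp
  ultimately show ?thesis
    using A B E q D' sqrt2q sqrt2p Ekfold pq by linarith
qed

text \<open>
If the bound is at least \<open>1\<close>, it holds trivially. Otherwise its two square roots are so small that the
exponents satisfy the smallness condition of the tail bounds.
\<close>

lemma deviation_bound:
  assumes \<delta>: "0 < \<delta>" "\<delta> < 1"
  defines "bound \<equiv> E_kfold 100 v n K \<alpha> + 20 / (3 * real n * \<alpha>) * ln (1 / \<delta>) + 20 * sqrt (2 / (real n * \<alpha>) * ln (1 / \<delta>))"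
  shows "measure \<Omega> {\<omega> \<in> space \<Omega>. \<bar>cv_risk n \<alpha> N c \<Psi> K V \<omega> - risk (\<Psi> {1..n} \<omega>)\<bar> \<le> bound} \<ge> 1 - 15 * \<delta>"
proof -
  interpret O: prob_space \<Omega> by (rule prob_\<Omega>)
  define l where "l = ln (1 / \<delta>)"
  define \<Lambda> where "\<Lambda> = l + 40 * real K * real v"
  have l0: "0 \<le> l" and exp_l: "exp (- l) = \<delta>" using \<delta> by (auto simp: l_def ln_div)
  define good where "good = {\<omega> \<in> space \<Omega>. \<bar>cv_risk n \<alpha> N c \<Psi> K V \<omega> - risk (\<Psi> {1..n} \<omega>)\<bar> \<le> bound}"
  have good_sets: "good \<in> sets \<Omega>"
    unfolding good_def by (intro borel_measurable_le borel_measurable_abs cv_error_measurable borel_measurable_const)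
  have k0: "0 < real k" using k by simp
  have "1 - 15 * \<delta> \<le> measure \<Omega> good"
  proof (cases "1 \<le> bound")
    case True
    then have "good = space \<Omega>" using cv_error_le_1 by (fastforce simp: good_def)
    then show ?thesis using \<delta> by (simp add: O.prob_space)
  next
    case False
    define u where "u = sqrt (real v * real K / real k)"
    have u0: "0 \<le> u" by (simp add: u_def)
    have "0 \<le> 20 / (3 * real n * \<alpha>) * l" using l0 \<alpha>_pos by simp
    moreover have "0 \<le> 5 * real K / ((real K - 1) * real n * \<alpha>)" using K \<alpha>_pos by simp
    moreover have "0 \<le> sqrt (2 / real k * l)" using l0 by simp
    ultimately have "500 * u < 1" "20 * sqrt (2 / real k * l) < 1"
      using False u0 unfolding bound_def E_kfold_def l_def[symmetric] \<alpha>n u_def by linarith+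
    then have "u\<^sup>2 \<le> (1 / 500)\<^sup>2" "(sqrt (2 / real k * l))\<^sup>2 \<le> (1 / 20)\<^sup>2"
      using u0 l0 by (intro power_mono; simp)+
    then have "real v * real K / real k \<le> 1 / 250000" "2 / real k * l \<le> 1 / 400"
      using l0 by (simp_all add: u_def power2_eq_square)
    then have "real v * real K \<le> real k / 250000" "2 * l \<le> real k / 400"
      using k0 by (simp_all add: field_simps)
    then have \<Lambda>k: "\<Lambda> \<le> real k" unfolding \<Lambda>_def by (simp add: mult_ac)
    let ?w = "card (T 1)"
    let ?ev = "{\<omega> \<in> space \<Omega>. \<bar>real k * valid_dev \<omega>\<bar> \<le> 6 * sqrt (real k * \<Lambda>)
      \<and> \<bar>\<alpha> * real ?w * train_dev \<omega>\<bar> \<le> 6 * sqrt (real ?w * \<alpha> * \<Lambda>)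
      \<and> \<bar>real k * full_dev \<omega>\<bar> \<le> 6 * sqrt (real k * \<Lambda>)
      \<and> \<bar>(\<Sum>i=1..n. indicator R (\<omega> i)) - real k\<bar> \<le> 2 * sqrt (real k * l)}"
    have "1 - 15 * \<delta> \<le> 1 - 8 * exp (- l)" using \<delta> by (simp add: exp_l)
    also have "\<dots> \<le> measure \<Omega> ?ev" using l0 \<Lambda>_def \<Lambda>k by (rule high_probability_event)
    also have "\<dots> \<le> measure \<Omega> good"
    proof (rule O.finite_measure_mono_AE[OF _ good_sets])
      show "AE \<omega> in \<Omega>. \<omega> \<in> ?ev \<longrightarrow> \<omega> \<in> good"
        using AE_mismatch_le
      proof eventually_elim
        case (elim \<omega>)
        show ?case
        proof
          assume ev: "\<omega> \<in> ?ev"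
          then have \<omega>: "\<omega> \<in> space \<Omega>" by blast
          have "\<bar>valid_dev \<omega>\<bar> + \<bar>train_dev \<omega>\<bar> + \<bar>full_dev \<omega>\<bar> + 3 * ((\<Sum>i=1..n. mismatch \<omega> i) / real k) \<le> bound"
            unfolding bound_def l_def[symmetric] using ev elim
            by (intro sum_of_deviations_le[OF l0 \<Lambda>_def]) auto
          with cv_error_decomposition[OF \<omega>] \<omega> show "\<omega> \<in> good" unfolding good_def by simp
        qed
      qed
    qed
    finally show ?thesis .
  qed
  then show ?thesis by (simp add: good_def)
qed

end

theorem corollary3p1:
  "\<exists>M::real. M > 0 \<and>
    (\<forall>(d::nat) (X :: vect set) (N :: vect \<Rightarrow> real) (P :: obs measure) (n::nat) (k::nat) (\<alpha>::real)
      (G :: (vect \<Rightarrow> real) set) (c :: (vect \<Rightarrow> real) \<Rightarrow> obs \<Rightarrow> real)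
      (\<Psi> :: nat set \<Rightarrow> (nat \<Rightarrow> obs) \<Rightarrow> (vect \<Rightarrow> real)) (v::nat) (K::nat) (V :: nat \<Rightarrow> nat set).
      X \<subseteq> space (borel_vect d) \<longrightarrow>
      norm_on d N \<longrightarrow>
      prob_space P \<longrightarrow>
      sets P = sets (obs_space d X) \<longrightarrow>
      1 \<le> k \<longrightarrow> k \<le> n \<longrightarrow> \<alpha> = real k / real n \<longrightarrow>
      measure P {z \<in> space P. N (fst z) \<ge> tail_quantile N P \<alpha>} = \<alpha> \<longrightarrow>
      (\<forall>t\<ge>tail_quantile N P \<alpha>. measure P {z \<in> space P. N (fst z) = t} = 0) \<longrightarrow>
      (\<forall>g\<in>G. \<forall>g'\<in>G. \<forall>x\<in>X. \<forall>y\<in>{-1, 1}. g x = g' x \<longrightarrow> c g (x, y) = c g' (x, y)) \<longrightarrow>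
      (\<forall>g\<in>G. c g \<in> borel_measurable P) \<longrightarrow>
      learning_rule n \<alpha> N P G c \<Psi> \<longrightarrow>
      cond_erm n \<alpha> N P G c \<Psi> \<longrightarrow>
      vc_dim ((\<lambda>g. subgraph (X \<times> {-1, 1}) (c g)) ` G) = enat v \<longrightarrow>
      (\<forall>g\<in>G. \<forall>z\<in>X \<times> {-1, 1}. 0 \<le> c g z \<and> c g z \<le> 1) \<longrightarrow>
      2 \<le> K \<longrightarrow> K dvd n \<longrightarrow>
      kfold n K V \<longrightarrow>
      (\<forall>\<delta>::real. 0 < \<delta> \<and> \<delta> < 1 \<longrightarrow>
        measure (sample_measure n P)
          {\<omega> \<in> space (sample_measure n P).
             \<bar>cv_risk n \<alpha> N c \<Psi> K V \<omega> - cond_risk N P \<alpha> c (\<Psi> {1..n} \<omega>)\<bar>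
             \<le> E_kfold M v n K \<alpha>
                + 20 / (3 * real n * \<alpha>) * ln (1 / \<delta>)
                + 20 * sqrt (2 / (real n * \<alpha>) * ln (1 / \<delta>))}
        \<ge> 1 - 15 * \<delta>))"
proof (intro exI[of _ 100] conjI allI impI)
  fix d X N P n k \<alpha> G v K V
    and c :: "(vect \<Rightarrow> real) \<Rightarrow> obs \<Rightarrow> real"
    and \<Psi> :: "nat set \<Rightarrow> (nat \<Rightarrow> obs) \<Rightarrow> (vect \<Rightarrow> real)" and \<delta> :: real
  assume *: "X \<subseteq> space (borel_vect d)" "norm_on d N" "prob_space P" "sets P = sets (obs_space d X)"
    "1 \<le> k" "k \<le> n" "\<alpha> = real k / real n"
    "measure P {z \<in> space P. N (fst z) \<ge> tail_quantile N P \<alpha>} = \<alpha>"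
    "\<forall>t\<ge>tail_quantile N P \<alpha>. measure P {z \<in> space P. N (fst z) = t} = 0"
    "\<forall>g\<in>G. c g \<in> borel_measurable P"
    "learning_rule n \<alpha> N P G c \<Psi>" "cond_erm n \<alpha> N P G c \<Psi>"
    "vc_dim ((\<lambda>g. subgraph (X \<times> {-1, 1}) (c g)) ` G) = enat v"
    "\<forall>g\<in>G. \<forall>z\<in>X \<times> {-1, 1}. 0 \<le> c g z \<and> c g z \<le> 1"
    "2 \<le> K" "K dvd n" "kfold n K V"
    and \<delta>: "0 < \<delta> \<and> \<delta> < 1"
  interpret cross_validated_erm d X N P n k \<alpha> G c \<Psi> v K V
    by (rule cross_validated_erm.intro)
      (fact *(1-8) *(9)[rule_format] *(10)[rule_format] *(11-13) *(14)[rule_format] *(15-17))+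
  show "1 - 15 * \<delta> \<le> measure (sample_measure n P)
      {\<omega> \<in> space (sample_measure n P). \<bar>cv_risk n \<alpha> N c \<Psi> K V \<omega> - cond_risk N P \<alpha> c (\<Psi> {1..n} \<omega>)\<bar>
        \<le> E_kfold 100 v n K \<alpha> + 20 / (3 * real n * \<alpha>) * ln (1 / \<delta>)
          + 20 * sqrt (2 / (real n * \<alpha>) * ln (1 / \<delta>))}"
    using \<delta> by (intro deviation_bound) auto
qed simp

end
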